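(* Let $X=(x_1,\ldots,x_N)$ be a list of vectors spanning $U\cong\mathbb{R}^r$ and let $\mathbb{B}'\subseteq\mathbb{B}(X)$ be a non-empty set of bases with the forward exchange property. Then the generalised $\mathcal{D}$-space $\mathcal{D}(X,\mathbb{B}')$ and the generalised $\mathcal{P}$-space $\mathcal{P}(X,\mathbb{B}')$ are dual via the pairing $\langle\cdot,\cdot\rangle$ (i.e. $f\mapsto\langle\cdot,f\rangle$ is an isomorphism $\mathcal{D}(X,\mathbb{B}')\to\mathcal{P}(X,\mathbb{B}')^*$). Moreover $\{\det(B)R^B_{X\setminus E(B)} : B\in\mathbb{B}'\}$ is a basis of $\mathcal{D}(X,\mathbb{B}')$, and it is dual to the basis $\{Q_B: B\in\mathbb{B}'\}$ of $\mathcal{P}(X,\mathbb{B}')$, i.e. $\langle Q_B,\det(D)R^D_{X\setminus E(D)}\rangle=\delta_{B,D}$ for $B,D\in\mathbb{B}'$.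
   Context: $U$ is a real vector space of dimension $r$ with a fixed basis $(s_1,\ldots,s_r)$, used to identify $U$ with $\mathbb{R}^r$ (Lebesgue measure and determinants are taken with respect to it). $V=U^*$ with dual basis $(t_1,\ldots,t_r)$; $\mathrm{Sym}(U)=\mathbb{R}[s_1,\ldots,s_r]$, $\mathrm{Sym}(V)=\mathbb{R}[t_1,\ldots,t_r]$ (polynomial functions on $U$). For $u=\sum\lambda_is_i$ let $p_u=\sum\lambda_is_i\in\mathrm{Sym}(U)$, $p_Y=\prod_{y\in Y}p_y$. Pairing $\langle p,f\rangle=(p(\partial/\partial t_1,\ldots,\partial/\partial t_r)f)(0)$; $p_u$ acts as directional derivative $D_u$, $D_Y=\prod_{y\in Y}D_y$. Lists are ordered by position ($x_i<x_j$ iff $i<j$); sublists are determined by positions. $\mathbb{B}(X)$: sublists of $X$ forming a basis of $U$, ordered as in $X$. For $B\in\mathbb{B}(X)$, $x\in X\setminus B$ is externally active if $x\in\mathrm{span}\{b\in B:b<x\}$; $E(B)$ is the sublist of these. For $B=(b_1,\ldots,b_r)$ put $S_0^B=\{0\}$, $S_i^B=\mathrm{span}(b_1,\ldots,b_i)$. Forward exchange property of $\mathbb{B}'$: for every $B=(b_1,\ldots,b_r)\in\mathbb{B}'$, every $i\in\{1,\ldots,r\}$ and every element $x$ of $X$ with $x\in S_i^B\setminus S_{i-1}^B$ and $x\notin E(B)$, the list $(B\setminus b_i)\cup x$ is in $\mathbb{B}'$. A $\mathbb{B}'$-cocircuit is a sublist $C\subseteq X$ intersecting every basis in $\mathbb{B}'$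 and inclusion-minimal with this property. $\mathcal{D}(X,\mathbb{B}')=\{f\in\mathrm{Sym}(V): D_Cf=0$ for all $\mathbb{B}'$-cocircuits $C\}$. $Q_B=p_{X\setminus(B\cup E(B))}$ and $\mathcal{P}(X,\mathbb{B}')=\mathrm{span}\{Q_B:B\in\mathbb{B}'\}$. Construction of $R^B_Z$: for a finite list $Y=(y_1,\ldots,y_m)$ in $U$ with some linear functional positive on all $y_j$, $T_Y$ is the distribution with $\int_U\varphi T_Y=\int_{[0,\infty)^m}\varphi(\sum\lambda_jy_j)d\lambda$ ($T_\emptyset=\delta_0$). For a finite list $Z$ spanning $U$ and a basis $B=(b_1,\ldots,b_r)\subseteq Z$ ordered as in $Z$, with $S_i=\mathrm{span}(b_1,\ldots,b_i)$: $u\in S_i\setminus S_{i-1}$ is positive if its $b_i$-coefficient is positive, negative otherwise; $P_i$, $N_i$ are the sublists of positive, negative elements of $Z$ in $S_i\setminus S_{i-1}$. $T_i^{B+}=(-1)^{|N_i|}T_{P_i}*T_{-N_i}$, $T_i^{B-}=(-1)^{|P_i|}T_{-P_i}*T_{N_i}$, $R_i^B=T_i^{B+}-T_i^{B-}$, $R^B_Z=R^B_1*\cdots*R^B_r$ (well-defined convolutions of distributions); $R^B_Z$ is a homogeneous polynomial function on $U$, regarded as an element of $\mathrm{Sym}(V)$.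
   Formalization: det(B) is taken as the absolute value |det(B)|: with the signed determinant the duality fails, e.g. for r = 1, X = (-s_1), where Q_B = 1, R^B = 1 and det(B) = -1, so the pairing would be -1 instead of 1. *)

theory Defs
  imports "HOL-Analysis.Analysis" "HOL-Library.Poly_Mapping"
begin

text \<open>
  The space \<open>U\<close> with its ordered basis \<open>(s\<^sub>1, \<dots>, s\<^sub>r)\<close> is rendered as \<open>real ^ 'n\<close>, where the
  linear order on the finite index type \<open>'n\<close> is the order of the basis. A sublist of a list \<open>X\<close>
  is a set \<open>J \<subseteq> {..<length X}\<close> of positions; the list of its entries is \<open>nths X J\<close>.
\<close>

subsection \<open>Polynomials\<close>

text \<open>
  Both \<open>Sym(U)\<close> and \<open>Sym(V)\<close> are polynomial rings in variables indexed by \<open>'n\<close>: finitely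
  supported functions from exponent vectors to real coefficients, with the ring structure of
  \<^theory>\<open>HOL-Library.Poly_Mapping\<close>.
\<close>

type_synonym 'n mpoly = "('n \<Rightarrow>\<^sub>0 nat) \<Rightarrow>\<^sub>0 real"

instantiation poly_mapping :: (type, real_vector) real_vector
begin

definition scaleR_poly_mapping :: "real \<Rightarrow> ('a \<Rightarrow>\<^sub>0 'b) \<Rightarrow> 'a \<Rightarrow>\<^sub>0 'b" where
  "scaleR_poly_mapping c p = Poly_Mapping.map (\<lambda>a. c *\<^sub>R a) p"

lemma lookup_scaleR [simp]:
  "Poly_Mapping.lookup (c *\<^sub>R p) k = c *\<^sub>R Poly_Mapping.lookup p k"
  for p :: "'a \<Rightarrow>\<^sub>0 'b"
  by (simp add: scaleR_poly_mapping_def Poly_Mapping.map.rep_eq when_def)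

instance
  by standard (auto intro!: poly_mapping_eqI simp: lookup_add algebra_simps)

end

definition mvar :: "'n \<Rightarrow> 'n mpoly" where
  "mvar i = Poly_Mapping.single (Poly_Mapping.single i 1) 1"

definition mpoly_eval :: "('n::finite) mpoly \<Rightarrow> real ^ 'n \<Rightarrow> real" where
  "mpoly_eval f x = (\<Sum>m\<in>Poly_Mapping.keys f.
     Poly_Mapping.lookup f m * (\<Prod>i\<in>UNIV. (x $ i) ^ Poly_Mapping.lookup m i))"

definition lin_poly :: "real ^ 'n \<Rightarrow> ('n::finite) mpoly" where
  "lin_poly u = (\<Sum>i\<in>UNIV. (u $ i) *\<^sub>R mvar i)"

definition prod_poly :: "(real ^ ('n::finite)) list \<Rightarrow> ('n::finite) mpoly" where
  "prod_poly Y = prod_list (map lin_poly Y)"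

text \<open>
  The mixed partial derivative of order \<open>m\<close>:
  \<open>\<partial>\<^sup>m t\<^sup>k = (\<Prod>i. k\<^sub>i (k\<^sub>i - 1) \<cdots> (k\<^sub>i - m\<^sub>i + 1)) t\<^sup>k\<^sup>-\<^sup>m\<close>. The coefficient vanishes unless
  \<open>m \<le> k\<close>, so the truncated subtraction of exponents does no harm.
\<close>

definition mixed_partial :: "('n \<Rightarrow>\<^sub>0 nat) \<Rightarrow> ('n::finite) mpoly \<Rightarrow> 'n mpoly" where
  "mixed_partial m f = (\<Sum>k\<in>Poly_Mapping.keys f. Poly_Mapping.single (k - m)
     (Poly_Mapping.lookup f k *
       (\<Prod>i\<in>UNIV. \<Prod>j<Poly_Mapping.lookup m i. real (Poly_Mapping.lookup k i) - real j)))"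

definition diff_op :: "('n::finite) mpoly \<Rightarrow> 'n mpoly \<Rightarrow> 'n mpoly" where
  "diff_op p f = (\<Sum>m\<in>Poly_Mapping.keys p. Poly_Mapping.lookup p m *\<^sub>R mixed_partial m f)"

definition pairing :: "('n::finite) mpoly \<Rightarrow> 'n mpoly \<Rightarrow> real" where
  "pairing p f = mpoly_eval (diff_op p f) 0"

definition dir_deriv :: "real ^ 'n \<Rightarrow> ('n::finite) mpoly \<Rightarrow> 'n mpoly" where
  "dir_deriv u f = diff_op (lin_poly u) f"

definition dir_derivs :: "(real ^ ('n::finite)) list \<Rightarrow> ('n::finite) mpoly \<Rightarrow> 'n mpoly" where
  "dir_derivs Y f = foldr dir_deriv Y f"

subsection \<open>Bases, external activity and forward exchange\<close>

definition bases_of :: "(real ^ ('n::finite)) list \<Rightarrow> nat set set" where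
  "bases_of X = {J. J \<subseteq> {..<length X} \<and> distinct (nths X J) \<and>
     independent (set (nths X J)) \<and> span (set (nths X J)) = UNIV}"

definition ext_active :: "(real ^ ('n::finite)) list \<Rightarrow> nat set \<Rightarrow> nat set" where
  "ext_active X J = {x \<in> {..<length X} - J. X ! x \<in> span ((!) X ` {b \<in> J. b < x})}"

definition flag :: "(real ^ ('n::finite)) list \<Rightarrow> nat \<Rightarrow> (real ^ 'n) set" where
  "flag B i = span (set (take i B))"

text \<open>
  \<open>sorted_list_of_set J ! (i - 1)\<close> is the position in \<open>X\<close> of the \<open>i\<close>-th basis vector \<open>b\<^sub>i\<close>.
\<close>

definition forward_exchange :: "(real ^ ('n::finite)) list \<Rightarrow> nat set set \<Rightarrow> bool" where
  "forward_exchange X \<BB> \<longleftrightarrow>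
     (\<forall>J\<in>\<BB>. \<forall>i\<in>{1..CARD('n)}. \<forall>x<length X.
        X ! x \<in> flag (nths X J) i - flag (nths X J) (i - 1) \<longrightarrow> x \<notin> ext_active X J \<longrightarrow>
        insert x (J - {sorted_list_of_set J ! (i - 1)}) \<in> \<BB>)"

definition cocircuit :: "(real ^ ('n::finite)) list \<Rightarrow> nat set set \<Rightarrow> nat set \<Rightarrow> bool" where
  "cocircuit X \<BB> C \<longleftrightarrow> C \<subseteq> {..<length X} \<and> (\<forall>J\<in>\<BB>. C \<inter> J \<noteq> {}) \<and>
     (\<forall>C'. C' \<subset> C \<longrightarrow> \<not> (\<forall>J\<in>\<BB>. C' \<inter> J \<noteq> {}))"

definition D_space :: "(real ^ ('n::finite)) list \<Rightarrow> nat set set \<Rightarrow> 'n mpoly set" where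
  "D_space X \<BB> = {f. \<forall>C. cocircuit X \<BB> C \<longrightarrow> dir_derivs (nths X C) f = 0}"

definition Q_poly :: "(real ^ ('n::finite)) list \<Rightarrow> nat set \<Rightarrow> 'n mpoly" where
  "Q_poly X J = prod_poly (nths X ({..<length X} - (J \<union> ext_active X J)))"

definition P_space :: "(real ^ ('n::finite)) list \<Rightarrow> nat set set \<Rightarrow> 'n mpoly set" where
  "P_space X \<BB> = span (Q_poly X ` \<BB>)"

subsection \<open>Distributions\<close>

primrec continuously_diff :: "nat \<Rightarrow> ('a::real_normed_vector \<Rightarrow> real) \<Rightarrow> bool" where
  "continuously_diff 0 f \<longleftrightarrow> continuous_on UNIV f"
| "continuously_diff (Suc k) f \<longleftrightarrow> f differentiable_on UNIV \<and>
     (\<forall>v. continuously_diff k (\<lambda>x. frechet_derivative f (at x) v))"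

definition test_fun :: "('a::real_normed_vector \<Rightarrow> real) \<Rightarrow> bool" where
  "test_fun \<phi> \<longleftrightarrow> (\<forall>k. continuously_diff k \<phi>) \<and> compact (closure {x. \<phi> x \<noteq> 0})"

text \<open>
  A distribution is represented by a functional on all functions, of which only the values on
  test functions are meaningful. It has to be defined on more than the test functions since
  the inner function \<open>\<lambda>x. T (\<lambda>y. \<phi> (x + y))\<close> of a convolution need not have compact support.
  In the convolutions below all integrals converge absolutely: if \<open>\<phi>\<close> is a test function, each
  integrand has compact support on the cone over which it is integrated.
\<close>

type_synonym 'n distr = "(real ^ 'n \<Rightarrow> real) \<Rightarrow> real"

definition conv :: "('n::finite) distr \<Rightarrow> 'n distr \<Rightarrow> 'n distr" where
  "conv S T = (\<lambda>\<phi>. S (\<lambda>x. T (\<lambda>y. \<phi> (x + y))))"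

definition T_distr :: "(real ^ ('n::finite)) list \<Rightarrow> 'n distr" where
  "T_distr Y = (\<lambda>\<phi>. set_lebesgue_integral (Pi\<^sub>M {..<length Y} (\<lambda>_. lborel))
     (Pi\<^sub>E {..<length Y} (\<lambda>_. {0..})) (\<lambda>c. \<phi> (\<Sum>j<length Y. c j *\<^sub>R Y ! j)))"

definition pos_part :: "(real ^ ('n::finite)) list \<Rightarrow> (real ^ 'n) list \<Rightarrow> nat \<Rightarrow> (real ^ 'n) list" where
  "pos_part Z B i = filter (\<lambda>u. u \<in> flag B i - flag B (i - 1) \<and>
     representation (set B) u (B ! (i - 1)) > 0) Z"

definition neg_part :: "(real ^ ('n::finite)) list \<Rightarrow> (real ^ 'n) list \<Rightarrow> nat \<Rightarrow> (real ^ 'n) list" where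
  "neg_part Z B i = filter (\<lambda>u. u \<in> flag B i - flag B (i - 1) \<and>
     \<not> representation (set B) u (B ! (i - 1)) > 0) Z"

definition T_plus :: "(real ^ ('n::finite)) list \<Rightarrow> (real ^ 'n) list \<Rightarrow> nat \<Rightarrow> 'n distr" where
  "T_plus Z B i = (\<lambda>\<phi>. (-1) ^ length (neg_part Z B i) *
     conv (T_distr (pos_part Z B i)) (T_distr (map uminus (neg_part Z B i))) \<phi>)"

definition T_minus :: "(real ^ ('n::finite)) list \<Rightarrow> (real ^ 'n) list \<Rightarrow> nat \<Rightarrow> 'n distr" where
  "T_minus Z B i = (\<lambda>\<phi>. (-1) ^ length (pos_part Z B i) *
     conv (T_distr (map uminus (pos_part Z B i))) (T_distr (neg_part Z B i)) \<phi>)"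

definition R_factor :: "(real ^ ('n::finite)) list \<Rightarrow> (real ^ 'n) list \<Rightarrow> nat \<Rightarrow> 'n distr" where
  "R_factor Z B i = (\<lambda>\<phi>. T_plus Z B i \<phi> - T_minus Z B i \<phi>)"

text \<open>
  The convolution is bracketed to the right, so that the factor \<open>i = r\<close> is integrated first;
  \<open>T_distr []\<close> is the Dirac distribution at the origin, the unit of convolution.
\<close>

definition R_distr :: "(real ^ ('n::finite)) list \<Rightarrow> (real ^ 'n) list \<Rightarrow> 'n distr" where
  "R_distr Z B = foldr conv (map (R_factor Z B) [1..<CARD('n) + 1]) (T_distr [])"

text \<open>The polynomial whose function is the density of the distribution above.\<close>

definition R_poly :: "(real ^ ('n::finite)) list \<Rightarrow> (real ^ 'n) list \<Rightarrow> 'n mpoly" where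
  "R_poly Z B = (THE f. \<forall>\<phi>. test_fun \<phi> \<longrightarrow>
     R_distr Z B \<phi> = (\<integral>x. \<phi> x * mpoly_eval f x \<partial>lborel))"

text \<open>
  The normalising factor is the absolute value of the determinant of the matrix with columns
  \<open>b\<^sub>1, \<dots>, b\<^sub>r\<close>. The sign of the determinant has to be dropped: for \<open>r = 1\<close> and \<open>X = (-s\<^sub>1)\<close> one
  has \<open>Q\<^sub>B = 1\<close> and \<open>R\<^sup>B = 1\<close>, whereas the determinant is \<open>-1\<close>.
\<close>

definition det_list :: "(real ^ ('n::{finite,linorder})) list \<Rightarrow> real" where
  "det_list B = det (\<chi> i j. (B ! card {k. k < j}) $ i)"

definition R_basis_poly :: "(real ^ ('n::{finite,linorder})) list \<Rightarrow> nat set \<Rightarrow> 'n mpoly" where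
  "R_basis_poly X J = \<bar>det_list (nths X J)\<bar> *\<^sub>R
     R_poly (nths X ({..<length X} - ext_active X J)) (nths X J)"

subsection \<open>Duality\<close>

definition dual_space :: "'a::real_vector set \<Rightarrow> ('a \<Rightarrow> real) set" where
  "dual_space W = {l \<in> extensional W. (\<forall>x\<in>W. \<forall>y\<in>W. l (x + y) = l x + l y) \<and>
     (\<forall>c. \<forall>x\<in>W. l (c *\<^sub>R x) = c * l x)}"

text \<open>
  \<open>f \<mapsto> b(\<cdot>, f)\<close> is a linear isomorphism from \<open>D\<close> onto the dual space of \<open>P\<close>.
\<close>

definition dual_via ::
  "('a::real_vector \<Rightarrow> 'b::real_vector \<Rightarrow> real) \<Rightarrow> 'b set \<Rightarrow> 'a set \<Rightarrow> bool" where
  "dual_via b D P \<longleftrightarrow> subspace D \<and> subspace P \<and>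
     (\<forall>p\<in>P. \<forall>f\<in>D. \<forall>g\<in>D. b p (f + g) = b p f + b p g) \<and>
     (\<forall>p\<in>P. \<forall>c. \<forall>f\<in>D. b p (c *\<^sub>R f) = c * b p f) \<and>
     bij_betw (\<lambda>f. restrict (\<lambda>p. b p f) P) D (dual_space P)"

definition basis_family :: "('i \<Rightarrow> 'a::real_vector) \<Rightarrow> 'i set \<Rightarrow> 'a set \<Rightarrow> bool" where
  "basis_family g I W \<longleftrightarrow> inj_on g I \<and> independent (g ` I) \<and> span (g ` I) = W"

end

theory Submission
  imports Defs
begin

text \<open>
  Sort the elements of \<open>Z = X - E(D)\<close> into layers according to the flag of \<open>D\<close>. Integrating by
  parts, the distribution \<open>R\<^sub>Z\<close> is, up to a constant, Lebesgue measure times the polynomial obtained from \<open>1\<close> by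
  passing through the layers: the first vector of a layer extends a polynomial constantly along
  this vector, each further vector \<open>y\<close> replaces it by its primitive in direction \<open>y\<close> which
  vanishes on the hyperplane of the layer. Hence \<open>D\<^sub>y\<close> deletes \<open>y\<close> from \<open>Z\<close> and annihilates the
  polynomial if \<open>y\<close> is alone in its layer. By forward exchange a set disjoint from some
  transversal of the layers is disjoint from a basis in \<open>\<BB>\<close>, so a cocircuit contains a layer
  and its derivative annihilates the polynomial. The same rule gives the biorthogonality.
  It remains to see that \<open>f = 0\<close> if \<open>f\<close> is in the \<open>\<D>\<close>-space and all \<open>\<langle>Q\<^sub>B, f\<rangle>\<close> vanish. This is
  a deletion-contraction argument on the first element \<open>x\<close> of \<open>X\<close>: both \<open>D\<^sub>x f\<close> (deletion) and,
  if \<open>D\<^sub>x f = 0\<close>, \<open>f\<close> itself (contraction) satisfy the hypotheses for a shorter list.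
\<close>

text \<open>The constants fit together as follows. The first vector \<open>y\<close> of a layer
  contributes \<open>1 / l y\<close>, because along \<open>y\<close> the coordinate \<open>l\<close>
  grows with speed \<open>l y\<close>. Replacing a vector by its negative changes the sign of the
  polynomial of a layer; this cancels the signs in \<open>T_plus\<close> and \<open>T_minus\<close>,
  so both halves of a layer yield the same polynomial, and the difference of the two distributions
  becomes one integral over the whole line of a basis vector. The resulting iterated integral along
  the basis is Lebesgue measure divided by the absolute value of the determinant, which is the
  factor in \<open>R_basis_poly\<close>. The analytic obstacle is that the inner functions of the
  convolutions are not compactly supported; hence a support condition relative to a cone that each
  integration preserves. Polynomials are identified with their functions, so that extensions and
  primitives can be given by values and compared along lines. In the uniqueness part, contraction
  needs no quotient space: the vectors already chosen are required to annihilate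
  \<open>f\<close>.\<close>

abbreviation "lk \<equiv> Poly_Mapping.lookup"
abbreviation "sg \<equiv> Poly_Mapping.single"

section \<open>Polynomials as sums of monomials\<close>

lemma mpoly_as_sum: "f = (\<Sum>k\<in>Poly_Mapping.keys f. sg k (lk f k))"
  by (rule poly_mapping_eqI) (simp add: lookup_sum lookup_single when_def in_keys_iff)

text \<open>Identities that are additive in \<open>f\<close> need only be checked on monomials; 0 is
  covered as the monomial with coefficient 0.\<close>

lemma mpoly_induct [case_names single add]:
  fixes f :: "'n mpoly"
  assumes "\<And>k c. P (sg k c)" and "\<And>f g. P f \<Longrightarrow> P g \<Longrightarrow> P (f + g)"
  shows "P f"
proof -
  have "P (\<Sum>k\<in>S. sg k (lk f k))" if "finite S" for S
    using that
  proof induction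
    case empty
    then show ?case using assms(1)[of 0 0] by simp
  qed (simp add: assms)
  then show ?thesis using mpoly_as_sum[of f] finite_keys by metis
qed

lemma sum_keys_mono:
  assumes "finite S" "Poly_Mapping.keys f \<subseteq> S" "\<And>k. G k 0 = 0"
  shows "(\<Sum>k\<in>Poly_Mapping.keys f. G k (lk f k)) = (\<Sum>k\<in>S. G k (lk f k))"
  using assms by (intro sum.mono_neutral_left) (auto simp: in_keys_iff)

lemma sum_keys_add:
  fixes G :: "_ \<Rightarrow> 'b::monoid_add \<Rightarrow> 'c::comm_monoid_add"
  assumes "\<And>k. G k 0 = 0" "\<And>k a b. G k (a + b) = G k a + G k b"
  shows "(\<Sum>k\<in>Poly_Mapping.keys (f + g). G k (lk (f + g) k)) =
    (\<Sum>k\<in>Poly_Mapping.keys f. G k (lk f k)) + (\<Sum>k\<in>Poly_Mapping.keys g. G k (lk g k))"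
proof -
  let ?S = "Poly_Mapping.keys f \<union> Poly_Mapping.keys g"
  have *: "Poly_Mapping.keys (f + g) \<subseteq> ?S" by (auto simp: in_keys_iff lookup_add)
  show ?thesis
    by (subst (1 2 3) sum_keys_mono[where S = ?S])
       (use * in \<open>auto simp: assms lookup_add sum.distrib\<close>)
qed

lemma sum_keys_single:
  assumes "\<And>k. G k 0 = 0"
  shows "(\<Sum>k\<in>Poly_Mapping.keys (sg m c). G k (lk (sg m c) k)) = G m c"
  using assms by (cases "c = 0") auto

subsection \<open>Evaluation\<close>

definition monom_eval :: "('n \<Rightarrow>\<^sub>0 nat) \<Rightarrow> real ^ 'n \<Rightarrow> real" where
  "monom_eval m x = (\<Prod>i\<in>UNIV. (x $ i) ^ lk m i)" for m :: "'n::finite \<Rightarrow>\<^sub>0 nat"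

lemma monom_eval_add: "monom_eval (m + k) x = monom_eval m x * monom_eval k x"
  by (simp add: monom_eval_def lookup_add power_add prod.distrib)

lemma mpoly_eval_single: "mpoly_eval (sg m c) x = c * monom_eval m x"
  unfolding mpoly_eval_def monom_eval_def
  by (rule sum_keys_single[where G = "\<lambda>m c. c * (\<Prod>i\<in>UNIV. (x $ i) ^ lk m i)"]) simp

lemma mpoly_eval_add [simp]: "mpoly_eval (f + g) x = mpoly_eval f x + mpoly_eval g x"
  unfolding mpoly_eval_def
  by (rule sum_keys_add[where G = "\<lambda>m c. c * (\<Prod>i\<in>UNIV. (x $ i) ^ lk m i)"])
     (auto simp: algebra_simps)

lemma mpoly_eval_0 [simp]: "mpoly_eval 0 x = 0"
  by (simp add: mpoly_eval_def)

lemma mpoly_eval_1 [simp]: "mpoly_eval 1 x = 1"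
  using mpoly_eval_single[of 0 1 x] by (simp add: monom_eval_def)

lemma mpoly_eval_mult [simp]: "mpoly_eval (f * g) x = mpoly_eval f x * mpoly_eval g x"
proof (induction f rule: mpoly_induct)
  case (single k c)
  show ?case
    by (induction g rule: mpoly_induct)
       (simp_all add: mult_single mpoly_eval_single monom_eval_add algebra_simps)
qed (simp add: algebra_simps)

lemma scaleR_single: "c *\<^sub>R sg m a = sg m (c * a :: real)"
  by (rule poly_mapping_eqI) (simp add: lookup_single when_def)

lemma scaleR_eq_mult: "c *\<^sub>R f = sg 0 c * f" for f :: "'n mpoly"
  by (induction f rule: mpoly_induct) (simp_all add: scaleR_single mult_single algebra_simps)

lemma mpoly_eval_scaleR [simp]: "mpoly_eval (c *\<^sub>R f) x = c * mpoly_eval f x"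
  by (simp add: scaleR_eq_mult mpoly_eval_single monom_eval_def)

lemma mpoly_eval_minus [simp]: "mpoly_eval (- f) x = - mpoly_eval f x"
  using mpoly_eval_add[of f "- f" x] by simp

lemma mpoly_eval_diff [simp]: "mpoly_eval (f - g) x = mpoly_eval f x - mpoly_eval g x"
  using mpoly_eval_add[of f "- g" x] by simp

lemma mpoly_eval_sum [simp]: "mpoly_eval (sum f I) x = (\<Sum>i\<in>I. mpoly_eval (f i) x)"
  by (induction I rule: infinite_finite_induct) auto

lemma monom_eval_single: "monom_eval (sg i n) x = (x $ i) ^ n"
proof -
  have "monom_eval (sg i n) x = (\<Prod>j\<in>UNIV. if j = i then (x $ i) ^ n else 1)"
    unfolding monom_eval_def by (rule prod.cong) (auto simp: lookup_single when_def)
  then show ?thesis by simp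
qed

lemma mpoly_eval_mvar [simp]: "mpoly_eval (mvar i) x = x $ i"
  by (simp add: mvar_def mpoly_eval_single monom_eval_single)

lemma mpoly_eval_lin_poly: "mpoly_eval (lin_poly u) x = (\<Sum>i\<in>UNIV. u $ i * x $ i)"
  by (simp add: lin_poly_def)

subsection \<open>Differential operators\<close>

definition falling :: "('n \<Rightarrow>\<^sub>0 nat) \<Rightarrow> ('n::finite \<Rightarrow>\<^sub>0 nat) \<Rightarrow> real" where
  "falling k m = (\<Prod>i\<in>UNIV. \<Prod>j<lk m i. real (lk k i) - real j)"

text \<open>The truncated \<open>k - b\<close> is harmless: for \<open>b > k\<close> both sides
  contain the factor with \<open>j = k\<close>, which is 0.\<close>

lemma falling_add_aux:
  "(\<Prod>j<a + b. real k - real j) = (\<Prod>j<b. real k - real j) * (\<Prod>j<a. real (k - b) - real j)"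
proof (cases "b \<le> k")
  case True
  have "(\<Prod>j<a + b. real k - real j) = (\<Prod>j<b. real k - real j) * (\<Prod>j=b..<a + b. real k - real j)"
    using prod.atLeastLessThan_concat[of 0 b "a + b" "\<lambda>j. real k - real j"]
    by (simp add: atLeast0LessThan)
  also have "(\<Prod>j=b..<a + b. real k - real j) = (\<Prod>j<a. real (k - b) - real j)"
    using prod.shift_bounds_nat_ivl[of "\<lambda>j. real k - real j" 0 b a] True
    by (simp add: atLeast0LessThan of_nat_diff algebra_simps)
  finally show ?thesis .
next
  case False
  then have "(\<Prod>j<a + b. real k - real j) = 0" "(\<Prod>j<b. real k - real j) = 0"
    by (auto intro!: bexI[of _ k])
  then show ?thesis by (simp only: mult_zero_left)
qed

lemma falling_add: "falling k (m + m') = falling k m' * falling (k - m') m"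
  by (simp add: falling_def lookup_add falling_add_aux prod.distrib lookup_minus)

lemma mixed_partial_single: "mixed_partial m (sg k c) = sg (k - m) (c * falling k m)"
  unfolding mixed_partial_def falling_def
  by (rule sum_keys_single[where G = "\<lambda>k c. sg (k - m) (c * (\<Prod>i\<in>UNIV. \<Prod>j<lk m i. real (lk k i) - real j))"]) simp

lemma mixed_partial_add [simp]: "mixed_partial m (f + g) = mixed_partial m f + mixed_partial m g"
  unfolding mixed_partial_def
  by (rule sum_keys_add[where G = "\<lambda>k c. sg (k - m) (c * (\<Prod>i\<in>UNIV. \<Prod>j<lk m i. real (lk k i) - real j))"])
     (auto simp: algebra_simps single_add)

lemma mixed_partial_scaleR [simp]: "mixed_partial m (c *\<^sub>R f) = c *\<^sub>R mixed_partial m f"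
  by (induction f rule: mpoly_induct)
     (simp_all add: scaleR_single mixed_partial_single scaleR_add_right mult.assoc)

lemma mixed_partial_mixed_partial:
  "mixed_partial (m + m') f = mixed_partial m (mixed_partial m' f)"
proof (induction f rule: mpoly_induct)
  case (single k c)
  have "k - (m + m') = k - m' - m"
    by (rule poly_mapping_eqI) (simp add: lookup_minus lookup_add)
  then show ?case by (simp add: mixed_partial_single falling_add mult.assoc)
qed simp

lemma mixed_partial_0 [simp]: "mixed_partial 0 f = f"
  by (induction f rule: mpoly_induct) (simp_all add: mixed_partial_single falling_def)

lemma mixed_partial_zero [simp]: "mixed_partial m 0 = 0"
  by (simp add: mixed_partial_def)

lemma diff_op_single: "diff_op (sg m c) f = c *\<^sub>R mixed_partial m f"
  unfolding diff_op_def
  by (rule sum_keys_single[where G = "\<lambda>m c. c *\<^sub>R mixed_partial m f"]) simp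

lemma diff_op_add_left [simp]: "diff_op (p + q) f = diff_op p f + diff_op q f"
  unfolding diff_op_def
  by (rule sum_keys_add[where G = "\<lambda>m c. c *\<^sub>R mixed_partial m f"])
     (auto simp: scaleR_add_left)

lemma diff_op_add [simp]: "diff_op p (f + g) = diff_op p f + diff_op p g"
  by (simp add: diff_op_def scaleR_add_right sum.distrib)

lemma diff_op_scaleR [simp]: "diff_op p (c *\<^sub>R f) = c *\<^sub>R diff_op p f"
  by (simp add: diff_op_def scaleR_sum_right mult.commute)

lemma diff_op_zero [simp]: "diff_op p 0 = 0"
  by (simp add: diff_op_def)

lemma diff_op_minus [simp]: "diff_op p (- f) = - diff_op p f"
  using diff_op_scaleR[of p "-1" f] by simp

lemma diff_op_diff [simp]: "diff_op p (f - g) = diff_op p f - diff_op p g"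
  using diff_op_add[of p f "- g"] by simp

lemma diff_op_1 [simp]: "diff_op 1 f = f"
  using diff_op_single[of 0 1 f] by simp

lemma diff_op_scaleR_left [simp]: "diff_op (c *\<^sub>R p) f = c *\<^sub>R diff_op p f"
  by (induction p rule: mpoly_induct)
     (simp_all add: scaleR_single diff_op_single scaleR_add_right)

text \<open>Through this, commutativity of partial derivatives is inherited from the polynomial
  ring.\<close>

lemma diff_op_mult: "diff_op (p * q) f = diff_op p (diff_op q f)"
proof (induction p rule: mpoly_induct)
  case (single m c)
  show ?case
    by (induction q rule: mpoly_induct)
       (simp_all add: mult_single diff_op_single mixed_partial_mixed_partial distrib_left scaleR_add_right)
qed (simp add: distrib_right)

lemma diff_op_commute: "diff_op p (diff_op q f) = diff_op q (diff_op p f)"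
  by (metis diff_op_mult mult.commute)

lemma dir_derivs_eq: "dir_derivs Y f = diff_op (prod_poly Y) f"
  by (induction Y) (simp_all add: dir_derivs_def prod_poly_def dir_deriv_def diff_op_mult)

lemma lin_poly_add: "lin_poly (u + v) = lin_poly u + lin_poly v"
  by (simp add: lin_poly_def scaleR_add_left sum.distrib)

lemma lin_poly_scaleR: "lin_poly (c *\<^sub>R u) = c *\<^sub>R lin_poly u"
  by (simp add: lin_poly_def scaleR_sum_right)

lemma dir_deriv_vec_add: "dir_deriv (u + v) f = dir_deriv u f + dir_deriv v f"
  by (simp add: dir_deriv_def lin_poly_add)

lemma dir_deriv_vec_scaleR: "dir_deriv (c *\<^sub>R u) f = c *\<^sub>R dir_deriv u f"
  by (simp add: dir_deriv_def lin_poly_scaleR)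

lemma dir_deriv_vec_minus: "dir_deriv (- u) f = - dir_deriv u f"
  using dir_deriv_vec_scaleR[of "-1" u f] by simp

lemma dir_deriv_vec_zero: "dir_deriv 0 f = 0"
  using dir_deriv_vec_scaleR[of 0 0 f] by simp

lemma subspace_dir_deriv_eq_0: "subspace {u. dir_deriv u f = 0}"
  by (auto intro!: subspaceI simp: dir_deriv_vec_add dir_deriv_vec_scaleR dir_deriv_vec_zero)

lemma dir_deriv_span_eq_0:
  assumes "\<And>a. a \<in> S \<Longrightarrow> dir_deriv a f = 0" "u \<in> span S"
  shows "dir_deriv u f = 0"
  using span_minimal[OF _ subspace_dir_deriv_eq_0, of S f] assms by blast

lemma dir_deriv_commute: "dir_deriv u (dir_deriv v f) = dir_deriv v (dir_deriv u f)"
  by (simp add: dir_deriv_def diff_op_commute)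

lemma dir_deriv_add [simp]: "dir_deriv u (f + g) = dir_deriv u f + dir_deriv u g"
  and dir_deriv_diff [simp]: "dir_deriv u (f - g) = dir_deriv u f - dir_deriv u g"
  and dir_deriv_minus [simp]: "dir_deriv u (- f) = - dir_deriv u f"
  and dir_deriv_scaleR [simp]: "dir_deriv u (c *\<^sub>R f) = c *\<^sub>R dir_deriv u f"
  and dir_deriv_zero [simp]: "dir_deriv u 0 = 0"
  by (simp_all add: dir_deriv_def)

lemma falling_unit: "falling k (sg i 1) = real (lk k i)"
proof -
  have "falling k (sg i 1) = (\<Prod>j\<in>UNIV. if j = i then real (lk k i) else 1)"
    unfolding falling_def by (rule prod.cong) (auto simp: lookup_single when_def)
  then show ?thesis by simp
qed

lemma dir_deriv_single:
  "dir_deriv u (sg k c) = (\<Sum>i\<in>UNIV. u $ i *\<^sub>R sg (k - sg i 1) (c * real (lk k i)))"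
proof -
  have "diff_op (\<Sum>i\<in>I. u $ i *\<^sub>R mvar i) (sg k c) =
      (\<Sum>i\<in>I. u $ i *\<^sub>R sg (k - sg i 1) (c * real (lk k i)))" for I
  proof (induction I rule: infinite_finite_induct)
    case (insert i I)
    then show ?case
      using falling_unit[of k i] by (simp add: mvar_def diff_op_single mixed_partial_single)
  qed (simp_all add: diff_op_def)
  then show ?thesis by (simp add: dir_deriv_def lin_poly_def)
qed

text \<open>The bridge between the formal and the analytic derivative: identities for
  \<open>dir_deriv\<close> are later read off from polynomial functions restricted to lines.\<close>

lemma mpoly_eval_has_real_derivative:
  "((\<lambda>t. mpoly_eval f (x + t *\<^sub>R u)) has_real_derivative
     mpoly_eval (dir_deriv u f) (x + t *\<^sub>R u)) (at t)"
proof (induction f rule: mpoly_induct)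
  case (single k c)
  let ?z = "x + t *\<^sub>R u"
  have "((\<lambda>t. monom_eval k (x + t *\<^sub>R u)) has_real_derivative
      (\<Sum>i\<in>UNIV. real (lk k i) * (?z $ i) ^ (lk k i - 1) * u $ i * (\<Prod>j\<in>UNIV - {i}. (?z $ j) ^ lk k j))) (at t)"
    unfolding monom_eval_def
    by (rule has_field_derivative_prod) (auto intro!: derivative_eq_intros)
  also have "(\<Sum>i\<in>UNIV. real (lk k i) * (?z $ i) ^ (lk k i - 1) * u $ i * (\<Prod>j\<in>UNIV - {i}. (?z $ j) ^ lk k j)) =
     (\<Sum>i\<in>UNIV. u $ i * (real (lk k i) * monom_eval (k - sg i 1) ?z))"
  proof (rule sum.cong)
    fix i
    have "monom_eval (k - sg i 1) ?z = (?z $ i) ^ (lk k i - 1) * (\<Prod>j\<in>UNIV - {i}. (?z $ j) ^ lk k j)"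
      unfolding monom_eval_def
      by (subst prod.remove[of _ i]) (auto simp: lookup_minus lookup_single when_def intro!: prod.cong)
    then show "real (lk k i) * (?z $ i) ^ (lk k i - 1) * u $ i * (\<Prod>j\<in>UNIV - {i}. (?z $ j) ^ lk k j) =
       u $ i * (real (lk k i) * monom_eval (k - sg i 1) ?z)" by (simp add: ac_simps)
  qed simp
  finally have "((\<lambda>t. c * monom_eval k (x + t *\<^sub>R u)) has_real_derivative
      c * (\<Sum>i\<in>UNIV. u $ i * (real (lk k i) * monom_eval (k - sg i 1) ?z))) (at t)"
    by (intro DERIV_cmult)
  then show ?case
    by (simp add: mpoly_eval_single dir_deriv_single sum_distrib_left algebra_simps)
next
  case (add f g)
  then show ?case by (auto intro: DERIV_add)
qed

lemma mpoly_eval_dir_deriv_unique: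
  assumes "((\<lambda>t. mpoly_eval f (x + t *\<^sub>R u)) has_real_derivative d) (at 0)"
  shows "mpoly_eval (dir_deriv u f) x = d"
  using DERIV_unique[OF mpoly_eval_has_real_derivative[of f x u 0] assms] by simp

lemma mpoly_eval_const_on_line:
  assumes "dir_deriv u f = 0"
  shows "mpoly_eval f (x + t *\<^sub>R u) = mpoly_eval f x"
  using DERIV_isconst_all[of "\<lambda>t. mpoly_eval f (x + t *\<^sub>R u)" t 0]
    mpoly_eval_has_real_derivative[of f x u] assms by simp

text \<open>Induction on the order of \<open>m\<close>: one unit is split off as a derivative along
  a coordinate axis, and a function that vanishes identically has derivative 0.\<close>

lemma mixed_partial_eval_0:
  assumes "\<And>x. mpoly_eval f x = 0"
  shows "mpoly_eval (mixed_partial m f) x = 0"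
proof (induction "\<Sum>i\<in>UNIV. lk m i" arbitrary: m x)
  case 0
  then have "m = 0" by (intro poly_mapping_eqI) simp
  then show ?case using assms by simp
next
  case (Suc n)
  then obtain i where i: "lk m i \<noteq> 0" by (metis sum.neutral nat.distinct(1))
  define m' where "m' = m - sg i 1"
  have m: "m = sg i 1 + m'"
    using i by (intro poly_mapping_eqI) (auto simp: m'_def lookup_add lookup_minus lookup_single when_def)
  have "(\<Sum>j\<in>UNIV. lk m j) = (\<Sum>j\<in>UNIV. lk (sg i (1::nat)) j) + (\<Sum>j\<in>UNIV. lk m' j)"
    unfolding m by (simp add: lookup_add sum.distrib)
  also have "(\<Sum>j\<in>UNIV. lk (sg i (1::nat)) j) = 1"
    by (simp add: lookup_single when_def)
  finally have "n = (\<Sum>j\<in>UNIV. lk m' j)" using Suc(2) by simp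
  then have IH: "mpoly_eval (mixed_partial m' f) x = 0" for x by (rule Suc)
  have "mixed_partial m f = dir_deriv (axis i 1) (mixed_partial m' f)"
  proof -
    have "lin_poly (axis i 1) = mvar i"
      by (simp add: lin_poly_def axis_def if_distrib[of "\<lambda>c. c *\<^sub>R _"] cong: if_cong)
    then show ?thesis
      by (simp add: dir_deriv_def m mixed_partial_mixed_partial mvar_def diff_op_single)
  qed
  then show ?case
    using mpoly_eval_dir_deriv_unique[of "mixed_partial m' f" x "axis i 1" 0] IH by simp
qed

text \<open>A monomial \<open>k\<close> with \<open>k - m = 0\<close> but
  \<open>k \<noteq> m\<close> does not contribute, since its exponent is strictly smaller than that
  of \<open>m\<close> in some variable, which produces a zero factor.\<close>

lemma lookup_mixed_partial_0: "lk (mixed_partial m f) 0 = lk f m * (\<Prod>i\<in>UNIV. fact (lk m i))"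
proof (induction f rule: mpoly_induct)
  case (single k c)
  have 1: "falling m m = (\<Prod>i\<in>UNIV. fact (lk m i))"
  proof -
    have "(\<Prod>j<n. real n - real j) = (\<Prod>j<n. real (n - j))" for n
      by (rule prod.cong) auto
    then have "(\<Prod>j<n. real n - real j) = fact n" for n
      by (simp add: fact_prod_rev atLeast0LessThan)
    then show ?thesis by (simp add: falling_def)
  qed
  have 2: "falling k m = 0" if "k - m = 0" "k \<noteq> m"
  proof -
    have le: "lk k i \<le> lk m i" for i
      using that(1) by (metis diff_is_0_eq lookup_minus lookup_zero)
    from \<open>k \<noteq> m\<close> obtain i where "lk k i \<noteq> lk m i" by (meson poly_mapping_eqI)
    then have "lk k i < lk m i" using le[of i] by simp
    then show ?thesis
      unfolding falling_def by (intro prod_zero) (auto intro!: bexI[of _ i])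
  qed
  show ?case
    using 1 2 by (auto simp: mixed_partial_single lookup_single when_def)
qed (simp add: lookup_add algebra_simps)

lemma mpoly_eval_at_0: "mpoly_eval f 0 = lk f 0"
proof (induction f rule: mpoly_induct)
  case (single k c)
  have "monom_eval k 0 = (if k = 0 then 1 else 0)"
  proof (cases "k = 0")
    case False
    then obtain i where "lk k i \<noteq> 0" by (metis poly_mapping_eqI lookup_zero)
    then have "(\<Prod>i\<in>UNIV. (0::real) ^ lk k i) = 0" by (intro prod_zero) auto
    then show ?thesis using False by (simp add: monom_eval_def)
  qed (simp add: monom_eval_def)
  then show ?case by (auto simp: mpoly_eval_single lookup_single when_def)
qed (simp add: lookup_add)

lemma mpoly_eq_0I:
  assumes "\<And>x. mpoly_eval f x = 0"
  shows "f = 0"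
proof (rule poly_mapping_eqI)
  fix m
  have "lk f m * (\<Prod>i\<in>UNIV. fact (lk m i)) = 0"
    using mixed_partial_eval_0[OF assms, of m 0] by (simp add: mpoly_eval_at_0 lookup_mixed_partial_0)
  then show "lk f m = lk 0 m" by simp
qed

lemma mpoly_eqI:
  assumes "\<And>x. mpoly_eval f x = mpoly_eval g x"
  shows "f = g"
  using mpoly_eq_0I[of "f - g"] assms by simp

lemma real_polynomial_function_mpoly_eval [intro]: "real_polynomial_function (mpoly_eval f)"
  unfolding mpoly_eval_def[abs_def]
  by (intro real_polynomial_function_sum real_polynomial_function.intros(4) real_polynomial_function.intros(2)
      real_polynomial_function_prod real_polynomial_function_power real_polynomial_function.intros(1)
      bounded_linear_vec_nth finite_keys finite)

text \<open>Allows polynomials to be constructed from their functions; \<open>extend\<close> and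
  \<open>primitive\<close> arise in this way.\<close>

lemma mpoly_of_real_polynomial_function:
  fixes F :: "real ^ 'n \<Rightarrow> real"
  assumes "real_polynomial_function F"
  shows "\<exists>f. mpoly_eval f = F"
  using assms
proof induction
  case (linear F)
  then interpret bounded_linear F .
  have 1: "mpoly_eval (lin_poly (\<chi> i. F (axis i 1))) x = F (\<Sum>i\<in>UNIV. x $ i *\<^sub>R axis i 1)" for x
    by (simp add: mpoly_eval_lin_poly sum scaleR mult.commute)
  have 2: "(\<Sum>i\<in>UNIV. x $ i *\<^sub>R axis i 1) = x" for x :: "real ^ 'n"
    using basis_expansion[of x] by (simp add: scalar_mult_eq_scaleR)
  have "mpoly_eval (lin_poly (\<chi> i. F (axis i 1))) = F"
    by (rule ext) (simp only: 1 2)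
  then show ?case by blast
next
  case (const c)
  have "mpoly_eval (c *\<^sub>R 1 :: 'n mpoly) = (\<lambda>_. c)" by auto
  then show ?case by blast
next
  case (add F G)
  then obtain f g where "mpoly_eval f = F" "mpoly_eval g = G" by blast
  then have "mpoly_eval (f + g) = (\<lambda>x. F x + G x)" by auto
  then show ?case by blast
next
  case (mult F G)
  then obtain f g where "mpoly_eval f = F" "mpoly_eval g = G" by blast
  then have "mpoly_eval (f * g) = (\<lambda>x. F x * G x)" by auto
  then show ?case by blast
qed

lemma continuous_on_mpoly_eval: "continuous_on S (mpoly_eval f)"
  using continuous_on_polymonial_function[of "mpoly_eval f" S] by (auto simp: real_polynomial_function_eq[symmetric])

subsection \<open>Integration of polynomials along a line\<close>

text \<open>The uniform degree bound and the polynomial dependence of the coefficients on the base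
  point ensure that a primitive along the line, taken coefficient by coefficient, is again a
  polynomial in the base point.\<close>

lemma polynomial_along_line:
  fixes y :: "'a::real_normed_vector"
  assumes "real_polynomial_function g"
  shows "\<exists>P n. (\<forall>z. degree (P z) \<le> n) \<and> (\<forall>k. real_polynomial_function (\<lambda>z. coeff (P z) k)) \<and>
    (\<forall>z t. poly (P z) t = g (z + t *\<^sub>R y))"
  using assms
proof induction
  case f: (linear f)
  then interpret bounded_linear f .
  show ?case
  proof (intro exI[of _ "\<lambda>z. [:f z, f y:]"] exI[of _ 1] conjI allI)
    fix k
    have "(\<lambda>z. coeff [:f z, f y:] k) = (if k = 0 then f else (\<lambda>_. coeff [:f y:] (k - 1)))"
      by (cases k) auto
    then show "real_polynomial_function (\<lambda>z. coeff [:f z, f y:] k)"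
      using f by (auto intro: real_polynomial_function.intros)
  qed (auto simp: add scaleR)
next
  case (const c)
  show ?case
    by (intro exI[of _ "\<lambda>z. [:c:]"] exI[of _ 0]) (auto intro: real_polynomial_function.intros)
next
  case (add f g)
  then obtain P n Q m where
    P: "\<And>z. degree (P z) \<le> n" "\<And>k. real_polynomial_function (\<lambda>z. coeff (P z) k)"
      "\<And>z t. poly (P z) t = f (z + t *\<^sub>R y)" and
    Q: "\<And>z. degree (Q z) \<le> m" "\<And>k. real_polynomial_function (\<lambda>z. coeff (Q z) k)"
      "\<And>z t. poly (Q z) t = g (z + t *\<^sub>R y)" by metis
  have "degree (P z + Q z) \<le> max n m" for z
    using P(1)[of z] Q(1)[of z] by (intro degree_add_le) auto
  then show ?case
    by (intro exI[of _ "\<lambda>z. P z + Q z"] exI[of _ "max n m"])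
       (auto simp: P(3) Q(3) intro!: real_polynomial_function.intros(3) P Q)
next
  case (mult f g)
  then obtain P n Q m where
    P: "\<And>z. degree (P z) \<le> n" "\<And>k. real_polynomial_function (\<lambda>z. coeff (P z) k)"
      "\<And>z t. poly (P z) t = f (z + t *\<^sub>R y)" and
    Q: "\<And>z. degree (Q z) \<le> m" "\<And>k. real_polynomial_function (\<lambda>z. coeff (Q z) k)"
      "\<And>z t. poly (Q z) t = g (z + t *\<^sub>R y)" by metis
  have "degree (P z * Q z) \<le> n + m" for z
    using P(1)[of z] Q(1)[of z] degree_mult_le[of "P z" "Q z"] by linarith
  then show ?case
    by (intro exI[of _ "\<lambda>z. P z * Q z"] exI[of _ "n + m"])
       (auto simp: P(3) Q(3) coeff_mult intro!: real_polynomial_function.intros(4)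
          real_polynomial_function_sum P Q)
qed

section \<open>Extension off a hyperplane and primitives along a transversal vector\<close>

locale hyperplane =
  fixes l :: "real ^ 'n::finite \<Rightarrow> real"
  assumes linear: "linear l"
begin

lemma l_simps: "l (u + v) = l u + l v" "l (u - v) = l u - l v" "l (c *\<^sub>R u) = c * l u"
  "l (- u) = - l u" "l 0 = 0"
  using linear by (simp_all add: linear_add linear_diff linear_cmul linear_neg linear_0)

text \<open>The projection onto the kernel of \<open>l\<close> along \<open>y\<close>.\<close>

definition proj :: "real ^ 'n \<Rightarrow> real ^ 'n \<Rightarrow> real ^ 'n" where
  "proj y x = x - (l x / l y) *\<^sub>R y"

lemma proj_line: "l y \<noteq> 0 \<Longrightarrow> proj y (x + t *\<^sub>R y) = proj y x"
  by (simp add: proj_def l_simps add_divide_distrib algebra_simps)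

lemma proj_parallel: "l u = 0 \<Longrightarrow> proj y (x + t *\<^sub>R u) = proj y x + t *\<^sub>R u"
  by (simp add: proj_def l_simps)

lemma l_proj: "l y \<noteq> 0 \<Longrightarrow> l (proj y x) = 0"
  by (simp add: proj_def l_simps)

lemma proj_id: "l x = 0 \<Longrightarrow> proj y x = x"
  by (simp add: proj_def)

lemma bounded_linear_l: "bounded_linear l"
  using linear linear_conv_bounded_linear by blast

lemma polynomial_function_proj: "polynomial_function (proj y)"
proof -
  have "linear (proj y)"
    by (rule linearI) (simp_all add: proj_def l_simps algebra_simps add_divide_distrib)
  then show ?thesis by (simp add: linear_conv_bounded_linear polynomial_function_bounded_linear)
qed

text \<open>The factor \<open>1 / l y\<close> is the Jacobian of the substitution that turns
  integration along \<open>y\<close> into integration along a vector on which \<open>l\<close> is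
  1.\<close>

definition extend :: "real ^ 'n \<Rightarrow> 'n mpoly \<Rightarrow> 'n mpoly" where
  "extend y f = (SOME h. \<forall>x. mpoly_eval h x = mpoly_eval f (proj y x) / l y)"

lemma eval_extend: "mpoly_eval (extend y f) x = mpoly_eval f (proj y x) / l y"
proof -
  have "real_polynomial_function (mpoly_eval f \<circ> proj y)"
    using polynomial_function_proj by (intro real_polynomial_function_compose) auto
  then have "real_polynomial_function (\<lambda>x. mpoly_eval f (proj y x) / l y)"
    by (intro real_polynomial_function_divide) (simp add: o_def)
  from mpoly_of_real_polynomial_function[OF this]
  have "\<exists>h. \<forall>x. mpoly_eval h x = mpoly_eval f (proj y x) / l y" by metis
  from someI_ex[OF this] show ?thesis by (simp add: extend_def)
qed

definition primitive :: "real ^ 'n \<Rightarrow> 'n mpoly \<Rightarrow> 'n mpoly" where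
  "primitive y g = (SOME h. dir_deriv y h = g \<and> (\<forall>x. l x = 0 \<longrightarrow> mpoly_eval h x = 0))"

lemma primitive_exists:
  assumes y: "l y \<noteq> 0"
  shows "\<exists>h. dir_deriv y h = g \<and> (\<forall>x. l x = 0 \<longrightarrow> mpoly_eval h x = 0)"
proof -
  obtain P n where P: "\<And>z. degree (P z) \<le> n" "\<And>k. real_polynomial_function (\<lambda>z. coeff (P z) k)"
      "\<And>z t. poly (P z) t = mpoly_eval g (z + t *\<^sub>R y)"
    using polynomial_along_line[OF real_polynomial_function_mpoly_eval, of g y] by metis
  \<comment> \<open>The integral of \<open>g\<close> along \<open>y\<close> from the foot point
    \<open>proj y x\<close> to \<open>x\<close>; \<open>l x / l y\<close> is the parameter of
    \<open>x\<close> on this line.\<close>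
  define H where "H x = (\<Sum>k\<le>n. coeff (P (proj y x)) k * (l x / l y) ^ Suc k / real (Suc k))" for x
  have "real_polynomial_function (\<lambda>x. coeff (P (proj y x)) k)" for k
    using real_polynomial_function_compose[OF polynomial_function_proj P(2)] by (simp add: o_def)
  then have "real_polynomial_function H"
    unfolding H_def[abs_def]
    by (intro real_polynomial_function_sum real_polynomial_function_divide real_polynomial_function.intros(4)
        real_polynomial_function_power finite_atMost real_polynomial_function.intros(1)[OF bounded_linear_l])
  then obtain h where h: "mpoly_eval h = H" using mpoly_of_real_polynomial_function by blast
  have "mpoly_eval (dir_deriv y h) x = mpoly_eval g x" for x
  proof (rule mpoly_eval_dir_deriv_unique)
    have "((\<lambda>t. \<Sum>k\<le>n. coeff (P (proj y x)) k * (l x / l y + t) ^ Suc k / real (Suc k)) has_real_derivative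
        (\<Sum>k\<le>n. coeff (P (proj y x)) k * (l x / l y) ^ k)) (at 0)"
      by (rule DERIV_sum) (auto intro!: derivative_eq_intros simp del: power_Suc of_nat_Suc)
    also have "(\<Sum>k\<le>n. coeff (P (proj y x)) k * (l x / l y) ^ k) = poly (P (proj y x)) (l x / l y)"
      unfolding poly_altdef
      by (rule sum.mono_neutral_right) (use P(1) in \<open>auto simp: coeff_eq_0\<close>)
    also have "\<dots> = mpoly_eval g x" by (simp add: P(3) proj_def)
    also have "(\<lambda>t. \<Sum>k\<le>n. coeff (P (proj y x)) k * (l x / l y + t) ^ Suc k / real (Suc k)) =
       (\<lambda>t. mpoly_eval h (x + t *\<^sub>R y))"
      by (rule ext) (simp add: h H_def proj_line[OF y] l_simps add_divide_distrib y del: power_Suc of_nat_Suc)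
    finally show "((\<lambda>t. mpoly_eval h (x + t *\<^sub>R y)) has_real_derivative mpoly_eval g x) (at 0)" .
  qed
  then have "dir_deriv y h = g" by (rule mpoly_eqI)
  moreover have "mpoly_eval h x = 0" if "l x = 0" for x
    using that by (simp add: h H_def)
  ultimately show ?thesis by blast
qed

lemma
  assumes "l y \<noteq> 0"
  shows dir_deriv_primitive: "dir_deriv y (primitive y g) = g"
    and eval_primitive: "l x = 0 \<Longrightarrow> mpoly_eval (primitive y g) x = 0"
  using someI_ex[OF primitive_exists[OF assms, of g]] by (simp_all add: primitive_def)

text \<open>Every line in direction \<open>y\<close> meets the hyperplane, and the difference of the
  two polynomials is constant along it.\<close>

lemma primitive_unique:
  assumes y: "l y \<noteq> 0" and "dir_deriv y h = dir_deriv y h'"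
    and eq: "\<And>x. l x = 0 \<Longrightarrow> mpoly_eval h x = mpoly_eval h' x"
  shows "h = h'"
proof (rule mpoly_eqI)
  fix x
  have "mpoly_eval (h - h') (proj y x + (l x / l y) *\<^sub>R y) = mpoly_eval (h - h') (proj y x)"
    using assms by (intro mpoly_eval_const_on_line) simp
  moreover have "proj y x + (l x / l y) *\<^sub>R y = x" by (simp add: proj_def)
  moreover have "mpoly_eval h (proj y x) = mpoly_eval h' (proj y x)" by (rule eq[OF l_proj[OF y]])
  ultimately show "mpoly_eval h x = mpoly_eval h' x" by simp
qed

lemma primitiveI:
  assumes "l y \<noteq> 0" "dir_deriv y h = g" "\<And>x. l x = 0 \<Longrightarrow> mpoly_eval h x = 0"
  shows "primitive y g = h"
  by (rule primitive_unique[of y]) (use assms in \<open>auto simp: dir_deriv_primitive eval_primitive\<close>)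

lemma dir_deriv_tangent:
  assumes "\<And>x. l x = 0 \<Longrightarrow> mpoly_eval h x = 0" "l u = 0" "l x = 0"
  shows "mpoly_eval (dir_deriv u h) x = 0"
  using assms by (intro mpoly_eval_dir_deriv_unique) (simp add: l_simps)

lemma dir_deriv_extend:
  assumes "l y \<noteq> 0"
  shows "dir_deriv y (extend y f) = 0"
  using assms by (intro mpoly_eq_0I mpoly_eval_dir_deriv_unique) (simp add: eval_extend proj_line)

lemma dir_deriv_extend_parallel:
  assumes "l u = 0"
  shows "dir_deriv u (extend y f) = extend y (dir_deriv u f)"
proof (intro mpoly_eqI mpoly_eval_dir_deriv_unique)
  fix x
  show "((\<lambda>t. mpoly_eval (extend y f) (x + t *\<^sub>R u)) has_real_derivative
      mpoly_eval (extend y (dir_deriv u f)) x) (at 0)"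
    using DERIV_cdivide[OF mpoly_eval_has_real_derivative[of f "proj y x" u 0], of "l y"]
    by (simp add: eval_extend proj_parallel[OF assms])
qed

text \<open>Differentiating \<open>\<integral>\<^sub>0\<^bsup>\<tau>(x)\<^esup> g (x - t y) dt\<close> with \<open>\<tau> = l / l y\<close>: the boundary term is the
  extension of the restriction of \<open>g\<close> to the hyperplane.\<close>

lemma dir_deriv_primitive_general:
  assumes y: "l y \<noteq> 0"
  shows "dir_deriv u (primitive y g) = primitive y (dir_deriv u g) + l u *\<^sub>R extend y g"
proof (rule primitive_unique[OF y])
  show "dir_deriv y (dir_deriv u (primitive y g)) =
      dir_deriv y (primitive y (dir_deriv u g) + l u *\<^sub>R extend y g)"
    by (simp add: dir_deriv_commute[of y u] dir_deriv_primitive[OF y] dir_deriv_extend[OF y])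
  fix x assume x: "l x = 0"
  define u' where "u' = u - (l u / l y) *\<^sub>R y"
  have u: "u = u' + (l u / l y) *\<^sub>R y" by (simp add: u'_def)
  have "l u' = 0" using y by (simp add: u'_def l_simps)
  then have "mpoly_eval (dir_deriv u' (primitive y g)) x = 0"
    using dir_deriv_tangent eval_primitive[OF y] x by blast
  then have "mpoly_eval (dir_deriv u (primitive y g)) x = l u / l y * mpoly_eval g x"
    by (subst u) (simp add: dir_deriv_vec_add dir_deriv_vec_scaleR dir_deriv_primitive[OF y])
  then show "mpoly_eval (dir_deriv u (primitive y g)) x =
      mpoly_eval (primitive y (dir_deriv u g) + l u *\<^sub>R extend y g) x"
    using x by (simp add: eval_primitive[OF y] eval_extend proj_id)
qed

lemma primitive_scaleR: "l y \<noteq> 0 \<Longrightarrow> primitive y (c *\<^sub>R g) = c *\<^sub>R primitive y g"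
  by (rule primitiveI) (simp_all add: dir_deriv_primitive eval_primitive)

lemma primitive_zero: "l y \<noteq> 0 \<Longrightarrow> primitive y 0 = 0"
  by (rule primitiveI) simp_all

lemma extend_eq_0: "l y \<noteq> 0 \<Longrightarrow> (\<And>x. l x = 0 \<Longrightarrow> mpoly_eval g x = 0) \<Longrightarrow> extend y g = 0"
  by (rule mpoly_eqI) (simp add: eval_extend l_proj)

lemma primitive_neg: "l y \<noteq> 0 \<Longrightarrow> primitive (- y) g = - primitive y g"
  by (rule primitiveI) (simp_all add: dir_deriv_primitive eval_primitive l_simps dir_deriv_vec_minus)

lemma proj_neg: "proj (- y) x = proj y x"
  by (simp add: proj_def l_simps)

lemma extend_neg: "extend (- y) f = - extend y f"
  by (rule mpoly_eqI) (simp add: eval_extend l_simps proj_neg)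

section \<open>The polynomial operator of one layer\<close>

definition level :: "(real ^ 'n) list \<Rightarrow> 'n mpoly \<Rightarrow> 'n mpoly" where
  "level Y f = (case Y of [] \<Rightarrow> 0 | y # ys \<Rightarrow> fold primitive ys (extend y f))"

text \<open>The value 0 on the empty list is the natural one: by
  \<open>dir_deriv_level_single\<close>, deleting the only vector of a layer by differentiation
  gives 0 as well.\<close>

lemma level_Nil [simp]: "level [] f = 0"
  and level_single: "level [y] f = extend y f"
  and level_snoc: "Y \<noteq> [] \<Longrightarrow> level (Y @ [y]) f = primitive y (level Y f)"
  by (auto simp: level_def split: list.splits)

lemma eval_level_hyperplane:
  assumes "\<forall>y\<in>set Y. l y \<noteq> 0" "length Y \<ge> 2" "l x = 0"
  shows "mpoly_eval (level Y f) x = 0"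
proof (cases Y rule: rev_cases)
  case (snoc Y' y)
  moreover from this have "Y' \<noteq> []" using assms(2) by auto
  ultimately show ?thesis using assms by (simp add: level_snoc eval_primitive)
qed (use assms in auto)

lemma dir_deriv_level_parallel:
  assumes "\<forall>y\<in>set Y. l y \<noteq> 0" "l u = 0"
  shows "dir_deriv u (level Y f) = level Y (dir_deriv u f)"
  using assms
proof (induction Y rule: rev_induct)
  case (snoc y Y)
  then show ?case
    by (cases "Y = []")
       (simp_all add: level_single dir_deriv_extend_parallel level_snoc dir_deriv_primitive_general)
qed simp

text \<open>Induction over the vectors applied after \<open>y\<close>. Passing the derivative
  through the primitive along \<open>z\<close> leaves a boundary term. It vanishes once two vectors
  precede \<open>z\<close>; if \<open>y\<close> is the only one, the main term dies and the boundary
  term is the extension along \<open>z\<close>.\<close>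

lemma dir_deriv_level:
  assumes "\<forall>z\<in>set (xs @ y # ys). l z \<noteq> 0" "xs @ ys \<noteq> []"
  shows "dir_deriv y (level (xs @ y # ys) f) = level (xs @ ys) f"
  using assms
proof (induction ys rule: rev_induct)
  case Nil
  then show ?case by (simp add: level_snoc dir_deriv_primitive)
next
  case (snoc z ys)
  have z: "l z \<noteq> 0" and y: "l y \<noteq> 0" using snoc.prems by auto
  have *: "level (xs @ y # ys @ [z]) f = primitive z (level (xs @ y # ys) f)"
    using level_snoc[of "xs @ y # ys" z f] by simp
  show ?case
  proof (cases "xs @ ys = []")
    case True
    then have "level (xs @ y # ys @ [z]) f = primitive z (extend y f)"
      using * by (simp add: level_single)
    \<comment> \<open>On the hyperplane \<open>extend y f\<close> equals \<open>f / l y\<close>, so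
      the factor \<open>l y\<close> cancels.\<close>
    moreover have "l y *\<^sub>R extend z (extend y f) = extend z f"
      by (rule mpoly_eqI) (simp add: eval_extend y proj_id[OF l_proj[OF z]])
    ultimately show ?thesis
      using True by (simp add: dir_deriv_primitive_general[OF z] dir_deriv_extend[OF y]
          primitive_zero[OF z] level_single)
  next
    case False
    then have "2 \<le> length (xs @ y # ys)" by (cases xs; cases ys) auto
    then have "extend z (level (xs @ y # ys) f) = 0"
      using snoc.prems by (intro extend_eq_0[OF z] eval_level_hyperplane) auto
    moreover have "dir_deriv y (level (xs @ y # ys) f) = level (xs @ ys) f"
      using snoc False by auto
    ultimately show ?thesis
      using level_snoc[of "xs @ ys" z f] False
      by (simp add: * dir_deriv_primitive_general[OF z])
  qed
qed

lemma dir_deriv_level_single: "l y \<noteq> 0 \<Longrightarrow> dir_deriv y (level [y] f) = 0"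
  by (simp add: level_single dir_deriv_extend)

text \<open>For at least two vectors, both polynomials have the same derivative along one of the
  vectors, by induction on the length, and both vanish on the hyperplane. Hence neither the order in
  \<open>X\<close> nor the separation into positive and negative vectors affects the
  polynomial.\<close>

lemma level_perm:
  assumes "\<forall>z\<in>set Y. l z \<noteq> 0" "mset Y = mset Y'"
  shows "level Y f = level Y' f"
  using assms
proof (induction "length Y" arbitrary: Y Y' rule: less_induct)
  case less
  show ?case
  proof (cases "length Y \<ge> 2")
    case True
    then obtain y ys where Y: "Y = y # ys" "ys \<noteq> []" by (cases Y) fastforce+
    then have "y \<in> set Y'" using less.prems(2) by (metis list.set_intros(1) set_mset_mset)
    then obtain as bs where Y': "Y' = as @ y # bs" by (meson split_list)
    have set: "set Y' = set Y" using less.prems(2) by (metis set_mset_mset)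
    have len: "length Y' = length Y" using less.prems(2) by (metis size_mset)
    have ms: "mset ys = mset (as @ bs)" using less.prems(2) Y Y' by simp
    have y: "l y \<noteq> 0" using less.prems Y by auto
    show ?thesis
    proof (rule primitive_unique[OF y])
      have "dir_deriv y (level Y f) = level ys f"
        using dir_deriv_level[of "[]" y ys f] Y less.prems by auto
      also have "\<dots> = level (as @ bs) f"
        by (rule less.hyps) (use Y less.prems ms in auto)
      also have "level (as @ bs) f = dir_deriv y (level Y' f)"
      proof -
        have "as @ bs \<noteq> []" using ms Y by auto
        moreover have "\<forall>z\<in>set (as @ y # bs). l z \<noteq> 0" using Y' less.prems(1) set by simp
        ultimately show ?thesis using dir_deriv_level[of as y bs f] Y' by simp
      qed
      finally show "dir_deriv y (level Y f) = dir_deriv y (level Y' f)" .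
      show "mpoly_eval (level Y f) x = mpoly_eval (level Y' f) x" if "l x = 0" for x
        using that True len set less.prems by (simp add: eval_level_hyperplane)
    qed
  next
    case False
    then consider "Y = []" | y where "Y = [y]" by (cases Y; cases "tl Y") auto
    then show ?thesis using less.prems by cases auto
  qed
qed

lemma level_neg_one:
  assumes "\<forall>z\<in>set (xs @ y # ys). l z \<noteq> 0"
  shows "level (xs @ (- y) # ys) f = - level (xs @ y # ys) f"
  using assms
proof (induction ys rule: rev_induct)
  case Nil
  then show ?case by (cases "xs = []") (simp_all add: level_single extend_neg level_snoc primitive_neg)
next
  case (snoc z ys)
  then show ?case
    using level_snoc[of "xs @ y # ys" z f] level_snoc[of "xs @ (- y) # ys" z f]
      primitive_scaleR[of z "-1"] by simp
qed

text \<open>This sign compensates the factor \<open>(-1) ^ length (neg_part Z B i)\<close> of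
  \<open>T_plus\<close>; \<open>level_neg_left\<close> does the same for
  \<open>T_minus\<close>.\<close>

lemma level_neg_right:
  assumes "\<forall>z\<in>set (xs @ ys). l z \<noteq> 0"
  shows "level (xs @ map uminus ys) f = (-1) ^ length ys *\<^sub>R level (xs @ ys) f"
  using assms
proof (induction ys arbitrary: xs)
  case (Cons y ys)
  then show ?case using level_neg_one[of xs y ys f] Cons.IH[of "xs @ [- y]"] by (simp add: l_simps)
qed simp

lemma level_neg_left:
  assumes "\<forall>z\<in>set (xs @ ys). l z \<noteq> 0"
  shows "level (map uminus xs @ ys) f = (-1) ^ length xs *\<^sub>R level (xs @ ys) f"
proof -
  have "level (map uminus xs @ ys) f = level (ys @ map uminus xs) f"
    using assms by (intro level_perm) (auto simp: l_simps)
  also have "\<dots> = (-1) ^ length xs *\<^sub>R level (ys @ xs) f"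
    using assms by (intro level_neg_right) auto
  also have "level (ys @ xs) f = level (xs @ ys) f"
    using assms by (intro level_perm) auto
  finally show ?thesis .
qed

lemma hyperplane_neg: "hyperplane (\<lambda>x. - l x)"
  by standard (auto intro!: linearI simp: l_simps)

text \<open>Only the initial extension sees the sign of \<open>l\<close>, through its normalising
  factor. This single minus sign matches the subtraction in \<open>R_factor\<close>.\<close>

lemma level_opposite:
  assumes "\<forall>z\<in>set Y. l z \<noteq> 0"
  shows "hyperplane.level (\<lambda>x. - l x) Y f = - level Y f"
proof -
  interpret neg: hyperplane "\<lambda>x. - l x" by (rule hyperplane_neg)
  have 1: "neg.extend y f = - extend y f" for y f
    by (rule mpoly_eqI) (simp add: neg.eval_extend eval_extend neg.proj_def proj_def)
  have 2: "neg.primitive y g = primitive y g" if "l y \<noteq> 0" for y g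
    using that by (intro neg.primitiveI) (auto simp: dir_deriv_primitive eval_primitive)
  show ?thesis
    using assms
  proof (induction Y rule: rev_induct)
    case (snoc y Y)
    then show ?case
      using primitive_scaleR[of y "-1"]
      by (cases "Y = []") (simp_all add: 1 2 neg.level_single level_single neg.level_snoc level_snoc)
  qed simp
qed

end

section \<open>Integrals along rays and lines\<close>

definition line_int :: "real set \<Rightarrow> 'a::real_normed_vector \<Rightarrow> ('a \<Rightarrow> real) \<Rightarrow> 'a \<Rightarrow> real" where
  "line_int A y \<psi> x = (LINT t:A|lborel. \<psi> (x + t *\<^sub>R y))"

text \<open>Integration along rays of the cone \<open>K\<close> evaluates a function on the sets \<open>x + K\<close> only. The
  following property makes these integrals converge and, unlike compact support, is preserved
  by them.\<close>

definition supported :: "'a::real_normed_vector set \<Rightarrow> ('a \<Rightarrow> real) \<Rightarrow> bool" where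
  "supported K \<psi> \<longleftrightarrow> continuous_on UNIV \<psi> \<and>
     (\<forall>A. bounded A \<longrightarrow> bounded {x. \<psi> x \<noteq> 0 \<and> (\<exists>a\<in>A. x - a \<in> K)})"

lemma supported_continuous: "supported K \<psi> \<Longrightarrow> continuous_on S \<psi>"
  unfolding supported_def using continuous_on_subset by blast

lemma supported_bounded:
  "supported K \<psi> \<Longrightarrow> bounded A \<Longrightarrow> bounded {x. \<psi> x \<noteq> 0 \<and> (\<exists>a\<in>A. x - a \<in> K)}"
  unfolding supported_def by blast

lemma supported_mono: "supported K \<psi> \<Longrightarrow> K' \<subseteq> K \<Longrightarrow> supported K' \<psi>"
  unfolding supported_def by (auto intro: bounded_subset)

lemma supported_mult:
  assumes "supported K \<psi>" "continuous_on UNIV g"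
  shows "supported K (\<lambda>x. g x * \<psi> x)"
  unfolding supported_def
proof (intro conjI allI impI)
  fix A :: "'a set" assume "bounded A"
  then have "bounded {x. \<psi> x \<noteq> 0 \<and> (\<exists>a\<in>A. x - a \<in> K)}"
    by (rule supported_bounded[OF assms(1)])
  then show "bounded {x. g x * \<psi> x \<noteq> 0 \<and> (\<exists>a\<in>A. x - a \<in> K)}"
    by (rule bounded_subset) auto
qed (use assms in \<open>auto intro!: continuous_intros simp: supported_def\<close>)

lemma supported_add:
  assumes "supported K \<psi>" "supported K \<phi>"
  shows "supported K (\<lambda>x. \<psi> x + \<phi> x)"
  unfolding supported_def
proof (intro conjI allI impI)
  fix A :: "'a set" assume "bounded A"
  then have "bounded ({x. \<psi> x \<noteq> 0 \<and> (\<exists>a\<in>A. x - a \<in> K)} \<union> {x. \<phi> x \<noteq> 0 \<and> (\<exists>a\<in>A. x - a \<in> K)})"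
    using assms by (simp only: bounded_Un supported_bounded simp_thms)
  then show "bounded {x. \<psi> x + \<phi> x \<noteq> 0 \<and> (\<exists>a\<in>A. x - a \<in> K)}"
    by (rule bounded_subset) auto
qed (use assms in \<open>auto intro!: continuous_intros simp: supported_def\<close>)

lemma supported_cmult:
  "supported K \<psi> \<Longrightarrow> supported K (\<lambda>x. c * \<psi> x)"
  by (rule supported_mult[where g = "\<lambda>_. c"]) (assumption, rule continuous_on_const)

lemma supported_shift:
  assumes "supported K \<psi>"
  shows "supported K (\<lambda>x. \<psi> (z + x))"
  unfolding supported_def
proof (intro conjI allI impI)
  show "continuous_on UNIV (\<lambda>x. \<psi> (z + x))"
    by (rule continuous_on_compose2[OF supported_continuous[OF assms, of UNIV]])
       (auto intro: continuous_intros)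
  fix A :: "'a set" assume "bounded A"
  then have "bounded ((+) z ` A)" by (rule bounded_translation)
  then have "bounded {x. \<psi> x \<noteq> 0 \<and> (\<exists>a\<in>(+) z ` A. x - a \<in> K)}"
    by (rule supported_bounded[OF assms])
  then have "bounded ((\<lambda>x. x - z) ` {x. \<psi> x \<noteq> 0 \<and> (\<exists>a\<in>(+) z ` A. x - a \<in> K)})"
    by (rule bounded_translation_minus)
  then show "bounded {x. \<psi> (z + x) \<noteq> 0 \<and> (\<exists>a\<in>A. x - a \<in> K)}"
    by (rule bounded_subset) (force simp: image_iff algebra_simps intro!: exI[of _ "z + _"])
qed

text \<open>Properness in \<open>t\<close> of the map taking \<open>(k, t)\<close> to
  \<open>k + t y\<close>: a bounded set is met only for bounded parameters, uniformly in
  \<open>k\<close>.\<close>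

definition escaping :: "real set \<Rightarrow> 'a::real_normed_vector \<Rightarrow> 'a set \<Rightarrow> bool" where
  "escaping A y K \<longleftrightarrow> (\<forall>M. bounded {t\<in>A. \<exists>k\<in>K. norm (k + t *\<^sub>R y) \<le> M})"

lemma escaping_half_line:
  fixes \<mu> :: "'a::euclidean_space \<Rightarrow> real"
  assumes "linear \<mu>" "\<mu> y > 0" "\<And>k. k \<in> K \<Longrightarrow> \<mu> k \<ge> 0"
  shows "escaping {0..} y K"
  unfolding escaping_def
proof
  fix M
  obtain B where B: "\<And>x. \<bar>\<mu> x\<bar> \<le> B * norm x" "B > 0"
    using linear_bounded_pos[OF assms(1)] by auto
  have "t \<le> B * M / \<mu> y" if "k \<in> K" "norm (k + t *\<^sub>R y) \<le> M" for t k
  proof -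
    have "\<mu> k + t * \<mu> y = \<mu> (k + t *\<^sub>R y)" using assms(1) by (simp add: linear_add linear_cmul)
    also have "\<dots> \<le> B * norm (k + t *\<^sub>R y)" using B(1) abs_ge_self order_trans by blast
    also have "\<dots> \<le> B * M" using B(2) that by simp
    finally have "t * \<mu> y \<le> B * M" using assms(3)[OF that(1)] by linarith
    then show ?thesis using assms(2) by (simp add: pos_le_divide_eq)
  qed
  then have "{t \<in> {0..}. \<exists>k\<in>K. norm (k + t *\<^sub>R y) \<le> M} \<subseteq> {0..B * M / \<mu> y}" by auto
  then show "bounded {t \<in> {0..}. \<exists>k\<in>K. norm (k + t *\<^sub>R y) \<le> M}"
    using bounded_closed_interval bounded_subset by blast
qed

lemma escaping_line:
  fixes \<mu> :: "'a::euclidean_space \<Rightarrow> real"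
  assumes "linear \<mu>" "\<mu> y \<noteq> 0" "\<And>k. k \<in> K \<Longrightarrow> \<mu> k = 0"
  shows "escaping A y K"
  unfolding escaping_def
proof
  fix M
  obtain B where B: "\<And>x. \<bar>\<mu> x\<bar> \<le> B * norm x" "B > 0"
    using linear_bounded_pos[OF assms(1)] by auto
  have "\<bar>t\<bar> \<le> B * M / \<bar>\<mu> y\<bar>" if "k \<in> K" "norm (k + t *\<^sub>R y) \<le> M" for t k
  proof -
    have "\<bar>t\<bar> * \<bar>\<mu> y\<bar> = \<bar>\<mu> (k + t *\<^sub>R y)\<bar>"
      using assms(1) assms(3)[OF that(1)] by (simp add: linear_add linear_cmul abs_mult)
    also have "\<dots> \<le> B * norm (k + t *\<^sub>R y)" using B(1) by blast
    also have "\<dots> \<le> B * M" using B(2) that by simp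
    finally show ?thesis using assms(2) by (simp add: pos_le_divide_eq)
  qed
  then have "{t \<in> A. \<exists>k\<in>K. norm (k + t *\<^sub>R y) \<le> M} \<subseteq> {-(B * M / \<bar>\<mu> y\<bar>)..B * M / \<bar>\<mu> y\<bar>}"
    by (force simp: abs_le_iff)
  then show "bounded {t \<in> A. \<exists>k\<in>K. norm (k + t *\<^sub>R y) \<le> M}"
    using bounded_closed_interval bounded_subset by blast
qed

text \<open>The bound is uniform over all \<open>x\<close> in the translates of \<open>K'\<close> by
  a bounded set. This gives locally uniform truncation of the integrals, and hence continuity, as
  well as the support condition for the integrated function.\<close>

lemma escaping_bound:
  assumes \<psi>: "supported K \<psi>" and K: "\<And>k t. k \<in> K' \<Longrightarrow> t \<in> A \<Longrightarrow> k + t *\<^sub>R y \<in> K"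
    and esc: "escaping A y K'" and "bounded S"
  obtains T where "T \<ge> 0" "\<And>x a t. a \<in> S \<Longrightarrow> x - a \<in> K' \<Longrightarrow> t \<in> A \<Longrightarrow> \<psi> (x + t *\<^sub>R y) \<noteq> 0 \<Longrightarrow>
    \<bar>t\<bar> \<le> T \<and> norm x \<le> T"
proof -
  obtain M where M: "\<And>a. a \<in> S \<Longrightarrow> norm a \<le> M" using \<open>bounded S\<close> bounded_iff by blast
  have "bounded {x. \<psi> x \<noteq> 0 \<and> (\<exists>a\<in>S. x - a \<in> K)}"
    by (rule supported_bounded[OF \<psi> \<open>bounded S\<close>])
  then obtain N where N: "\<And>x a. \<psi> x \<noteq> 0 \<Longrightarrow> a \<in> S \<Longrightarrow> x - a \<in> K \<Longrightarrow> norm x \<le> N"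
    unfolding bounded_iff by blast
  obtain T where T: "\<And>t k. t \<in> A \<Longrightarrow> k \<in> K' \<Longrightarrow> norm (k + t *\<^sub>R y) \<le> N + M \<Longrightarrow> \<bar>t\<bar> \<le> T"
    using esc[unfolded escaping_def bounded_iff, rule_format, of "N + M"] by auto
  show ?thesis
  \<comment> \<open>The first summand bounds the parameter, the other two bound \<open>x\<close>:
    going back from \<open>x + t y\<close> to \<open>x\<close> costs at most \<open>|T|\<close>
    times the norm of \<open>y\<close>.\<close>
  proof (rule that[of "\<bar>T\<bar> + \<bar>N\<bar> + \<bar>T\<bar> * norm y"])
    fix x a t
    assume *: "a \<in> S" "x - a \<in> K'" "t \<in> A" "\<psi> (x + t *\<^sub>R y) \<noteq> 0"
    have "x + t *\<^sub>R y - a \<in> K" using K[OF *(2,3)] by (simp add: algebra_simps)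
    then have n: "norm (x + t *\<^sub>R y) \<le> N" using N * by blast
    have "norm ((x - a) + t *\<^sub>R y) \<le> N + M"
      using norm_triangle_ineq4[of "x + t *\<^sub>R y" a] n M[OF *(1)] by (simp add: algebra_simps)
    then have t: "\<bar>t\<bar> \<le> T" using T * by blast
    have "norm x \<le> norm (x + t *\<^sub>R y) + norm (t *\<^sub>R y)"
      using norm_triangle_ineq4[of "x + t *\<^sub>R y" "t *\<^sub>R y"] by simp
    also have "norm (t *\<^sub>R y) \<le> \<bar>T\<bar> * norm y" using t by (simp add: mult_right_mono)
    finally have "norm x \<le> \<bar>T\<bar> + \<bar>N\<bar> + \<bar>T\<bar> * norm y" using n by linarith
    moreover have "\<bar>t\<bar> \<le> \<bar>T\<bar> + \<bar>N\<bar> + \<bar>T\<bar> * norm y" using t by (smt (verit) mult_nonneg_nonneg norm_ge_zero)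
    ultimately show "\<bar>t\<bar> \<le> \<bar>T\<bar> + \<bar>N\<bar> + \<bar>T\<bar> * norm y \<and> norm x \<le> \<bar>T\<bar> + \<bar>N\<bar> + \<bar>T\<bar> * norm y" by blast
  qed auto
qed

lemma line_int_truncate:
  assumes "\<And>t. t \<in> A \<Longrightarrow> \<psi> (x + t *\<^sub>R y) \<noteq> 0 \<Longrightarrow> \<bar>t\<bar> \<le> T"
  shows "line_int A y \<psi> x = line_int (A \<inter> {-T..T}) y \<psi> x"
  unfolding line_int_def set_lebesgue_integral_def
  by (rule Bochner_Integration.integral_cong) (use assms in \<open>force simp: indicator_def\<close>)+

lemma set_integrable_on_line:
  fixes \<psi> :: "'a::real_normed_vector \<Rightarrow> real"
  assumes "closed A" "continuous_on UNIV \<psi>"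
    and "\<And>t. t \<in> A \<Longrightarrow> \<psi> (x + t *\<^sub>R y) \<noteq> 0 \<Longrightarrow> \<bar>t\<bar> \<le> T"
  shows "set_integrable lborel A (\<lambda>t. \<psi> (x + t *\<^sub>R y))"
proof -
  have "set_integrable lborel (A \<inter> {-T..T}) (\<lambda>t. \<psi> (x + t *\<^sub>R y))"
    unfolding set_integrable_def
  proof (rule borel_integrable_compact)
    show "compact (A \<inter> {-T..T})" by (rule closed_Int_compact[OF assms(1)]) simp
    show "continuous_on (A \<inter> {-T..T}) (\<lambda>t. \<psi> (x + t *\<^sub>R y))"
      by (intro continuous_on_compose2[OF assms(2)] continuous_intros) auto
  qed
  moreover have "(\<lambda>t. indicator (A \<inter> {-T..T}) t *\<^sub>R \<psi> (x + t *\<^sub>R y)) = (\<lambda>t. indicator A t *\<^sub>R \<psi> (x + t *\<^sub>R y))"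
    using assms(3) by (force simp: indicator_def fun_eq_iff)
  ultimately show ?thesis unfolding set_integrable_def by simp
qed

lemma integrable_on_line:
  assumes \<psi>: "supported K \<psi>" and "\<And>t. t \<in> A \<Longrightarrow> t *\<^sub>R y \<in> K"
    and "escaping A y {0}" "closed A"
  shows "set_integrable lborel A (\<lambda>t. \<psi> (x + t *\<^sub>R y))"
proof -
  obtain T where "\<And>x' a t. a \<in> {x} \<Longrightarrow> x' - a \<in> {0} \<Longrightarrow> t \<in> A \<Longrightarrow> \<psi> (x' + t *\<^sub>R y) \<noteq> 0 \<Longrightarrow>
    \<bar>t\<bar> \<le> T \<and> norm x' \<le> T"
    by (rule escaping_bound[OF \<psi> _ assms(3), of "{x}"]) (use assms(2) in auto)
  then show ?thesis
    using \<psi> assms(4) by (intro set_integrable_on_line[of _ _ _ _ T]) (auto simp: supported_def)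
qed

lemma line_int_add:
  assumes "set_integrable lborel A (\<lambda>t. \<psi> (x + t *\<^sub>R y))" "set_integrable lborel A (\<lambda>t. \<phi> (x + t *\<^sub>R y))"
  shows "line_int A y (\<lambda>x. \<psi> x + \<phi> x) x = line_int A y \<psi> x + line_int A y \<phi> x"
  using assms unfolding line_int_def by (rule set_integral_add(2))

lemma line_int_cmult: "line_int A y (\<lambda>x. c * \<psi> x) x = c * line_int A y \<psi> x"
  unfolding line_int_def by simp

lemma line_int_shift: "line_int A y (\<lambda>x. \<psi> (z + x)) x = line_int A y \<psi> (z + x)"
  by (simp add: line_int_def add.assoc)

lemma continuous_on_line_int_truncated:
  fixes \<psi> :: "'a::euclidean_space \<Rightarrow> real"
  assumes "continuous_on UNIV \<psi>" "A = {a..} \<or> A = UNIV"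
  shows "continuous_on S (line_int (A \<inter> {-T..T}) y \<psi>)"
proof -
  define c where "c = (if A = UNIV then -T else max a (-T))"
  have A: "A \<inter> {-T..T} = cbox c T" using assms(2) by (auto simp: c_def)
  have "line_int (A \<inter> {-T..T}) y \<psi> x = integral (cbox c T) (\<lambda>t. \<psi> (x + t *\<^sub>R y))" for x
    unfolding line_int_def A
    by (intro set_borel_integral_eq_integral(2))
       (unfold set_integrable_def, intro borel_integrable_compact continuous_intros
          continuous_on_compose2[OF assms(1)], auto)
  moreover have "continuous_on S (\<lambda>x. integral (cbox c T) (\<lambda>t. \<psi> (x + t *\<^sub>R y)))"
    by (rule integral_continuous_on_param)
       (auto simp: case_prod_unfold intro!: continuous_intros continuous_on_compose2[OF assms(1)])
  ultimately show ?thesis by simp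
qed

text \<open>Near a given point all integrals may be cut off at a common parameter, which reduces
  continuity to integrals over a compact interval. A nonzero integral requires a nonzero integrand
  somewhere, so the support condition is inherited as well.\<close>

lemma supported_line_int:
  fixes \<psi> :: "'a::euclidean_space \<Rightarrow> real"
  assumes \<psi>: "supported K \<psi>" and K: "\<And>k t. k \<in> K' \<Longrightarrow> t \<in> A \<Longrightarrow> k + t *\<^sub>R y \<in> K"
    and esc: "escaping A y K'" and "0 \<in> K'" and A: "A = {0..} \<or> A = UNIV"
  shows "supported K' (line_int A y \<psi>)"
  unfolding supported_def
proof (intro conjI allI impI)
  have "isCont (line_int A y \<psi>) x0" for x0
  proof -
    obtain T where T: "\<And>x a t. a \<in> ball x0 1 \<Longrightarrow> x - a \<in> K' \<Longrightarrow> t \<in> A \<Longrightarrow> \<psi> (x + t *\<^sub>R y) \<noteq> 0 \<Longrightarrow>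
        \<bar>t\<bar> \<le> T \<and> norm x \<le> T"
      by (rule escaping_bound[OF \<psi> K esc bounded_ball]) blast+
    \<comment> \<open>Since \<open>0 \<in> K'\<close>, each \<open>x\<close> may serve as its own
      base point \<open>a\<close>.\<close>
    have "line_int A y \<psi> x = line_int (A \<inter> {-T..T}) y \<psi> x" if "x \<in> ball x0 1" for x
      using T[OF that, of x] \<open>0 \<in> K'\<close> by (intro line_int_truncate) auto
    then have "continuous_on (ball x0 1) (line_int A y \<psi>)"
      using continuous_on_line_int_truncated[of \<psi> A 0 "ball x0 1" T y] A supported_continuous[OF \<psi>]
      by (subst continuous_on_cong[OF refl]) auto
    then show ?thesis
      by (simp add: continuous_on_eq_continuous_at)
  qed
  then show "continuous_on UNIV (line_int A y \<psi>)" by (simp add: continuous_at_imp_continuous_on)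
next
  fix S :: "'a set" assume "bounded S"
  obtain T where T: "\<And>x a t. a \<in> S \<Longrightarrow> x - a \<in> K' \<Longrightarrow> t \<in> A \<Longrightarrow> \<psi> (x + t *\<^sub>R y) \<noteq> 0 \<Longrightarrow>
        \<bar>t\<bar> \<le> T \<and> norm x \<le> T"
    by (rule escaping_bound[OF \<psi> K esc \<open>bounded S\<close>]) blast+
  have "norm x \<le> T" if x: "line_int A y \<psi> x \<noteq> 0" "a \<in> S" "x - a \<in> K'" for x a
  proof -
    have "\<exists>t\<in>A. \<psi> (x + t *\<^sub>R y) \<noteq> 0"
    proof (rule ccontr)
      assume "\<not> ?thesis"
      then have "(\<lambda>t. indicator A t *\<^sub>R \<psi> (x + t *\<^sub>R y)) = (\<lambda>t. 0)" by (auto simp: indicator_def)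
      then have "line_int A y \<psi> x = 0" by (simp add: line_int_def set_lebesgue_integral_def)
      with x show False by simp
    qed
    then show ?thesis using T x by blast
  qed
  then show "bounded {x. line_int A y \<psi> x \<noteq> 0 \<and> (\<exists>a\<in>S. x - a \<in> K')}"
    unfolding bounded_iff by blast
qed

text \<open>Fubini: \<open>esc\<close> and the support condition confine the integrand to a compact
  part of \<open>A \<times> B\<close>, where continuity gives integrability.\<close>

lemma line_int_commute:
  fixes \<psi> :: "'a::euclidean_space \<Rightarrow> real"
  assumes \<psi>: "supported K \<psi>" and cl: "closed A" "closed B"
    and K: "\<And>s t. s \<in> A \<Longrightarrow> t \<in> B \<Longrightarrow> s *\<^sub>R y + t *\<^sub>R z \<in> K"
    and esc: "\<And>M. bounded {(s,t). s \<in> A \<and> t \<in> B \<and> norm (s *\<^sub>R y + t *\<^sub>R z) \<le> M}"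
  shows "line_int A y (line_int B z \<psi>) x = line_int B z (line_int A y \<psi>) x"
proof -
  have "bounded {w. \<psi> w \<noteq> 0 \<and> (\<exists>a\<in>{x}. w - a \<in> K)}"
    by (rule supported_bounded[OF \<psi>]) simp
  then obtain N where N: "\<And>w. \<psi> w \<noteq> 0 \<Longrightarrow> w - x \<in> K \<Longrightarrow> norm w \<le> N"
    unfolding bounded_iff by blast
  obtain T where T: "\<And>s t. s \<in> A \<Longrightarrow> t \<in> B \<Longrightarrow> norm (s *\<^sub>R y + t *\<^sub>R z) \<le> N + norm x \<Longrightarrow> norm (s,t) \<le> T"
    using esc[of "N + norm x"] unfolding bounded_iff by blast
  define S where "S = (A \<times> B) \<inter> cball 0 T"
  define F where "F s t = \<psi> (x + s *\<^sub>R y + t *\<^sub>R z)" for s t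
  have S: "(s, t) \<in> S" if "s \<in> A" "t \<in> B" "F s t \<noteq> 0" for s t
  proof -
    have "norm (x + s *\<^sub>R y + t *\<^sub>R z) \<le> N"
      using N[of "x + s *\<^sub>R y + t *\<^sub>R z"] K that by (simp add: F_def add.assoc)
    then have "norm (s *\<^sub>R y + t *\<^sub>R z) \<le> N + norm x"
      using norm_triangle_ineq4[of "x + s *\<^sub>R y + t *\<^sub>R z" x] by (simp add: algebra_simps)
    then show ?thesis using T that by (simp add: S_def)
  qed
  have "integrable lborel (\<lambda>p. indicator S p *\<^sub>R (case p of (s,t) \<Rightarrow> F s t))"
    unfolding S_def F_def using cl \<psi>
    by (intro borel_integrable_compact closed_Int_compact closed_Times)
       (auto simp: case_prod_unfold intro!: continuous_intros
          continuous_on_compose2[OF supported_continuous[OF \<psi>, of UNIV]])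
  also have "(\<lambda>p. indicator S p *\<^sub>R (case p of (s,t) \<Rightarrow> F s t)) =
     (\<lambda>(s,t). indicator A s * (indicator B t * F s t))"
    using S by (force simp: indicator_def S_def)
  finally have int: "integrable (lborel \<Otimes>\<^sub>M lborel) (\<lambda>(s,t). indicator A s * (indicator B t * F s t))"
    by (simp add: lborel_prod)
  have "line_int A y (line_int B z \<psi>) x = (\<integral>s. (\<integral>t. indicator A s * (indicator B t * F s t) \<partial>lborel) \<partial>lborel)"
    by (simp add: line_int_def set_lebesgue_integral_def F_def)
  also have "\<dots> = (\<integral>t. (\<integral>s. indicator A s * (indicator B t * F s t) \<partial>lborel) \<partial>lborel)"
    by (rule lborel_pair.Fubini_integral[OF int, symmetric])
  also have "\<dots> = line_int B z (line_int A y \<psi>) x"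
    by (simp add: line_int_def set_lebesgue_integral_def F_def mult.left_commute[of "indicator A _"] add.assoc
        add.commute[of "_ *\<^sub>R y"])
  finally show ?thesis .
qed

abbreviation "ray_int \<equiv> line_int {0..}"
abbreviation "full_int \<equiv> line_int UNIV"

lemma full_int_invariant: "full_int b \<psi> (x + c *\<^sub>R b) = full_int b \<psi> x"
  using lborel_integral_real_affine[of 1 "\<lambda>t. \<psi> (x + t *\<^sub>R b)" c]
  by (simp add: line_int_def set_lebesgue_integral_def algebra_simps)

lemma ray_int_scale:
  assumes "c > 0"
  shows "ray_int (c *\<^sub>R b) \<psi> x = ray_int b \<psi> x / c"
proof -
  have "(\<integral>t. indicator {0..} t * \<psi> (x + t *\<^sub>R b) \<partial>lborel) =
      c * (\<integral>t. indicator {0..} (c * t) * \<psi> (x + (c * t) *\<^sub>R b) \<partial>lborel)"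
    using lborel_integral_real_affine[of c "\<lambda>t. indicator {0..} t * \<psi> (x + t *\<^sub>R b)" 0] assms by simp
  also have "(\<lambda>t. indicator {0..} (c * t) :: real) = indicator {0..}"
    using assms by (auto simp: indicator_def zero_le_mult_iff)
  finally show ?thesis
    using assms by (simp add: line_int_def set_lebesgue_integral_def field_simps)
qed

lemma full_int_split:
  assumes "set_integrable lborel {0..} (\<lambda>t. \<psi> (x + t *\<^sub>R b))"
    and "set_integrable lborel {0..} (\<lambda>t. \<psi> (x + t *\<^sub>R (- b)))"
  shows "full_int b \<psi> x = ray_int b \<psi> x + ray_int (- b) \<psi> x"
proof -
  let ?f = "\<lambda>t. \<psi> (x + t *\<^sub>R b)"
  have eq: "indicator {0..} t *\<^sub>R \<psi> (x + t *\<^sub>R (- b)) = indicator {..0} (- t) *\<^sub>R ?f (- t)" for t :: real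
    by (simp add: indicator_def)
  have "integrable lborel (\<lambda>t. indicator {..0} t *\<^sub>R ?f t)"
    using assms(2) lborel_integrable_real_affine_iff[of "-1" "\<lambda>t. indicator {..0} t *\<^sub>R ?f t" 0]
    unfolding set_integrable_def eq by simp
  moreover have "(LINT t:{..0}|lborel. ?f t) = ray_int (- b) \<psi> x"
    using lborel_integral_real_affine[of "-1" "\<lambda>t. indicator {..0} t *\<^sub>R ?f t" 0]
    unfolding line_int_def set_lebesgue_integral_def eq by simp
  moreover have "AE t in lborel. \<not> (t \<in> {0..} \<and> t \<in> {..0::real})"
    by (rule AE_mp[OF AE_lborel_singleton[of 0]]) auto
  moreover have "{0..} \<union> {..0} = (UNIV :: real set)" by auto
  ultimately show ?thesis
    using set_integral_Un_AE[of "{0..}" "{..0::real}" lborel ?f] assms(1)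
    by (simp add: line_int_def set_integrable_def)
qed

text \<open>Along the ray from \<open>x\<close> the integrand is the derivative of \<open>h\<close>
  times the tail integral of \<open>\<psi>\<close>. This product vanishes at the start because
  \<open>h\<close> does, and for large parameters because the tail does.\<close>

lemma ray_int_product_rule:
  fixes \<psi> :: "real ^ 'n \<Rightarrow> real"
  assumes \<psi>: "supported K \<psi>" and y: "\<And>t. t \<ge> 0 \<Longrightarrow> t *\<^sub>R y \<in> K" "escaping {0..} y {0}"
    and h: "dir_deriv y h = g" "mpoly_eval h x = 0"
    and cont: "continuous_on UNIV (ray_int y \<psi>)"
  shows "ray_int y (\<lambda>x. mpoly_eval g x * ray_int y \<psi> x - mpoly_eval h x * \<psi> x) x = 0"
proof -
  obtain T where T: "T \<ge> 0" "\<And>x' a t. a \<in> {x} \<Longrightarrow> x' - a \<in> {0} \<Longrightarrow> t \<in> {0..} \<Longrightarrow> \<psi> (x' + t *\<^sub>R y) \<noteq> 0 \<Longrightarrow>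
      \<bar>t\<bar> \<le> T \<and> norm x' \<le> T"
    by (rule escaping_bound[OF \<psi> _ y(2), of "{x}"]) (use y(1) in auto)
  have van: "\<psi> (x + t *\<^sub>R y) = 0" if "t > T" for t using T(2)[of x x t] T(1) that by force
  define p where "p t = \<psi> (x + t *\<^sub>R y)" for t
  define \<theta> where "\<theta> z = mpoly_eval g z * ray_int y \<psi> z - mpoly_eval h z * \<psi> z" for z
  have p: "continuous_on S p" for S
    unfolding p_def
    by (rule continuous_on_compose2[OF supported_continuous[OF \<psi>, of UNIV]])
       (intro continuous_intros, simp)
  have u: "ray_int y \<psi> (x + t *\<^sub>R y) = (LINT s:{t..}|lborel. p s)" for t
    using lborel_integral_real_affine[of 1 "\<lambda>s. indicator {t..} s *\<^sub>R p s" t]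
    by (simp add: line_int_def set_lebesgue_integral_def p_def algebra_simps indicator_def)
  have u1: "ray_int y \<psi> (x + t *\<^sub>R y) = integral {t..T} p" for t
  proof -
    have "(LINT s:{t..}|lborel. p s) = (LINT s:{t..T}|lborel. p s)"
      unfolding set_lebesgue_integral_def
      by (rule Bochner_Integration.integral_cong) (use van in \<open>force simp: indicator_def p_def\<close>)+
    also have "\<dots> = integral {t..T} p"
      by (rule set_borel_integral_eq_integral(2))
         (unfold set_integrable_def, intro borel_integrable_compact p compact_Icc)
    finally show ?thesis using u by simp
  qed
  have u2: "integral {t..T} p = integral {0..T} p - integral {0..t} p" if "t \<in> {0..T}" for t
    using Henstock_Kurzweil_Integration.integral_combine[of 0 t T p] that integrable_continuous_interval[OF p] by (simp add: algebra_simps)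
  have u3: "ray_int y \<psi> (x + t *\<^sub>R y) = 0" if "t \<ge> T" for t
    using u1[of t] that by (cases "t = T") auto
  define F where "F t = mpoly_eval h (x + t *\<^sub>R y) * (integral {0..T} p - integral {0..t} p)" for t
  have "(F has_vector_derivative \<theta> (x + t *\<^sub>R y)) (at t within {0..T})" if t: "t \<in> {0..T}" for t
  proof -
    have 1: "((\<lambda>t. mpoly_eval h (x + t *\<^sub>R y)) has_real_derivative mpoly_eval g (x + t *\<^sub>R y)) (at t within {0..T})"
      using mpoly_eval_has_real_derivative[of h x y t] h(1) has_field_derivative_at_within by blast
    have 2: "((\<lambda>t. integral {0..t} p) has_real_derivative p t) (at t within {0..T})"
      by (rule integral_has_real_derivative[OF p t])
    have "(F has_real_derivative mpoly_eval g (x + t *\<^sub>R y) * (integral {0..T} p - integral {0..t} p)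
        - mpoly_eval h (x + t *\<^sub>R y) * p t) (at t within {0..T})"
      unfolding F_def by (rule derivative_eq_intros 1 2 refl | simp)+
    then show ?thesis
      using u1[of t] u2[OF t] by (simp add: has_real_derivative_iff_has_vector_derivative \<theta>_def p_def)
  qed
  then have "((\<lambda>t. \<theta> (x + t *\<^sub>R y)) has_integral (F T - F 0)) {0..T}"
    by (rule fundamental_theorem_of_calculus[OF T(1)])
  moreover have "F T - F 0 = 0" by (simp add: F_def h(2))
  ultimately have I: "integral {0..T} (\<lambda>t. \<theta> (x + t *\<^sub>R y)) = 0" by (simp add: integral_unique)
  have \<theta>: "continuous_on UNIV \<theta>"
    unfolding \<theta>_def using \<psi> cont
    by (intro continuous_intros continuous_on_mpoly_eval) (auto simp: supported_def)
  have "ray_int y \<theta> x = (LINT t:{0..T}|lborel. \<theta> (x + t *\<^sub>R y))"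
    unfolding set_lebesgue_integral_def line_int_def
  proof (rule Bochner_Integration.integral_cong)
    fix t :: real
    have "\<theta> (x + t *\<^sub>R y) = 0" if "t > T" using that u3[of t] van[of t] by (simp add: \<theta>_def)
    then show "indicator {0..} t *\<^sub>R \<theta> (x + t *\<^sub>R y) = indicator {0..T} t *\<^sub>R \<theta> (x + t *\<^sub>R y)"
      by (force simp: indicator_def)
  qed simp
  also have "continuous_on {0..T} (\<lambda>t. \<theta> (x + t *\<^sub>R y))"
    by (rule continuous_on_compose2[OF \<theta>]) (intro continuous_intros, simp)
  then have "set_integrable lborel {0..T} (\<lambda>t. \<theta> (x + t *\<^sub>R y))"
    unfolding set_integrable_def by (rule borel_integrable_compact[OF compact_Icc])
  then have "(LINT t:{0..T}|lborel. \<theta> (x + t *\<^sub>R y)) = 0"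
    using set_borel_integral_eq_integral(2) I by metis
  finally show ?thesis by (simp add: \<theta>_def[abs_def])
qed

lemma foldr_line_int_shift:
  "foldr (line_int A) bs (\<lambda>z. \<psi> (a + z)) = (\<lambda>z. foldr (line_int A) bs \<psi> (a + z))"
  by (induction bs) (auto simp: line_int_shift)

lemma foldr_line_int_shift':
  "foldr (line_int A) bs (\<lambda>z. \<psi> (z + a)) = (\<lambda>z. foldr (line_int A) bs \<psi> (z + a))"
  using foldr_line_int_shift[of A bs \<psi> a] by (simp add: add.commute)

text \<open>Invariance under \<open>b\<close> holds for the integral along \<open>b\<close> itself,
  and a translation passes through the integrals outside it.\<close>

lemma foldr_full_int_invariant:
  assumes "w \<in> span (set bs)"
  shows "foldr full_int bs \<psi> (x + w) = foldr full_int bs \<psi> x"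
proof -
  let ?S = "{w. \<forall>c x. foldr full_int bs \<psi> (x + c *\<^sub>R w) = foldr full_int bs \<psi> x}"
  have "b \<in> ?S" if b: "b \<in> set bs" for b
  proof -
    obtain as cs where bs: "bs = as @ b # cs" using b by (meson split_list)
    let ?\<theta> = "full_int b (foldr full_int cs \<psi>)"
    have "foldr full_int bs \<psi> (x + c *\<^sub>R b) = foldr full_int bs \<psi> x" for c x
    proof -
      have "(\<lambda>z. ?\<theta> (z + c *\<^sub>R b)) = ?\<theta>" by (rule ext) (rule full_int_invariant)
      then have "foldr full_int as (\<lambda>z. ?\<theta> (z + c *\<^sub>R b)) x = foldr full_int as ?\<theta> x" by simp
      then show ?thesis by (simp add: bs foldr_line_int_shift')
    qed
    then show ?thesis by blast
  qed
  moreover have "subspace ?S"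
  proof (rule subspaceI)
    fix v w assume "v \<in> ?S" "w \<in> ?S"
    then show "v + w \<in> ?S" by (simp add: scaleR_add_right flip: add.assoc)
  qed simp_all
  ultimately have "span (set bs) \<subseteq> ?S" by (intro span_minimal) auto
  then have "w \<in> ?S" using assms by blast
  then have "foldr full_int bs \<psi> (x + 1 *\<^sub>R w) = foldr full_int bs \<psi> x" by blast
  then show ?thesis by simp
qed

lemma foldr_line_int_cong:
  assumes "subspace S" "set bs \<subseteq> S" "\<And>x. x \<in> S \<Longrightarrow> \<theta> x = \<theta>' x" "x \<in> S"
  shows "foldr (line_int A) bs \<theta> x = foldr (line_int A) bs \<theta>' x"
  using assms(2,4)
proof (induction bs arbitrary: x)
  case (Cons b bs)
  have "foldr (line_int A) bs \<theta> (x + t *\<^sub>R b) = foldr (line_int A) bs \<theta>' (x + t *\<^sub>R b)" for t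
    using Cons assms(1) by (intro Cons.IH) (auto intro: subspace_add subspace_scale)
  then show ?case by (simp add: line_int_def[of A b])
qed (use assms in auto)

lemma foldr_line_int_cmult:
  "foldr (line_int A) bs (\<lambda>x. c * \<theta> x) = (\<lambda>x. c * foldr (line_int A) bs \<theta> x)"
  by (induction bs) (auto simp: line_int_cmult)

subsection \<open>Coordinates with respect to an ordered basis\<close>

locale ordered_basis =
  fixes B :: "(real ^ 'n::finite) list"
  assumes distinct_B: "distinct B" and independent_B: "independent (set B)" and span_B: "span (set B) = UNIV"
begin

lemma length_B: "length B = CARD('n)"
proof -
  have "dim (UNIV :: (real ^ 'n) set) = card (set B)"
    by (rule basis_card_eq_dim[symmetric]) (use independent_B span_B in auto)
  then show ?thesis using distinct_B by (simp add: distinct_card)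
qed

definition coord :: "nat \<Rightarrow> real ^ 'n \<Rightarrow> real" where
  "coord j x = representation (set B) x (B ! j)"

lemma linear_coord: "linear (coord j)"
  by (rule linearI) (simp_all add: coord_def representation_add representation_scale independent_B span_B)

lemmas coord_simps = linear_add[OF linear_coord] linear_diff[OF linear_coord]
  linear_cmul[OF linear_coord] linear_neg[OF linear_coord] linear_0[OF linear_coord]

lemma coord_B: "i < length B \<Longrightarrow> j < length B \<Longrightarrow> coord j (B ! i) = (if i = j then 1 else 0)"
  using distinct_B by (auto simp: coord_def representation_basis independent_B nth_eq_iff_index_eq)

lemma coord_expansion: "x = (\<Sum>j<length B. coord j x *\<^sub>R B ! j)"
proof -
  have "x = (\<Sum>b\<in>set B. representation (set B) x b *\<^sub>R b)"
    using sum_representation_eq[OF independent_B, of x "set B"] span_B by simp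
  also have "\<dots> = (\<Sum>j<length B. coord j x *\<^sub>R B ! j)"
    unfolding coord_def
    by (rule sum.reindex_bij_betw[symmetric]) (use distinct_B in \<open>auto intro: bij_betw_nth\<close>)
  finally show ?thesis .
qed

text \<open>The flag space with \<open>i\<close> generators (\<open>flag_eq_sub\<close>), described
  by vanishing coordinates so that the layer of a vector can be tested one coordinate at a
  time.\<close>

definition sub :: "nat \<Rightarrow> (real ^ 'n) set" where
  "sub i = {x. \<forall>j. i \<le> j \<longrightarrow> j < length B \<longrightarrow> coord j x = 0}"

lemma subspace_sub: "subspace (sub i)"
  by (rule subspaceI) (auto simp: sub_def coord_simps)

lemma flag_eq_sub:
  assumes "i \<le> length B"
  shows "flag B i = sub i"
proof
  have "set (take i B) \<subseteq> sub i"
    using assms by (auto simp: sub_def in_set_conv_nth coord_B)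
  then show "flag B i \<subseteq> sub i"
    unfolding flag_def by (rule span_minimal[OF _ subspace_sub])
  show "sub i \<subseteq> flag B i"
  proof
    fix x assume x: "x \<in> sub i"
    have "x = (\<Sum>j<i. coord j x *\<^sub>R B ! j)"
      by (subst coord_expansion, rule sum.mono_neutral_right)
         (use x assms in \<open>auto simp: sub_def\<close>)
    moreover have "B ! j \<in> set (take i B)" if "j < i" for j
      using that assms by (metis in_set_conv_nth length_take min.absorb2 nth_take)
    ultimately show "x \<in> flag B i"
      unfolding flag_def by (metis (no_types, lifting) lessThan_iff span_base span_scale span_sum)
  qed
qed

lemma sub_mono: "i \<le> j \<Longrightarrow> sub i \<subseteq> sub j"
  by (auto simp: sub_def)

lemma sub_full: "length B \<le> i \<Longrightarrow> sub i = UNIV"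
  by (auto simp: sub_def)

lemma sub_0: "sub 0 = {0}"
proof -
  have "x = 0" if "x \<in> sub 0" for x
    by (subst coord_expansion) (use that in \<open>simp add: sub_def\<close>)
  then show ?thesis by (auto simp: sub_def coord_simps)
qed

lemma B_in_sub: "j < i \<Longrightarrow> j < length B \<Longrightarrow> B ! j \<in> sub i"
  by (auto simp: sub_def coord_B)

lemma sub_Suc_coord_0: "x \<in> sub (Suc i) \<Longrightarrow> coord i x = 0 \<Longrightarrow> x \<in> sub i"
  unfolding sub_def using le_neq_implies_less Suc_leI by blast

text \<open>Integration over \<open>sub i\<close> in the coordinates of \<open>B\<close>: the
  integral along the first basis vector is outermost, the one along the last of the \<open>i\<close>
  vectors innermost.\<close>

abbreviation "\<Lambda> i \<theta> \<equiv> foldr full_int (take i B) \<theta> 0"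

lemma full_int_supported:
  assumes "j < length B" "supported (sub (Suc j)) \<theta>"
  shows "supported (sub j) (full_int (B ! j) \<theta>)"
proof (rule supported_line_int[OF assms(2)])
  show "escaping UNIV (B ! j) (sub j)"
    by (rule escaping_line[of "coord j"]) (use assms in \<open>auto simp: linear_coord coord_B sub_def\<close>)
  show "k + t *\<^sub>R B ! j \<in> sub (Suc j)" if "k \<in> sub j" for k t
    using that assms by (auto simp: sub_def coord_simps coord_B)
qed (auto simp: sub_def coord_simps)

lemma \<Lambda>_add:
  assumes "i \<le> length B" "supported (sub i) \<theta>" "supported (sub i) \<theta>'"
  shows "\<Lambda> i (\<lambda>x. \<theta> x + \<theta>' x) = \<Lambda> i \<theta> + \<Lambda> i \<theta>'"
  using assms
proof (induction i arbitrary: \<theta> \<theta>')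
  case (Suc i)
  have int: "set_integrable lborel UNIV (\<lambda>t. \<theta> (x + t *\<^sub>R B ! i))"
    if "supported (sub (Suc i)) \<theta>" for \<theta> x
  proof (rule integrable_on_line[OF that])
    show "escaping UNIV (B ! i) {0}"
      by (rule escaping_line[of "coord i"]) (use Suc.prems in \<open>auto simp: linear_coord coord_B coord_simps\<close>)
    show "t *\<^sub>R B ! i \<in> sub (Suc i)" for t
      using Suc.prems by (auto simp: sub_def coord_simps coord_B)
  qed simp
  have "full_int (B ! i) (\<lambda>x. \<theta> x + \<theta>' x) = (\<lambda>x. full_int (B ! i) \<theta> x + full_int (B ! i) \<theta>' x)"
    by (rule ext, rule line_int_add) (use int Suc.prems in auto)
  then show ?case
    using Suc full_int_supported[of i] by (simp add: take_Suc_conv_app_nth)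
qed simp

lemma \<Lambda>_cmult: "\<Lambda> i (\<lambda>x. c * \<theta> x) = c * \<Lambda> i \<theta>"
  by (simp add: foldr_line_int_cmult)

lemma \<Lambda>_cong:
  assumes "i \<le> length B" "\<And>x. x \<in> sub i \<Longrightarrow> \<theta> x = \<theta>' x"
  shows "\<Lambda> i \<theta> = \<Lambda> i \<theta>'"
proof (rule foldr_line_int_cong[OF subspace_sub _ assms(2)])
  show "set (take i B) \<subseteq> sub i" using assms(1) flag_eq_sub[of i] span_superset unfolding flag_def by blast
qed (auto simp: subspace_0[OF subspace_sub])

end

section \<open>Integration by parts on one half of a layer\<close>

lemma bounded_prod_subset:
  assumes "bounded S" "bounded T" "\<And>s t. (s, t) \<in> W \<Longrightarrow> s \<in> S \<and> t \<in> T"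
  shows "bounded W"
  by (rule bounded_subset[OF bounded_Times[OF assms(1,2)]]) (use assms(3) in auto)

text \<open>The sign selects one of the two half spaces of \<open>sub (Suc i)\<close> bounded by
  \<open>sub i\<close>: \<open>1\<close> serves \<open>T_plus\<close> and \<open>-1\<close> serves
  \<open>T_minus\<close>, so that the integration by parts is done once for both.\<close>

locale half_level = ordered_basis B for B :: "(real ^ 'n::finite) list" +
  fixes i :: nat and \<sigma> :: real
  assumes i_less: "i < length B" and \<sigma>: "\<sigma> = 1 \<or> \<sigma> = -1"
begin

definition l :: "real ^ 'n \<Rightarrow> real" where "l x = \<sigma> * coord i x"

sublocale hyperplane l
  by standard (auto intro!: linearI simp: l_def coord_simps algebra_simps)

definition cone :: "(real ^ 'n) set" where "cone = {x \<in> sub (Suc i). l x \<ge> 0}"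

definition e :: "real ^ 'n" where "e = \<sigma> *\<^sub>R B ! i"

lemma l_e: "l e = 1"
  using \<sigma> i_less by (auto simp: l_def e_def coord_simps coord_B)

lemma e_sub: "e \<in> sub (Suc i)"
  unfolding e_def using i_less by (intro subspace_scale[OF subspace_sub] B_in_sub) auto

lemma cone_add: "x \<in> cone \<Longrightarrow> y \<in> cone \<Longrightarrow> x + y \<in> cone"
  by (auto simp: cone_def l_simps intro: subspace_add[OF subspace_sub])

lemma cone_scale: "x \<in> cone \<Longrightarrow> c \<ge> 0 \<Longrightarrow> c *\<^sub>R x \<in> cone"
  by (auto simp: cone_def l_simps intro: subspace_scale[OF subspace_sub])

lemma cone_0: "0 \<in> cone"
  by (auto simp: cone_def l_simps subspace_0[OF subspace_sub])

lemma l_sub_i: "x \<in> sub i \<Longrightarrow> l x = 0"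
  using i_less by (auto simp: l_def sub_def)

lemma sub_i_cone: "sub i \<subseteq> cone"
  using sub_mono[of i "Suc i"] by (auto simp: cone_def l_sub_i)

lemma escaping_cone: "l y > 0 \<Longrightarrow> escaping {0..} y cone"
  by (rule escaping_half_line[of l]) (auto simp: linear cone_def)

lemma escaping_cone_0: "l y > 0 \<Longrightarrow> escaping {0..} y {0}"
  by (rule escaping_half_line[of l]) (auto simp: linear l_simps)

lemma ray_int_supported:
  assumes "supported cone \<psi>" "y \<in> sub (Suc i)" "l y > 0"
  shows "supported cone (ray_int y \<psi>)"
  using assms
  by (intro supported_line_int[OF assms(1)] cone_add cone_scale escaping_cone cone_0)
     (auto simp: cone_def)

lemma foldr_ray_int_supported:
  assumes "supported cone \<psi>" "\<forall>y\<in>set Y. y \<in> sub (Suc i) \<and> l y > 0"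
  shows "supported cone (foldr ray_int Y \<psi>)"
  using assms(2) by (induction Y) (auto simp: assms(1) ray_int_supported)

lemma ray_integrable:
  assumes "supported cone \<psi>" "y \<in> sub (Suc i)" "l y > 0"
  shows "set_integrable lborel {0..} (\<lambda>t. \<psi> (x + t *\<^sub>R y))"
  by (rule integrable_on_line[OF assms(1)]) 
     (use assms in \<open>auto simp: cone_def escaping_cone_0 l_simps intro: subspace_scale[OF subspace_sub]\<close>)

text \<open>Fubini, one line integral at a time. The support condition refers to the set swept out
  from \<open>sub j\<close> by the ray, which shrinks in step with the induction on
  \<open>j\<close>.\<close>

lemma ray_full_commute:
  assumes v: "v \<in> sub (Suc i)" "l v > 0" and "j \<le> i"
    and "supported {s + t *\<^sub>R v | s t. s \<in> sub j \<and> t \<ge> 0} \<psi>"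
  shows "foldr full_int (take j B) (ray_int v \<psi>) = ray_int v (foldr full_int (take j B) \<psi>)"
  using assms(3,4)
proof (induction j arbitrary: \<psi>)
  case (Suc j)
  define C where "C j = {s + t *\<^sub>R v | s t. s \<in> sub j \<and> t \<ge> 0}" for j
  \<comment> \<open>A functional that is 1 on \<open>B ! j\<close> and 0 on \<open>sub j\<close> and
    on \<open>v\<close>; the multiple of \<open>l\<close> removes the contribution of
    \<open>v\<close>. It shows that the line along \<open>B ! j\<close> escapes.\<close>
  define \<mu> where "\<mu> x = coord j x - coord j v / l v * l x" for x
  have j: "j < length B" "j < i" using Suc.prems i_less by auto
  have l\<mu>: "linear \<mu>"
    by (rule linearI) (simp_all add: \<mu>_def coord_simps l_simps algebra_simps)
  have lB: "l (B ! j) = 0" using j i_less by (simp add: l_def coord_B)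
  have \<mu>B: "\<mu> (B ! j) = 1" using j lB by (simp add: \<mu>_def coord_B)
  have \<mu>v: "\<mu> (t *\<^sub>R v) = 0" for t using v(2) by (simp add: \<mu>_def coord_simps l_simps)
  have \<mu>s: "\<mu> s = 0" if "s \<in> sub j" for s
    using that j i_less by (simp add: \<mu>_def sub_def l_def)
  have \<mu>C: "\<mu> x = 0" if "x \<in> C j" for x
    using that \<mu>v \<mu>s by (auto simp: C_def linear_add[OF l\<mu>])
  have step: "s + c *\<^sub>R B ! j \<in> sub (Suc j)" if "s \<in> sub j" for s c
    using that j by (auto simp: sub_def coord_simps coord_B)
  have \<psi>: "supported (C (Suc j)) \<psi>" using Suc.prems by (simp add: C_def)
  have "supported (C j) (full_int (B ! j) \<psi>)"
  proof (rule supported_line_int[OF \<psi>])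
    show "escaping UNIV (B ! j) (C j)"
      by (rule escaping_line[OF l\<mu>]) (auto simp: \<mu>B \<mu>C)
    show "k + t *\<^sub>R B ! j \<in> C (Suc j)" if k: "k \<in> C j" for k t
    proof -
      obtain s t' where k: "k = s + t' *\<^sub>R v" "s \<in> sub j" "t' \<ge> 0" using k unfolding C_def by blast
      have "k + t *\<^sub>R B ! j = (s + t *\<^sub>R B ! j) + t' *\<^sub>R v" by (simp add: k)
      then show ?thesis unfolding C_def using k step by blast
    qed
    show "0 \<in> C j" unfolding C_def using subspace_0[OF subspace_sub]
      by (intro CollectI exI[of _ 0]) auto
  qed auto
  then have IH: "foldr full_int (take j B) (ray_int v (full_int (B ! j) \<psi>)) =
      ray_int v (foldr full_int (take j B) (full_int (B ! j) \<psi>))"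
    using Suc.IH[of "full_int (B ! j) \<psi>"] Suc.prems by (simp add: C_def)
  have "full_int (B ! j) (ray_int v \<psi>) x = ray_int v (full_int (B ! j) \<psi>) x" for x
  proof (rule line_int_commute[OF \<psi>])
    show "s *\<^sub>R B ! j + t *\<^sub>R v \<in> C (Suc j)" if "t \<in> {0..}" for s t
      unfolding C_def using that step[of 0 s] subspace_0[OF subspace_sub] by auto
    fix M
    have "escaping UNIV (B ! j) (range (\<lambda>t. t *\<^sub>R v))"
      by (rule escaping_line[OF l\<mu>]) (auto simp: \<mu>B \<mu>v)
    then have 1: "bounded {s \<in> UNIV. \<exists>k\<in>range (\<lambda>t. t *\<^sub>R v). norm (k + s *\<^sub>R B ! j) \<le> M}"
      by (simp only: escaping_def)
    have "escaping {0..} v (range (\<lambda>s. s *\<^sub>R B ! j))"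
      by (rule escaping_half_line[OF linear]) (auto simp: l_simps lB v)
    then have 2: "bounded {t \<in> {0..}. \<exists>k\<in>range (\<lambda>s. s *\<^sub>R B ! j). norm (k + t *\<^sub>R v) \<le> M}"
      by (simp only: escaping_def)
    show "bounded {(s, t). s \<in> UNIV \<and> t \<in> {0..} \<and> norm (s *\<^sub>R B ! j + t *\<^sub>R v) \<le> M}"
      by (rule bounded_prod_subset[OF 1 2]) (auto simp: add.commute)
  qed auto
  then have "full_int (B ! j) (ray_int v \<psi>) = ray_int v (full_int (B ! j) \<psi>)" by blast
  then show ?case using IH j by (simp add: take_Suc_conv_app_nth)
qed simp

text \<open>The vector \<open>y - l y *\<^sub>R e\<close> lies in \<open>sub i\<close>, and the
  integral over \<open>sub i\<close> is invariant under translations by this space. So only the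
  component of \<open>y\<close> along \<open>e\<close> counts, and rescaling it gives the factor
  \<open>1 / l y\<close>.\<close>

lemma \<Lambda>_ray_int_shear:
  assumes \<theta>: "supported cone \<theta>" and y: "y \<in> sub (Suc i)" "l y > 0"
  shows "\<Lambda> i (ray_int y \<theta>) = \<Lambda> i (ray_int e \<theta>) / l y"
proof -
  define \<Psi> where "\<Psi> = foldr full_int (take i B) \<theta>"
  have *: "\<Lambda> i (ray_int v \<theta>) = ray_int v \<Psi> 0" if v: "v \<in> sub (Suc i)" "l v > 0" for v
  proof -
    have "supported {s + t *\<^sub>R v | s t. s \<in> sub i \<and> t \<ge> 0} \<theta>"
    proof (rule supported_mono[OF \<theta>], safe)
      fix s t assume "s \<in> sub i" "(t::real) \<ge> 0"
      then show "s + t *\<^sub>R v \<in> cone"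
        using sub_i_cone v by (intro cone_add cone_scale) (auto simp: cone_def)
    qed
    then show ?thesis using ray_full_commute[OF v, of i \<theta>] by (simp add: \<Psi>_def)
  qed
  define s where "s = y - l y *\<^sub>R e"
  have "s \<in> sub (Suc i)"
    unfolding s_def using y e_sub by (intro subspace_diff subspace_scale subspace_sub) auto
  moreover have "l s = 0" by (simp add: s_def l_simps l_e)
  ultimately have s: "s \<in> sub i" using sub_Suc_coord_0[of s i] \<sigma> by (auto simp: l_def)
  have "\<Psi> (0 + t *\<^sub>R y) = \<Psi> (0 + t *\<^sub>R (l y *\<^sub>R e))" for t
  proof -
    have "t *\<^sub>R s \<in> span (set (take i B))"
      using subspace_scale[OF subspace_sub s] flag_eq_sub[of i] i_less by (simp add: flag_def)
    from foldr_full_int_invariant[OF this, of \<theta> "t *\<^sub>R (l y *\<^sub>R e)"]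
    show ?thesis by (simp add: \<Psi>_def s_def algebra_simps)
  qed
  then have "ray_int y \<Psi> 0 = ray_int (l y *\<^sub>R e) \<Psi> 0" by (simp add: line_int_def)
  then show ?thesis
    using *[OF y] *[OF e_sub] l_e ray_int_scale[OF y(2), of e \<Psi> 0] by simp
qed

lemma supported_mpoly:
  "supported K \<psi> \<Longrightarrow> supported K (\<lambda>x. mpoly_eval f x * \<psi> x)"
  by (rule supported_mult[OF _ continuous_on_mpoly_eval])

text \<open>On rays along \<open>y\<close> that start in \<open>sub i\<close>, the polynomial
  \<open>extend y f\<close> is constant with value \<open>f / l y\<close> taken at the starting
  point; hence \<open>f\<close> may be moved inside the ray integral. The factor \<open>l y\<close>
  cancels against the one from replacing \<open>y\<close> by \<open>e\<close>.\<close>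

lemma level_step_single:
  assumes \<psi>: "supported cone \<psi>" and y: "y \<in> sub (Suc i)" "l y > 0"
  shows "\<Lambda> i (\<lambda>x. mpoly_eval f x * ray_int y \<psi> x) =
    \<Lambda> i (ray_int e (\<lambda>x. mpoly_eval (extend y f) x * \<psi> x))"
proof -
  let ?\<theta> = "\<lambda>x. l y * (mpoly_eval (extend y f) x * \<psi> x)"
  have "\<Lambda> i (\<lambda>x. mpoly_eval f x * ray_int y \<psi> x) = \<Lambda> i (ray_int y ?\<theta>)"
  proof (rule \<Lambda>_cong)
    fix x assume "x \<in> sub i"
    then have "l x = 0" by (rule l_sub_i)
    then have "?\<theta> (x + t *\<^sub>R y) = mpoly_eval f x * \<psi> (x + t *\<^sub>R y)" for t
      using y proj_line[of y x t] by (simp add: eval_extend proj_id)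
    then have "ray_int y ?\<theta> x = ray_int y (\<lambda>z. mpoly_eval f x * \<psi> z) x"
      unfolding line_int_def by (simp only:)
    then show "mpoly_eval f x * ray_int y \<psi> x = ray_int y ?\<theta> x"
      by (simp only: line_int_cmult)
  qed (use i_less in simp)
  also have "\<dots> = \<Lambda> i (ray_int e ?\<theta>) / l y"
    by (rule \<Lambda>_ray_int_shear[OF _ y]) (intro supported_cmult supported_mpoly \<psi>)
  also have "ray_int e ?\<theta> = (\<lambda>x. l y * ray_int e (\<lambda>x. mpoly_eval (extend y f) x * \<psi> x) x)"
    by (rule ext) (rule line_int_cmult)
  finally show ?thesis using y by (simp add: \<Lambda>_cmult)
qed

text \<open>Integration by parts along \<open>y\<close>; the boundary term vanishes on the hyperplane.\<close>

lemma level_step_primitive: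
  assumes \<psi>: "supported cone \<psi>" and y: "y \<in> sub (Suc i)" "l y > 0"
  shows "\<Lambda> i (ray_int e (\<lambda>x. mpoly_eval g x * ray_int y \<psi> x)) =
    \<Lambda> i (ray_int e (\<lambda>x. mpoly_eval (primitive y g) x * \<psi> x))"
proof -
  let ?h = "primitive y g"
  define \<theta> where "\<theta> = (\<lambda>x. mpoly_eval g x * ray_int y \<psi> x - mpoly_eval ?h x * \<psi> x)"
  have g: "supported cone (\<lambda>x. mpoly_eval g x * ray_int y \<psi> x)"
    and h: "supported cone (\<lambda>x. mpoly_eval ?h x * \<psi> x)"
    using ray_int_supported[OF \<psi> y] \<psi> by (intro supported_mpoly; simp)+
  have \<theta>: "supported cone \<theta>"
    using supported_add[OF g supported_cmult[OF h, of "-1"]] by (simp add: \<theta>_def)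
  \<comment> \<open>The constant is written as a product so that \<open>\<Lambda>_cmult\<close>
    evaluates its integral to 0.\<close>
  have "\<Lambda> i (ray_int y \<theta>) = \<Lambda> i (\<lambda>_. 0 * 0)"
  proof (rule \<Lambda>_cong)
    fix x assume "x \<in> sub i"
    then have "l x = 0" by (rule l_sub_i)
    have "ray_int y \<theta> x = 0"
      unfolding \<theta>_def
    proof (rule ray_int_product_rule[OF \<psi>])
      show "t *\<^sub>R y \<in> cone" if "t \<ge> 0" for t using that y by (intro cone_scale) (auto simp: cone_def)
    qed (use y \<open>l x = 0\<close> ray_int_supported[OF \<psi> y] in
        \<open>auto simp: escaping_cone_0 dir_deriv_primitive eval_primitive supported_continuous\<close>)
    then show "ray_int y \<theta> x = 0 * 0" by simp
  qed (use i_less in simp)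
  then have "\<Lambda> i (ray_int e \<theta>) = 0"
    using \<Lambda>_ray_int_shear[OF \<theta> y] y \<Lambda>_cmult[of i 0 "\<lambda>_. 0"] by simp
  moreover have "ray_int e (\<lambda>x. mpoly_eval g x * ray_int y \<psi> x) =
      (\<lambda>x. ray_int e \<theta> x + ray_int e (\<lambda>x. mpoly_eval ?h x * \<psi> x) x)"
  proof
    fix x
    have "ray_int e (\<lambda>x. \<theta> x + mpoly_eval ?h x * \<psi> x) x =
        ray_int e \<theta> x + ray_int e (\<lambda>x. mpoly_eval ?h x * \<psi> x) x"
      by (rule line_int_add) (use ray_integrable[OF \<theta>] ray_integrable[OF h] e_sub l_e in auto)
    then show "ray_int e (\<lambda>x. mpoly_eval g x * ray_int y \<psi> x) x =
        ray_int e \<theta> x + ray_int e (\<lambda>x. mpoly_eval ?h x * \<psi> x) x" by (simp add: \<theta>_def)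
  qed
  moreover have "supported (sub i) (ray_int e \<theta>)"
    "supported (sub i) (ray_int e (\<lambda>x. mpoly_eval ?h x * \<psi> x))"
    using ray_int_supported \<theta> h e_sub l_e by (auto intro: supported_mono[OF _ sub_i_cone])
  ultimately show ?thesis using \<Lambda>_add[of i] i_less by simp
qed

text \<open>The last vector of \<open>Y\<close> is integrated first. In the induction it is regarded
  as part of the function \<open>\<psi>\<close>, and one further step then moves it into the
  polynomial.\<close>

lemma level_step:
  assumes "supported cone \<psi>" "\<forall>y\<in>set Y. y \<in> sub (Suc i) \<and> l y > 0" "Y \<noteq> []"
  shows "\<Lambda> i (\<lambda>x. mpoly_eval f x * foldr ray_int Y \<psi> x) =
    \<Lambda> i (ray_int e (\<lambda>x. mpoly_eval (level Y f) x * \<psi> x))"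
  using assms
proof (induction Y arbitrary: \<psi> rule: rev_induct)
  case (snoc y Y)
  then show ?case
    using level_step_single[of \<psi> y f] level_step_primitive[of \<psi> y "level Y f"] ray_int_supported[of \<psi> y]
    by (cases "Y = []") (simp_all add: level_single level_snoc)
qed simp

end

section \<open>Cone distributions as iterated ray integrals\<close>

lemma PiM_integral_insert_line_int:
  fixes \<phi> :: "'a::euclidean_space \<Rightarrow> real" and A :: "'i \<Rightarrow> real set"
  assumes J: "finite J" "m \<notin> J" and A: "\<And>j. A j \<in> sets borel" and \<phi>: "continuous_on UNIV \<phi>"
    and T: "\<And>c j. c \<in> Pi\<^sub>E (insert m J) A \<Longrightarrow> \<phi> (x + (\<Sum>j\<in>insert m J. c j *\<^sub>R v j)) \<noteq> 0 \<Longrightarrow>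
      j \<in> insert m J \<Longrightarrow> \<bar>c j\<bar> \<le> T"
  shows "(\<integral>c. indicator (Pi\<^sub>E (insert m J) A) c *\<^sub>R \<phi> (x + (\<Sum>j\<in>insert m J. c j *\<^sub>R v j)) \<partial>Pi\<^sub>M (insert m J) (\<lambda>_. lborel)) =
    (\<integral>c. indicator (Pi\<^sub>E J A) c *\<^sub>R line_int (A m) (v m) \<phi> (x + (\<Sum>j\<in>J. c j *\<^sub>R v j)) \<partial>Pi\<^sub>M J (\<lambda>_. lborel))"
proof -
  interpret product_sigma_finite "\<lambda>_::'i. lborel :: real measure"
    by standard
  define I where "I = insert m J"
  have I: "finite I" using J by (simp add: I_def)
  define E where "E c = x + (\<Sum>j\<in>I. c j *\<^sub>R v j)" for c :: "'i \<Rightarrow> real"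
  define M where "M = Pi\<^sub>M I (\<lambda>_. lborel :: real measure)"
  \<comment> \<open>Bounds the norm of \<open>E c\<close> for parameters in the box
    \<open>D\<close>; on the ball of this radius \<open>\<phi>\<close> is bounded, so the integrand
    is bounded on a set of finite measure.\<close>
  define N where "N = norm x + (\<Sum>j\<in>I. \<bar>T\<bar> * norm (v j))"
  define h where "h c = indicator (Pi\<^sub>E I A) c *\<^sub>R \<phi> (E c)" for c
  define D where "D = Pi\<^sub>E I (\<lambda>_. {-T..T})"
  obtain C where C: "\<And>x. norm x \<le> N \<Longrightarrow> \<bar>\<phi> x\<bar> \<le> C"
  proof -
    have "compact (\<phi> ` cball 0 N)"
      by (rule compact_continuous_image[OF continuous_on_subset[OF \<phi>] compact_cball]) simp
    then have "bounded (\<phi> ` cball 0 N)" by (rule compact_imp_bounded)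
    then obtain C where "\<forall>y\<in>\<phi> ` cball 0 N. norm y \<le> C" unfolding bounded_iff by blast
    then show ?thesis by (intro that[of C]) auto
  qed
  have D: "c \<in> D" and hC: "\<bar>h c\<bar> \<le> \<bar>C\<bar>" if c: "h c \<noteq> 0" for c
  proof -
    have *: "c \<in> Pi\<^sub>E I A" "\<phi> (E c) \<noteq> 0" using c by (auto simp: h_def indicator_def split: if_splits)
    then have T': "\<bar>c j\<bar> \<le> T" if "j \<in> I" for j using T[of c j] that by (simp add: I_def E_def)
    then show "c \<in> D" using *(1) by (fastforce simp: D_def PiE_iff)
    have "norm (E c) \<le> norm x + (\<Sum>j\<in>I. norm (c j *\<^sub>R v j))"
      unfolding E_def by (intro norm_triangle_le add_left_mono norm_sum)
    also have "(\<Sum>j\<in>I. norm (c j *\<^sub>R v j)) \<le> (\<Sum>j\<in>I. \<bar>T\<bar> * norm (v j))"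
      using T' by (intro sum_mono) (auto intro!: mult_right_mono order_trans[OF _ abs_ge_self])
    finally have "\<bar>\<phi> (E c)\<bar> \<le> C" by (intro C) (simp add: N_def)
    then show "\<bar>h c\<bar> \<le> \<bar>C\<bar>" by (auto simp: h_def indicator_def)
  qed
  have [measurable]: "\<phi> \<in> borel_measurable borel"
    by (rule borel_measurable_continuous_onI[OF \<phi>])
  have [measurable]: "E \<in> borel_measurable M"
    unfolding E_def[abs_def] M_def by measurable
  have [measurable]: "Pi\<^sub>E I A \<in> sets M" unfolding M_def using A I by (intro sets_PiM_I_finite) auto
  have "integrable M h"
  proof (rule integrableI_bounded_set[where A = D and B = "\<bar>C\<bar>"])
    show "D \<in> sets M" unfolding D_def M_def using I by (intro sets_PiM_I_finite) auto
    show "h \<in> borel_measurable M" unfolding h_def[abs_def] by measurable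
    show "emeasure M D < \<infinity>"
      unfolding M_def D_def using I
      by (subst emeasure_PiM) (auto simp: emeasure_lborel_Icc_eq less_top[symmetric] power_eq_top_ennreal)
    show "AE c in M. c \<in> D \<longrightarrow> norm (h c) \<le> \<bar>C\<bar>"
    proof (intro AE_I2 impI)
      fix c show "norm (h c) \<le> \<bar>C\<bar>" using hC[of c] by (cases "h c = 0") auto
    qed
    show "AE c in M. c \<notin> D \<longrightarrow> h c = 0" using D by (intro AE_I2) blast
  qed
  then have int: "integrable (Pi\<^sub>M (insert m J) (\<lambda>_. lborel)) h"
    by (simp add: M_def I_def)
  have "(\<integral>c. indicator (Pi\<^sub>E (insert m J) A) c *\<^sub>R \<phi> (x + (\<Sum>j\<in>insert m J. c j *\<^sub>R v j)) \<partial>Pi\<^sub>M (insert m J) (\<lambda>_. lborel))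
     = integral\<^sup>L (Pi\<^sub>M (insert m J) (\<lambda>_. lborel)) h"
    by (simp add: h_def[abs_def] E_def I_def)
  also have "\<dots> = (\<integral>c. (\<integral>t. h (c(m := t)) \<partial>lborel) \<partial>Pi\<^sub>M J (\<lambda>_. lborel))"
    by (rule product_integral_insert[OF J int])
  also have "\<dots> = (\<integral>c. indicator (Pi\<^sub>E J A) c *\<^sub>R line_int (A m) (v m) \<phi> (x + (\<Sum>j\<in>J. c j *\<^sub>R v j)) \<partial>Pi\<^sub>M J (\<lambda>_. lborel))"
  proof (rule Bochner_Integration.integral_cong[OF refl])
    fix c assume "c \<in> space (Pi\<^sub>M J (\<lambda>_. lborel :: real measure))"
    then have c: "c \<in> extensional J" by (simp add: space_PiM PiE_iff)
    have "(\<Sum>j\<in>J. (c(m := t)) j *\<^sub>R v j) = (\<Sum>j\<in>J. c j *\<^sub>R v j)" for t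
      using J by (intro sum.cong) auto
    then have 1: "E (c(m := t)) = (x + (\<Sum>j\<in>J. c j *\<^sub>R v j)) + t *\<^sub>R v m" for t
      unfolding E_def I_def using J by (simp add: algebra_simps)
    have 2: "(c(m := t) \<in> Pi\<^sub>E I A) = (c \<in> Pi\<^sub>E J A \<and> t \<in> A m)" for t
    proof -
      have "c(m := t) \<in> extensional (insert m J)" using c by (auto simp: extensional_def)
      moreover have "(\<forall>j\<in>J. (c(m := t)) j \<in> A j) \<longleftrightarrow> (\<forall>j\<in>J. c j \<in> A j)" using J by auto
      ultimately show ?thesis unfolding I_def PiE_iff using c by auto
    qed
    show "(\<integral>t. h (c(m := t)) \<partial>lborel) =
        indicator (Pi\<^sub>E J A) c *\<^sub>R line_int (A m) (v m) \<phi> (x + (\<Sum>j\<in>J. c j *\<^sub>R v j))"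
      by (cases "c \<in> Pi\<^sub>E J A")
         (simp_all add: h_def 1 2 line_int_def set_lebesgue_integral_def indicator_def)
  qed
  finally show ?thesis .
qed

lemma T_distr_snoc:
  fixes \<phi> :: "real ^ 'n::finite \<Rightarrow> real" and l :: "real ^ 'n \<Rightarrow> real"
  assumes l: "linear l" and Y: "\<forall>y\<in>set (Y @ [y]). y \<in> K \<and> l y > 0"
    and K: "0 \<in> K" "\<And>u v. u \<in> K \<Longrightarrow> v \<in> K \<Longrightarrow> u + v \<in> K" "\<And>c u. c \<ge> 0 \<Longrightarrow> u \<in> K \<Longrightarrow> c *\<^sub>R u \<in> K"
    and \<phi>: "supported K \<phi>"
  shows "T_distr (Y @ [y]) \<phi> = T_distr Y (ray_int y \<phi>)"
proof -
  define Z where "Z = Y @ [y]"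
  define m where "m = length Y"
  have Z: "Z ! j \<in> K" "l (Z ! j) > 0" if "j < Suc m" for j
    using that Y unfolding Z_def m_def by (metis length_append_singleton nth_mem)+
  obtain N where N: "\<And>x. \<phi> x \<noteq> 0 \<Longrightarrow> x \<in> K \<Longrightarrow> norm x \<le> N"
  proof -
    have "bounded {x. \<phi> x \<noteq> 0 \<and> (\<exists>a\<in>{0}. x - a \<in> K)}" by (rule supported_bounded[OF \<phi>]) simp
    then show ?thesis using that unfolding bounded_iff by auto
  qed
  obtain b where b: "\<And>x. \<bar>l x\<bar> \<le> b * norm x" "b > 0" using linear_bounded_pos[OF l] by auto
  \<comment> \<open>The value of \<open>l\<close> at the point with parameters \<open>c\<close> is
    the sum of the nonnegative terms \<open>c j * l (Z ! j)\<close>, so each \<open>c j\<close> is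
    at most \<open>b * |N| / l (Z ! j)\<close>; the sum over \<open>j\<close> is a common
    bound.\<close>
  define T where "T = (\<Sum>j<Suc m. b * \<bar>N\<bar> / l (Z ! j))"
  have T: "\<bar>c j\<bar> \<le> T" if c: "c \<in> Pi\<^sub>E (insert m {..<m}) (\<lambda>_. {0..})"
      "\<phi> (0 + (\<Sum>j\<in>insert m {..<m}. c j *\<^sub>R Z ! j)) \<noteq> 0" and j: "j \<in> insert m {..<m}" for c j
  proof -
    define E where "E = (\<Sum>j<Suc m. c j *\<^sub>R Z ! j)"
    have "0 + (\<Sum>j\<in>insert m {..<m}. c j *\<^sub>R Z ! j) = E" unfolding E_def lessThan_Suc by (rule add_0)
    then have E: "\<phi> E \<noteq> 0" using c(2) by simp
    have j: "j < Suc m" using j by auto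
    have nn: "c j \<ge> 0" if "j < Suc m" for j using c(1) that by (auto simp: less_Suc_eq)
    have "(\<Sum>j<n. c j *\<^sub>R Z ! j) \<in> K" if "n \<le> Suc m" for n
      using that by (induction n) (auto intro!: K Z nn)
    from this[of "Suc m"] have "E \<in> K" unfolding E_def by blast
    have "c j * l (Z ! j) \<le> (\<Sum>j<Suc m. c j * l (Z ! j))"
      by (rule member_le_sum) (use j nn Z in \<open>auto simp: less_imp_le\<close>)
    also have "\<dots> = l E" unfolding E_def by (simp add: linear_sum[OF l] linear_cmul[OF l] linear_add[OF l])
    also have "\<dots> \<le> b * norm E" using b(1) abs_ge_self order_trans by blast
    also have "\<dots> \<le> b * \<bar>N\<bar>" using N[OF E \<open>E \<in> K\<close>] b(2) by simp
    finally have "c j \<le> b * \<bar>N\<bar> / l (Z ! j)" using Z(2)[OF j] by (simp add: pos_le_divide_eq)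
    also have "\<dots> \<le> T" unfolding T_def
      by (rule member_le_sum[of j _ "\<lambda>j. b * \<bar>N\<bar> / l (Z ! j)"]) (use j b Z in \<open>auto intro!: divide_nonneg_pos\<close>)
    finally show ?thesis using nn[OF j] by simp
  qed
  have eq: "(\<Sum>j<m. c j *\<^sub>R Z ! j) = (\<Sum>j<m. c j *\<^sub>R Y ! j)" for c
    by (rule sum.cong) (auto simp: Z_def m_def nth_append)
  have "T_distr Z \<phi> = (\<integral>c. indicator (Pi\<^sub>E (insert m {..<m}) (\<lambda>_. {0..})) c *\<^sub>R
      \<phi> (0 + (\<Sum>j\<in>insert m {..<m}. c j *\<^sub>R Z ! j)) \<partial>Pi\<^sub>M (insert m {..<m}) (\<lambda>_. lborel))"
    unfolding T_distr_def set_lebesgue_integral_def by (simp add: Z_def m_def lessThan_Suc)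
  also have "\<dots> = (\<integral>c. indicator (Pi\<^sub>E {..<m} (\<lambda>_. {0..})) c *\<^sub>R
      ray_int (Z ! m) \<phi> (0 + (\<Sum>j<m. c j *\<^sub>R Z ! j)) \<partial>Pi\<^sub>M {..<m} (\<lambda>_. lborel))"
    by (rule PiM_integral_insert_line_int[where A = "\<lambda>_. {0..}" and v = "(!) Z" and T = T])
       (use T supported_continuous[OF \<phi>] in auto)
  also have "\<dots> = T_distr Y (ray_int y \<phi>)"
    unfolding T_distr_def set_lebesgue_integral_def eq by (simp add: Z_def m_def)
  finally show ?thesis by (simp add: Z_def)
qed

lemma T_distr_Nil: "T_distr [] \<phi> = \<phi> 0"
proof -
  show ?thesis
    by (simp add: T_distr_def set_lebesgue_integral_def PiM_empty lebesgue_integral_count_space_finite)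
qed

text \<open>The convolutions are bracketed to the right; this isolates the innermost factor.\<close>

lemma foldr_conv_snoc:
  "foldr conv Ts T \<phi> = foldr conv Ts (T_distr []) (\<lambda>x. T (\<lambda>y. \<phi> (x + y)))"
proof (induction Ts arbitrary: \<phi>)
  case Nil
  then show ?case by (simp add: T_distr_Nil)
next
  case (Cons S Ts)
  have "foldr conv Ts T (\<lambda>y. \<phi> (x + y)) = foldr conv Ts (T_distr []) (\<lambda>z. T (\<lambda>y. \<phi> (x + z + y)))" for x
    using Cons[of "\<lambda>y. \<phi> (x + y)"] by (simp add: add.assoc)
  then show ?case by (simp add: conv_def[of S])
qed

context half_level
begin

lemma T_distr_eq_foldr:
  assumes "supported cone \<phi>" "\<forall>y\<in>set Y. y \<in> sub (Suc i) \<and> l y > 0"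
  shows "T_distr Y \<phi> = foldr ray_int Y \<phi> 0"
  using assms
proof (induction Y arbitrary: \<phi> rule: rev_induct)
  case (snoc y Y)
  have "T_distr (Y @ [y]) \<phi> = T_distr Y (ray_int y \<phi>)"
    by (rule T_distr_snoc[OF linear, where K = cone])
       (use snoc.prems in \<open>auto simp: cone_def l_simps subspace_0[OF subspace_sub]
          intro: subspace_add[OF subspace_sub] subspace_scale[OF subspace_sub]\<close>)
  then show ?case using snoc ray_int_supported[of \<phi> y] by simp
qed (simp add: T_distr_Nil)

lemma conv_T_distr_eq_foldr:
  assumes \<phi>: "supported cone \<phi>" and "\<forall>y\<in>set (Y @ Y'). y \<in> sub (Suc i) \<and> l y > 0"
  shows "conv (T_distr Y) (T_distr Y') \<phi> = foldr ray_int (Y @ Y') \<phi> 0"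
proof -
  have "T_distr Y' (\<lambda>y. \<phi> (x + y)) = foldr ray_int Y' \<phi> x" for x
    using T_distr_eq_foldr[OF supported_shift[OF \<phi>], of Y' x] assms(2)
    by (simp add: foldr_line_int_shift)
  then show ?thesis
    using T_distr_eq_foldr[OF foldr_ray_int_supported[OF \<phi>], of Y' Y] assms(2) by (simp add: conv_def)
qed

end

section \<open>The density of the convolution product\<close>

context ordered_basis
begin

lemma half_level_pos: "i < length B \<Longrightarrow> half_level B i 1"
  and half_level_neg: "i < length B \<Longrightarrow> half_level B i (-1)"
  by unfold_locales auto

lemma hyperplane_coord: "hyperplane (coord i)"
  unfolding hyperplane_def by (rule linear_coord)

definition level_list :: "(real ^ 'n) list \<Rightarrow> nat \<Rightarrow> (real ^ 'n) list" where
  "level_list Z i = pos_part Z B (Suc i) @ neg_part Z B (Suc i)"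

text \<open>For the layers of \<open>Z\<close>, this is the density on \<open>sub i\<close>, in the
  coordinates of \<open>B\<close>, of the convolution of the first \<open>i\<close> factors; the
  starting value 1 stands for the Dirac distribution on the zero space.\<close>

primrec density :: "(nat \<Rightarrow> (real ^ 'n) list) \<Rightarrow> nat \<Rightarrow> 'n mpoly" where
  "density Y 0 = 1"
| "density Y (Suc i) = hyperplane.level (coord i) (Y i) (density Y i)"

lemma sub_Suc_iff: "i < length B \<Longrightarrow> x \<in> sub i \<longleftrightarrow> x \<in> sub (Suc i) \<and> coord i x = 0"
  using sub_Suc_coord_0[of x i] sub_mono[of i "Suc i"] by (auto simp: sub_def)

lemma pos_part_iff: "i < length B \<Longrightarrow> y \<in> set (pos_part Z B (Suc i)) \<longleftrightarrow>
    y \<in> set Z \<and> y \<in> sub (Suc i) \<and> coord i y > 0"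
  by (auto simp: pos_part_def flag_eq_sub coord_def[symmetric] sub_Suc_iff[of i])

lemma neg_part_iff: "i < length B \<Longrightarrow> y \<in> set (neg_part Z B (Suc i)) \<longleftrightarrow>
    y \<in> set Z \<and> y \<in> sub (Suc i) \<and> coord i y < 0"
  by (auto simp: neg_part_def flag_eq_sub coord_def[symmetric] sub_Suc_iff[of i])

text \<open>Each half of the layer yields the same polynomial up to the signs \<open>a\<close> and
  \<open>b\<close>. These occur twice and cancel: once from the definition of the distributions,
  once from negating vectors and the functional. The integrals along \<open>B ! i\<close> and
  \<open>- B ! i\<close> then combine to one over the full line.\<close>

lemma R_factor_step:
  assumes i: "i < length B" and \<psi>: "supported (sub (Suc i)) \<psi>" and Y: "level_list Z i \<noteq> []"
  shows "supported (sub i) (\<lambda>x. R_factor Z B (Suc i) (\<lambda>y. \<psi> (x + y)))" (is ?thesis1)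
    and "\<Lambda> i (\<lambda>x. mpoly_eval f x * R_factor Z B (Suc i) (\<lambda>y. \<psi> (x + y))) =
      \<Lambda> (Suc i) (\<lambda>x. mpoly_eval (hyperplane.level (coord i) (level_list Z i) f) x * \<psi> x)" (is ?thesis2)
proof -
  interpret h: hyperplane "coord i" by (rule hyperplane_coord)
  interpret p: half_level B i 1 by (rule half_level_pos[OF i])
  interpret n: half_level B i "-1" by (rule half_level_neg[OF i])
  define P where "P = pos_part Z B (Suc i)"
  define N where "N = neg_part Z B (Suc i)"
  have pl: "p.l = coord i" and nl: "n.l = (\<lambda>x. - coord i x)"
    by (auto simp: p.l_def n.l_def fun_eq_iff)
  have sub_neg: "- y \<in> sub (Suc i) \<longleftrightarrow> y \<in> sub (Suc i)" for y
    by (auto simp: sub_def coord_simps)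
  have P: "\<forall>y\<in>set P. y \<in> sub (Suc i) \<and> coord i y > 0" and N: "\<forall>y\<in>set N. y \<in> sub (Suc i) \<and> coord i y < 0"
    using pos_part_iff[OF i] neg_part_iff[OF i] by (auto simp: P_def N_def)
  have PN: "\<forall>y\<in>set (P @ map uminus N). y \<in> sub (Suc i) \<and> p.l y > 0"
    and NP: "\<forall>y\<in>set (map uminus P @ N). y \<in> sub (Suc i) \<and> n.l y > 0"
    using P N by (auto simp: pl nl sub_neg coord_simps)
  have ne: "P @ map uminus N \<noteq> []" "map uminus P @ N \<noteq> []"
    using Y by (auto simp: level_list_def P_def N_def)
  have \<psi>p: "supported p.cone \<psi>" and \<psi>n: "supported n.cone \<psi>"
    by (rule supported_mono[OF \<psi>], force simp: p.cone_def n.cone_def)+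
  define Fp where "Fp = foldr ray_int (P @ map uminus N) \<psi>"
  define Fn where "Fn = foldr ray_int (map uminus P @ N) \<psi>"
  define a where "a = (-1 :: real) ^ length N"
  \<comment> \<open>The additional minus sign comes from the subtraction of
    \<open>T_minus\<close>.\<close>
  define b where "b = - ((-1 :: real) ^ length P)"
  have R: "R_factor Z B (Suc i) (\<lambda>y. \<psi> (x + y)) = a * Fp x + b * Fn x" for x
    using p.conv_T_distr_eq_foldr[OF supported_shift[OF \<psi>p] PN, of x]
      n.conv_T_distr_eq_foldr[OF supported_shift[OF \<psi>n] NP, of x]
    unfolding foldr_line_int_shift
    by (simp add: R_factor_def T_plus_def T_minus_def a_def b_def Fp_def Fn_def flip: P_def N_def)
  have F: "supported (sub i) Fp" "supported (sub i) Fn"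
    unfolding Fp_def Fn_def
    using supported_mono[OF p.foldr_ray_int_supported[OF \<psi>p PN] p.sub_i_cone]
      supported_mono[OF n.foldr_ray_int_supported[OF \<psi>n NP] n.sub_i_cone] by auto
  show ?thesis1
    unfolding R by (intro supported_add supported_cmult F)
  let ?G = "h.level (level_list Z i) f"
  have set: "\<forall>z\<in>set (P @ N). coord i z \<noteq> 0" using P N by fastforce
  have LP: "h.level (P @ map uminus N) f = a *\<^sub>R ?G"
    using h.level_neg_right[OF set] by (simp add: level_list_def P_def N_def a_def)
  have LN: "hyperplane.level n.l (map uminus P @ N) f = b *\<^sub>R ?G"
  proof -
    have "\<forall>z\<in>set (map uminus P @ N). coord i z \<noteq> 0" using set by (auto simp: coord_simps)
    from h.level_opposite[OF this] show ?thesis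
      using h.level_neg_left[OF set] by (simp add: level_list_def P_def N_def b_def nl)
  qed
  have aa: "a * a = 1" "b * b = 1" by (simp_all add: a_def b_def flip: power_mult_distrib)
  have G: "supported p.cone (\<lambda>x. mpoly_eval ?G x * \<psi> x)"
      "supported n.cone (\<lambda>x. mpoly_eval ?G x * \<psi> x)"
    by (intro p.supported_mpoly \<psi>p \<psi>n)+
  have "\<Lambda> i (\<lambda>x. mpoly_eval f x * Fp x) = a * \<Lambda> i (ray_int (B ! i) (\<lambda>x. mpoly_eval ?G x * \<psi> x))"
  proof -
    have "\<Lambda> i (\<lambda>x. mpoly_eval f x * Fp x) = \<Lambda> i (ray_int (B ! i) (\<lambda>x. a * (mpoly_eval ?G x * \<psi> x)))"
      using p.level_step[OF \<psi>p PN ne(1), of f] unfolding Fp_def pl LP by (simp add: p.e_def mult.assoc)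
    also have "ray_int (B ! i) (\<lambda>x. a * (mpoly_eval ?G x * \<psi> x)) = (\<lambda>x. a * ray_int (B ! i) (\<lambda>x. mpoly_eval ?G x * \<psi> x) x)"
      by (rule ext) (rule line_int_cmult)
    finally show ?thesis by (simp add: \<Lambda>_cmult)
  qed
  moreover have "\<Lambda> i (\<lambda>x. mpoly_eval f x * Fn x) = b * \<Lambda> i (ray_int (- B ! i) (\<lambda>x. mpoly_eval ?G x * \<psi> x))"
  proof -
    have "\<Lambda> i (\<lambda>x. mpoly_eval f x * Fn x) = \<Lambda> i (ray_int (- B ! i) (\<lambda>x. b * (mpoly_eval ?G x * \<psi> x)))"
      using n.level_step[OF \<psi>n NP ne(2), of f] unfolding Fn_def LN by (simp add: n.e_def mult.assoc)
    also have "ray_int (- B ! i) (\<lambda>x. b * (mpoly_eval ?G x * \<psi> x)) = (\<lambda>x. b * ray_int (- B ! i) (\<lambda>x. mpoly_eval ?G x * \<psi> x) x)"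
      by (rule ext) (rule line_int_cmult)
    finally show ?thesis by (simp add: \<Lambda>_cmult)
  qed
  moreover have "\<Lambda> i (\<lambda>x. a * (mpoly_eval f x * Fp x) + b * (mpoly_eval f x * Fn x)) =
      a * \<Lambda> i (\<lambda>x. mpoly_eval f x * Fp x) + b * \<Lambda> i (\<lambda>x. mpoly_eval f x * Fn x)"
  proof -
    have "supported (sub i) (\<lambda>x. a * (mpoly_eval f x * Fp x))"
      "supported (sub i) (\<lambda>x. b * (mpoly_eval f x * Fn x))"
      by (intro supported_cmult p.supported_mpoly F)+
    from \<Lambda>_add[OF _ this] show ?thesis using i by (simp only: \<Lambda>_cmult less_imp_le)
  qed
  ultimately have "\<Lambda> i (\<lambda>x. mpoly_eval f x * R_factor Z B (Suc i) (\<lambda>y. \<psi> (x + y))) =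
      \<Lambda> i (ray_int (B ! i) (\<lambda>x. mpoly_eval ?G x * \<psi> x)) + \<Lambda> i (ray_int (- B ! i) (\<lambda>x. mpoly_eval ?G x * \<psi> x))"
  proof -
    have "(\<lambda>x. mpoly_eval f x * R_factor Z B (Suc i) (\<lambda>y. \<psi> (x + y))) =
        (\<lambda>x. a * (mpoly_eval f x * Fp x) + b * (mpoly_eval f x * Fn x))"
      by (simp add: R distrib_left mult.left_commute)
    moreover assume "\<Lambda> i (\<lambda>x. mpoly_eval f x * Fp x) = a * \<Lambda> i (ray_int (B ! i) (\<lambda>x. mpoly_eval ?G x * \<psi> x))"
      "\<Lambda> i (\<lambda>x. mpoly_eval f x * Fn x) = b * \<Lambda> i (ray_int (- B ! i) (\<lambda>x. mpoly_eval ?G x * \<psi> x))"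
      "\<Lambda> i (\<lambda>x. a * (mpoly_eval f x * Fp x) + b * (mpoly_eval f x * Fn x)) =
        a * \<Lambda> i (\<lambda>x. mpoly_eval f x * Fp x) + b * \<Lambda> i (\<lambda>x. mpoly_eval f x * Fn x)"
    ultimately show ?thesis by (simp only: aa mult_1 flip: mult.assoc)
  qed
  also have "\<dots> = \<Lambda> i (\<lambda>x. ray_int (B ! i) (\<lambda>x. mpoly_eval ?G x * \<psi> x) x + ray_int (- B ! i) (\<lambda>x. mpoly_eval ?G x * \<psi> x) x)"
    using i p.ray_int_supported[OF G(1) p.e_sub] n.ray_int_supported[OF G(2) n.e_sub] p.l_e n.l_e
    by (intro \<Lambda>_add[symmetric] supported_mono[OF _ p.sub_i_cone] supported_mono[OF _ n.sub_i_cone])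
       (auto simp: p.e_def n.e_def)
  also have "\<dots> = \<Lambda> i (full_int (B ! i) (\<lambda>x. mpoly_eval ?G x * \<psi> x))"
  proof -
    have "full_int (B ! i) (\<lambda>x. mpoly_eval ?G x * \<psi> x) x = ray_int (B ! i) (\<lambda>x. mpoly_eval ?G x * \<psi> x) x +
        ray_int (- B ! i) (\<lambda>x. mpoly_eval ?G x * \<psi> x) x" for x
      using p.ray_integrable[OF G(1) p.e_sub, of x] n.ray_integrable[OF G(2) n.e_sub, of x] p.l_e n.l_e
      by (intro full_int_split) (simp_all add: p.e_def n.e_def)
    then have "full_int (B ! i) (\<lambda>x. mpoly_eval ?G x * \<psi> x) = (\<lambda>x. ray_int (B ! i) (\<lambda>x. mpoly_eval ?G x * \<psi> x) x +
        ray_int (- B ! i) (\<lambda>x. mpoly_eval ?G x * \<psi> x) x)" by (rule ext)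
    then show ?thesis by (simp only:)
  qed
  finally show ?thesis2 using i by (simp add: take_Suc_conv_app_nth)
qed

text \<open>The highest factor is innermost in the convolution. The lower factors are first turned
  into an integral over \<open>sub i\<close>; the remaining factor then extends this integral to
  \<open>sub (Suc i)\<close> and the polynomial by one layer.\<close>

lemma R_distr_partial:
  assumes "i \<le> length B" "supported (sub i) \<psi>" "\<And>j. j < i \<Longrightarrow> level_list Z j \<noteq> []"
  shows "foldr conv (map (R_factor Z B) [1..<i + 1]) (T_distr []) \<psi> =
    \<Lambda> i (\<lambda>x. mpoly_eval (density (level_list Z) i) x * \<psi> x)"
  using assms
proof (induction i arbitrary: \<psi>)
  case 0
  then show ?case by (simp add: T_distr_Nil)
next
  case (Suc i)
  let ?\<theta> = "\<lambda>x. R_factor Z B (Suc i) (\<lambda>y. \<psi> (x + y))"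
  have "foldr conv (map (R_factor Z B) [1..<Suc i + 1]) (T_distr []) \<psi> =
      foldr conv (map (R_factor Z B) [1..<i + 1]) (conv (R_factor Z B (Suc i)) (T_distr [])) \<psi>"
    by simp
  also have "conv (R_factor Z B (Suc i)) (T_distr []) = R_factor Z B (Suc i)"
    by (simp add: conv_def T_distr_Nil)
  also have "foldr conv (map (R_factor Z B) [1..<i + 1]) (R_factor Z B (Suc i)) \<psi> =
      foldr conv (map (R_factor Z B) [1..<i + 1]) (T_distr []) ?\<theta>"
    by (rule foldr_conv_snoc)
  also have "\<dots> = \<Lambda> i (\<lambda>x. mpoly_eval (density (level_list Z) i) x * ?\<theta> x)"
    using Suc.prems by (intro Suc.IH R_factor_step(1)) auto
  also have "\<dots> = \<Lambda> (Suc i) (\<lambda>x. mpoly_eval (density (level_list Z) (Suc i)) x * \<psi> x)"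
    using Suc.prems R_factor_step(2)[of i \<psi> Z "density (level_list Z) i"] by simp
  finally show ?case .
qed

lemma R_distr_eq:
  assumes "supported UNIV \<phi>" "\<And>j. j < length B \<Longrightarrow> level_list Z j \<noteq> []"
  shows "R_distr Z B \<phi> = foldr full_int B (\<lambda>x. mpoly_eval (density (level_list Z) (length B)) x * \<phi> x) 0"
  using R_distr_partial[of "length B" \<phi> Z] assms by (simp add: R_distr_def sub_full length_B)

end

subsection \<open>Lebesgue measure as an iterated integral\<close>

text \<open>Fubini, one coordinate direction after another. The induction passes through sublists of
  the basis, with the support condition relative to their span.\<close>

lemma PiM_Basis_integral:
  fixes \<phi> :: "'a::euclidean_space \<Rightarrow> real"
  assumes "distinct bs" "set bs \<subseteq> Basis" "supported (span (set bs)) \<phi>"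
  shows "(\<integral>c. \<phi> (x + (\<Sum>b\<in>set bs. c b *\<^sub>R b)) \<partial>Pi\<^sub>M (set bs) (\<lambda>_. lborel)) = foldr full_int bs \<phi> x"
  using assms
proof (induction bs arbitrary: \<phi> rule: rev_induct)
  case Nil
  show ?case by (simp add: PiM_empty lebesgue_integral_count_space_finite)
next
  case (snoc b bs)
  have b: "b \<notin> set bs" "b \<in> Basis" "set bs \<subseteq> Basis" using snoc.prems by auto
  have \<phi>: "supported (span (insert b (set bs))) \<phi>" using snoc.prems by (simp add: insert_commute)
  have orth: "inner k b = 0" if "k \<in> span (set bs)" for k
  proof -
    have "set bs \<subseteq> {k. inner b k = 0}" using b by (auto simp: inner_Basis)
    then have "span (set bs) \<subseteq> {k. inner b k = 0}" by (rule span_minimal) (rule subspace_hyperplane)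
    then show ?thesis using that by (auto simp: inner_commute)
  qed
  obtain N where N: "\<And>z. \<phi> z \<noteq> 0 \<Longrightarrow> z - x \<in> span (insert b (set bs)) \<Longrightarrow> norm z \<le> N"
  proof -
    have "bounded {z. \<phi> z \<noteq> 0 \<and> (\<exists>a\<in>{x}. z - a \<in> span (insert b (set bs)))}"
      by (rule supported_bounded[OF \<phi>]) simp
    then show ?thesis using that unfolding bounded_iff by auto
  qed
  have T: "\<bar>c j\<bar> \<le> N + norm x" if c: "\<phi> (x + (\<Sum>j\<in>insert b (set bs). c j *\<^sub>R j)) \<noteq> 0"
    and j: "j \<in> insert b (set bs)" for c j
  proof -
    let ?s = "\<Sum>j\<in>insert b (set bs). c j *\<^sub>R j"
    have "?s \<in> span (insert b (set bs))"
      by (intro span_sum span_scale span_base)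
    then have "norm (x + ?s) \<le> N" using N[OF c] by simp
    then have "norm ?s \<le> N + norm x"
      using norm_triangle_ineq4[of "x + ?s" x] by simp
    moreover have "inner ?s j = c j"
    proof -
      have "inner ?s j = (\<Sum>k\<in>insert b (set bs). if k = j then c j else 0)"
        unfolding inner_sum_left
      proof (rule sum.cong[OF refl])
        fix k assume "k \<in> insert b (set bs)"
        then have "k \<in> Basis" "j \<in> Basis" using j b by auto
        then show "inner (c k *\<^sub>R k) j = (if k = j then c j else 0)" by (simp add: inner_Basis)
      qed
      then show ?thesis using j by simp
    qed
    moreover have "\<bar>inner ?s j\<bar> \<le> norm ?s" using j b by (intro Basis_le_norm) auto
    ultimately show ?thesis by simp
  qed
  have "(\<integral>c. \<phi> (x + (\<Sum>b\<in>set (bs @ [b]). c b *\<^sub>R b)) \<partial>Pi\<^sub>M (set (bs @ [b])) (\<lambda>_. lborel)) =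
    (\<integral>c. indicator (Pi\<^sub>E (insert b (set bs)) (\<lambda>_. UNIV)) c *\<^sub>R
      \<phi> (x + (\<Sum>j\<in>insert b (set bs). c j *\<^sub>R j)) \<partial>Pi\<^sub>M (insert b (set bs)) (\<lambda>_. lborel))"
    by (rule Bochner_Integration.integral_cong) (auto simp: space_PiM indicator_def)
  also have "\<dots> = (\<integral>c. indicator (Pi\<^sub>E (set bs) (\<lambda>_. UNIV)) c *\<^sub>R
      full_int b \<phi> (x + (\<Sum>j\<in>set bs. c j *\<^sub>R j)) \<partial>Pi\<^sub>M (set bs) (\<lambda>_. lborel))"
    by (rule PiM_integral_insert_line_int[where A = "\<lambda>_. UNIV" and v = "\<lambda>j. j" and T = "N + norm x"])
       (use b T supported_continuous[OF \<phi>] in auto)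
  also have "\<dots> = (\<integral>c. full_int b \<phi> (x + (\<Sum>j\<in>set bs. c j *\<^sub>R j)) \<partial>Pi\<^sub>M (set bs) (\<lambda>_. lborel))"
    by (rule Bochner_Integration.integral_cong) (auto simp: space_PiM indicator_def)
  also have "\<dots> = foldr full_int bs (full_int b \<phi>) x"
  proof (rule snoc.IH)
    show "supported (span (set bs)) (full_int b \<phi>)"
    proof (rule supported_line_int[OF \<phi>])
      show "k + t *\<^sub>R b \<in> span (insert b (set bs))" if "k \<in> span (set bs)" for k t
      proof (rule span_add)
        show "k \<in> span (insert b (set bs))" using that span_mono[of "set bs" "insert b (set bs)"] by blast
      qed (intro span_scale span_base, simp)
      show "escaping UNIV b (span (set bs))"
        using b by (intro escaping_line[of "\<lambda>k. inner k b"])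
          (auto simp: orth intro!: linearI simp: inner_add_left)
    qed (auto simp: span_zero)
  qed (use snoc.prems in auto)
  finally show ?case by simp
qed

lemma lborel_integral_eq_foldr:
  fixes \<phi> :: "'a::euclidean_space \<Rightarrow> real"
  assumes "distinct bs" "set bs = Basis" "supported UNIV \<phi>"
  shows "(\<integral>x. \<phi> x \<partial>lborel) = foldr full_int bs \<phi> 0"
proof -
  have [measurable]: "\<phi> \<in> borel_measurable borel"
    by (rule borel_measurable_continuous_onI) (rule supported_continuous[OF assms(3)])
  have "(\<integral>x. \<phi> x \<partial>lborel) = (\<integral>c. \<phi> (\<Sum>b\<in>Basis. c b *\<^sub>R b) \<partial>Pi\<^sub>M Basis (\<lambda>_. lborel))"
    unfolding lborel_def[where 'a = 'a] lborel_eq_real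
    by (subst integral_distr) (auto simp: borel_measurable_if)
  also have "\<dots> = foldr full_int bs \<phi> 0"
    using PiM_Basis_integral[of bs \<phi> 0] assms span_Basis by simp
  finally show ?thesis .
qed

lemma foldr_full_int_linear:
  assumes "linear g"
  shows "foldr full_int bs (\<lambda>x. \<phi> (g x)) x = foldr full_int (map g bs) \<phi> (g x)"
  by (induction bs arbitrary: x)
     (simp_all add: line_int_def linear_add[OF assms] linear_cmul[OF assms])

lemma full_int_scale:
  assumes "c \<noteq> 0"
  shows "full_int (c *\<^sub>R b) \<psi> x = full_int b \<psi> x / \<bar>c\<bar>"
  using lborel_integral_real_affine[of c "\<lambda>t. \<psi> (x + t *\<^sub>R b)" 0] assms
  by (simp add: line_int_def set_lebesgue_integral_def ac_simps)

lemma foldr_full_int_scale: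
  assumes "\<And>b. b \<in> set bs \<Longrightarrow> c b \<noteq> 0"
  shows "foldr full_int (map (\<lambda>b. c b *\<^sub>R b) bs) \<phi> x = foldr full_int bs \<phi> x / (\<Prod>b\<leftarrow>bs. \<bar>c b\<bar>)"
  using assms
proof (induction bs arbitrary: x)
  case (Cons b bs)
  then have "foldr full_int (map (\<lambda>b. c b *\<^sub>R b) bs) \<phi> = (\<lambda>x. inverse (\<Prod>b\<leftarrow>bs. \<bar>c b\<bar>) * foldr full_int bs \<phi> x)"
    by (auto simp: divide_inverse)
  then show ?case
    using Cons.prems by (simp add: full_int_scale line_int_cmult divide_inverse)
qed simp

lemma supported_UNIV_iff:
  "supported UNIV \<phi> \<longleftrightarrow> continuous_on UNIV \<phi> \<and> bounded {x. \<phi> x \<noteq> 0}"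
  unfolding supported_def
  by (auto elim: bounded_subset dest!: spec[of _ "{0}"])

lemma supported_UNIV_matrix:
  fixes A :: "real ^ 'n ^ 'n" and \<phi> :: "real ^ 'n::finite \<Rightarrow> real"
  assumes "supported UNIV \<phi>" "det A \<noteq> 0"
  shows "supported UNIV (\<lambda>x. \<phi> (A *v x))"
  unfolding supported_UNIV_iff
proof
  show "continuous_on UNIV (\<lambda>x. \<phi> (A *v x))"
    by (rule continuous_on_compose2[OF supported_continuous[OF assms(1), of UNIV]])
       (auto intro: linear_continuous_on linear_conv_bounded_linear[THEN iffD1])
  obtain A' where A': "A' ** A = mat 1" using assms(2) invertible_det_nz invertible_def by blast
  have "bounded ((*v) A' ` {x. \<phi> x \<noteq> 0})"
    using assms(1) by (intro bounded_linear_image) (auto simp: supported_UNIV_iff)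
  moreover have "{x. \<phi> (A *v x) \<noteq> 0} \<subseteq> (*v) A' ` {x. \<phi> x \<noteq> 0}"
  proof safe
    fix x assume "\<phi> (A *v x) \<noteq> 0"
    moreover have "x = A' *v (A *v x)" by (simp add: matrix_vector_mul_assoc A')
    ultimately show "x \<in> (*v) A' ` {x. \<phi> x \<noteq> 0}" by blast
  qed
  ultimately show "bounded {x. \<phi> (A *v x) \<noteq> 0}" by (rule bounded_subset)
qed

lemma Basis_list_starting_with:
  fixes as :: "'a::euclidean_space list"
  assumes "distinct as" "set as \<subseteq> Basis"
  obtains bs where "distinct (as @ bs)" "set (as @ bs) = Basis"
proof -
  obtain bs where "set bs = Basis - set as" "distinct bs"
    using finite_distinct_list[of "Basis - set as"] by auto
  then show ?thesis using assms by (intro that[of bs]) auto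
qed

text \<open>Each elementary matrix is visible in the iterated integral: a diagonal matrix rescales
  the directions, a transposition permutes them, and a shear adds an inner direction to an outer
  one.\<close>

lemma integral_matrix_change_of_variables:
  fixes A :: "real ^ 'n::finite ^ 'n" and \<phi> :: "real ^ 'n \<Rightarrow> real"
  assumes "supported UNIV \<phi>" "det A \<noteq> 0"
  shows "\<bar>det A\<bar> * (\<integral>x. \<phi> (A *v x) \<partial>lborel) = (\<integral>x. \<phi> x \<partial>lborel)"
proof -
  \<comment> \<open>With \<open>det A \<noteq> 0\<close> as a premise, the case of a zero row in the
    induction is void.\<close>
  define P where "P A \<longleftrightarrow> (\<forall>\<phi>::real ^ 'n \<Rightarrow> real. supported UNIV \<phi> \<longrightarrow> det A \<noteq> 0 \<longrightarrow>
    \<bar>det A\<bar> * (\<integral>x. \<phi> (A *v x) \<partial>lborel) = (\<integral>x. \<phi> x \<partial>lborel))" for A :: "real ^ 'n ^ 'n"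
  have iter: "(\<integral>x. \<phi> (A *v x) \<partial>lborel) = foldr full_int (map ((*v) A) bs) \<phi> 0"
    if "supported UNIV \<phi>" "det A \<noteq> 0" "distinct bs" "set bs = Basis"
    for A :: "real ^ 'n ^ 'n" and \<phi> bs
    using lborel_integral_eq_foldr[OF that(3,4) supported_UNIV_matrix[OF that(1,2)]]
      foldr_full_int_linear[of "(*v) A" bs \<phi> 0] by simp
  have axis: "b \<in> Basis \<longleftrightarrow> (\<exists>j. b = axis j 1)" for b :: "real ^ 'n"
    by (auto simp: Basis_vec_def)
  have "P A"
  proof (rule induct_matrix_elementary_alt)
    fix A B :: "real ^ 'n ^ 'n" assume P: "P A" "P B"
    show "P (A ** B)"
      unfolding P_def
    proof (intro allI impI)
      fix \<phi> :: "real ^ 'n \<Rightarrow> real" assume \<phi>: "supported UNIV \<phi>" "det (A ** B) \<noteq> 0"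
      then have d: "det A \<noteq> 0" "det B \<noteq> 0" by (auto simp: det_mul)
      have "\<bar>det B\<bar> * (\<integral>x. \<phi> (A *v (B *v x)) \<partial>lborel) = (\<integral>x. \<phi> (A *v x) \<partial>lborel)"
        using P(2)[unfolded P_def, rule_format, OF supported_UNIV_matrix[OF \<phi>(1) d(1)] d(2)] .
      moreover have "\<bar>det A\<bar> * (\<integral>x. \<phi> (A *v x) \<partial>lborel) = (\<integral>x. \<phi> x \<partial>lborel)"
        using P(1) d \<phi> by (simp add: P_def)
      ultimately show "\<bar>det (A ** B)\<bar> * (\<integral>x. \<phi> ((A ** B) *v x) \<partial>lborel) = (\<integral>x. \<phi> x \<partial>lborel)"
        by (metis (no_types, lifting) Bochner_Integration.integral_cong abs_mult det_mul matrix_vector_mul_assoc mult.assoc)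
    qed
  next
    fix A :: "real ^ 'n ^ 'n" and i assume "row i A = 0"
    then show "P A" using det_zero_row[of i A] by (simp add: P_def row_def vec_eq_iff)
  next
    fix A :: "real ^ 'n ^ 'n" assume diag: "\<And>i j. i \<noteq> j \<Longrightarrow> A $ i $ j = 0"
    show "P A"
      unfolding P_def
    proof (intro allI impI)
      fix \<phi> :: "real ^ 'n \<Rightarrow> real" assume \<phi>: "supported UNIV \<phi>" "det A \<noteq> 0"
      obtain bs :: "(real ^ 'n) list" where bs: "distinct bs" "set bs = Basis"
        using Basis_list_starting_with[of "[]"] by auto
      define c where "c b = (\<Sum>i\<in>UNIV. A $ i $ i * b $ i)" for b :: "real ^ 'n"
      have c: "c (axis j 1) = A $ j $ j" for j by (simp add: c_def axis_def if_distrib cong: if_cong)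
      have det: "det A = (\<Prod>i\<in>UNIV. A $ i $ i)" by (rule det_diagonal[OF diag])
      have Ab: "A *v b = c b *\<^sub>R b" if "b \<in> Basis" for b
      proof -
        obtain j where j: "b = axis j 1" using \<open>b \<in> Basis\<close> axis by blast
        show ?thesis unfolding j c
          by (auto simp: vec_eq_iff matrix_vector_mult_def axis_def if_distrib diag cong: if_cong)
      qed
      have map: "map ((*v) A) bs = map (\<lambda>b. c b *\<^sub>R b) bs" using Ab bs by auto
      have "(\<integral>x. \<phi> (A *v x) \<partial>lborel) = foldr full_int (map (\<lambda>b. c b *\<^sub>R b) bs) \<phi> 0"
        using iter[OF \<phi> bs] unfolding map .
      also have "\<dots> = foldr full_int bs \<phi> 0 / (\<Prod>b\<leftarrow>bs. \<bar>c b\<bar>)"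
        using \<phi>(2) bs by (intro foldr_full_int_scale) (auto simp: axis c det)
      also have "(\<Prod>b\<leftarrow>bs. \<bar>c b\<bar>) = (\<Prod>b\<in>Basis. \<bar>c b\<bar>)"
        using bs by (metis prod.distinct_set_conv_list)
      also have "\<dots> = (\<Prod>j\<in>UNIV. \<bar>A $ j $ j\<bar>)"
        by (rule prod.reindex_cong[of "\<lambda>j. axis j 1"]) (auto simp: axis c inj_on_def axis_eq_axis)
      also have "\<dots> = \<bar>det A\<bar>" by (simp add: det abs_prod)
      also have "foldr full_int bs \<phi> 0 = (\<integral>x. \<phi> x \<partial>lborel)"
        using lborel_integral_eq_foldr[OF bs \<phi>(1)] by simp
      finally show "\<bar>det A\<bar> * (\<integral>x. \<phi> (A *v x) \<partial>lborel) = (\<integral>x. \<phi> x \<partial>lborel)"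
        using \<phi>(2) by simp
    qed
  next
    fix m n :: 'n assume "m \<noteq> n"
    define T where "T = Transposition.transpose m n"
    define A :: "real ^ 'n ^ 'n" where "A = (\<chi> i j. mat 1 $ i $ T j)"
    have T: "T permutes UNIV" unfolding T_def by (rule permutes_swap_id) auto
    have det: "\<bar>det A\<bar> = 1"
      using det_permute_columns[OF T, of "mat 1 :: real ^ 'n ^ 'n"] by (simp add: A_def sign_def)
    have Ab: "A *v axis j 1 = axis (T j) 1" for j
      unfolding matrix_vector_mult_basis by (auto simp: column_def A_def vec_eq_iff axis_def mat_def)
    have "P A"
      unfolding P_def
    proof (intro allI impI)
      fix \<phi> :: "real ^ 'n \<Rightarrow> real" assume \<phi>: "supported UNIV \<phi>" "det A \<noteq> 0"
      obtain bs :: "(real ^ 'n) list" where bs: "distinct bs" "set bs = Basis"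
        using Basis_list_starting_with[of "[]"] by auto
      have im: "(*v) A ` Basis = Basis"
      proof -
        have rng: "(Basis :: (real ^ 'n) set) = (\<lambda>j. axis j 1) ` UNIV" by (auto simp: axis)
        have "(\<lambda>j. axis (T j) 1 :: real ^ 'n) ` UNIV = (\<lambda>j. axis j 1) ` T ` UNIV"
          by (simp add: image_image)
        also have "T ` UNIV = UNIV" using T by (simp add: permutes_surj)
        finally show ?thesis unfolding rng by (simp add: image_image Ab)
      qed
      then have "inj_on ((*v) A) Basis" by (intro eq_card_imp_inj_on) auto
      then have "distinct (map ((*v) A) bs)" "set (map ((*v) A) bs) = Basis"
        using bs im by (auto simp: distinct_map)
      from lborel_integral_eq_foldr[OF this \<phi>(1)]
      show "\<bar>det A\<bar> * (\<integral>x. \<phi> (A *v x) \<partial>lborel) = (\<integral>x. \<phi> x \<partial>lborel)"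
        using iter[OF \<phi> bs] det by simp
    qed
    then show "P (\<chi> i j. mat 1 $ i $ Transposition.transpose m n j)" by (simp add: A_def T_def)
  next
    fix m n :: 'n assume mn: "m \<noteq> n"
    define A :: "real ^ 'n ^ 'n" where "A = (\<chi> i j. of_bool (i = m \<and> j = n \<or> i = j))"
    have Ab: "A *v axis j 1 = axis j 1 + of_bool (j = n) *\<^sub>R axis m 1" for j
      unfolding matrix_vector_mult_basis using mn by (auto simp: column_def A_def vec_eq_iff axis_def)
    have "P A"
      unfolding P_def
    proof (intro allI impI)
      fix \<phi> :: "real ^ 'n \<Rightarrow> real" assume \<phi>: "supported UNIV \<phi>" "det A \<noteq> 0"
      have det: "det A = 1"
      proof -
        have "A = (\<chi> k. if k = m then row m (mat 1) + 1 *s row n (mat 1) else row k (mat 1 :: real ^ 'n ^ 'n))"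
          using mn by (auto simp: A_def vec_eq_iff row_def mat_def)
        then show ?thesis using det_row_operation[OF mn, of "mat 1 :: real ^ 'n ^ 'n" 1] by simp
      qed
      \<comment> \<open>The two directions involved come first, so that the integral along
        \<open>axis m 1\<close> stands directly inside the one along \<open>axis n 1\<close> and
        absorbs the shear.\<close>
      obtain bs :: "(real ^ 'n) list" where
        bs: "distinct ([axis n 1, axis m 1] @ bs)" "set ([axis n 1, axis m 1] @ bs) = Basis"
        using mn Basis_list_starting_with[of "[axis n 1, axis m 1] :: (real ^ 'n) list"]
        by (auto simp: axis axis_eq_axis)
      have "map ((*v) A) bs = bs"
      proof (rule map_idI)
        fix b assume "b \<in> set bs"
        then have "b \<in> Basis" "b \<noteq> axis n 1" using bs by auto
        then show "A *v b = b" using axis[of b] Ab by auto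
      qed
      then have map: "map ((*v) A) ([axis n 1, axis m 1] @ bs) = [axis n 1 + axis m 1, axis m 1] @ bs"
        using mn by (simp add: Ab)
      have "(\<integral>x. \<phi> (A *v x) \<partial>lborel) = full_int (axis n 1 + axis m 1) (full_int (axis m 1) (foldr full_int bs \<phi>)) 0"
        using iter[OF \<phi> bs] unfolding map by simp
      also have "\<dots> = full_int (axis n 1) (full_int (axis m 1) (foldr full_int bs \<phi>)) 0"
        unfolding line_int_def[of UNIV "axis n 1 + axis m 1"] line_int_def[of UNIV "axis n 1"]
        by (simp add: scaleR_add_right full_int_invariant flip: add.assoc)
      also have "\<dots> = (\<integral>x. \<phi> x \<partial>lborel)"
        using lborel_integral_eq_foldr[OF bs \<phi>(1)] by simp
      finally show "\<bar>det A\<bar> * (\<integral>x. \<phi> (A *v x) \<partial>lborel) = (\<integral>x. \<phi> x \<partial>lborel)"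
        using det by simp
    qed
    then show "P (\<chi> i j. of_bool (i = m \<and> j = n \<or> i = j))" by (simp add: A_def)
  qed
  then show ?thesis using assms by (simp add: P_def)
qed

subsection \<open>Test functions determine polynomial densities\<close>

lemma frechet_derivative_eqI:
  "(f has_derivative f') (at x) \<Longrightarrow> frechet_derivative f (at x) v = f' v"
  using frechet_derivative_at by metis

lemma continuously_diff_SucD: "continuously_diff (Suc k) f \<Longrightarrow> continuously_diff k f"
  by (induction k arbitrary: f) (auto intro: differentiable_imp_continuous_on)

lemma continuously_diff_const: "continuously_diff k (\<lambda>_. c)"
proof (induction k arbitrary: c)
  case (Suc k)
  have "(\<lambda>x. frechet_derivative (\<lambda>_. c) (at x) v) = (\<lambda>_. 0)" for v :: 'a
    by (intro ext frechet_derivative_eqI has_derivative_const)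
  then show ?case using Suc by simp
qed simp

lemma differentiable_on_UNIV_has_derivative:
  "f differentiable_on UNIV \<Longrightarrow> (f has_derivative frechet_derivative f (at x)) (at x)"
  using frechet_derivative_works unfolding differentiable_on_def by auto

lemma continuously_diff_add:
  "continuously_diff k f \<Longrightarrow> continuously_diff k g \<Longrightarrow> continuously_diff k (\<lambda>x. f x + g x)"
proof (induction k arbitrary: f g)
  case (Suc k)
  have "(\<lambda>x. frechet_derivative (\<lambda>x. f x + g x) (at x) v) =
      (\<lambda>x. frechet_derivative f (at x) v + frechet_derivative g (at x) v)" for v
    using Suc.prems
    by (intro ext frechet_derivative_eqI has_derivative_add differentiable_on_UNIV_has_derivative) auto
  then show ?case using Suc by (auto intro: differentiable_on_add)
qed (auto intro: continuous_on_add)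

lemma continuously_diff_mult:
  "continuously_diff k f \<Longrightarrow> continuously_diff k g \<Longrightarrow> continuously_diff k (\<lambda>x. f x * g x)"
proof (induction k arbitrary: f g)
  case (Suc k)
  have "(\<lambda>x. frechet_derivative (\<lambda>x. f x * g x) (at x) v) =
      (\<lambda>x. f x * frechet_derivative g (at x) v + frechet_derivative f (at x) v * g x)" for v
    using Suc.prems
    by (intro ext frechet_derivative_eqI has_derivative_mult differentiable_on_UNIV_has_derivative) auto
  moreover have "continuously_diff k f" "continuously_diff k g"
    using Suc.prems continuously_diff_SucD by blast+
  ultimately show ?case
    using Suc by (auto intro!: differentiable_on_mult continuously_diff_add)
qed (auto intro: continuous_on_mult)

lemma continuously_diff_prod:
  "(\<And>i. i \<in> I \<Longrightarrow> continuously_diff k (f i)) \<Longrightarrow> continuously_diff k (\<lambda>x. \<Prod>i\<in>I. f i x)"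
  by (induction I rule: infinite_finite_induct)
     (auto intro: continuously_diff_mult continuously_diff_const)

text \<open>The factor \<open>p\<close> makes the family closed under differentiation; for
  \<open>p = 1\<close> it is the standard smooth function that is positive exactly on the positive
  half-line.\<close>

definition flat :: "real poly \<Rightarrow> real \<Rightarrow> real" where
  "flat p t = (if t > 0 then poly p (1 / t) * exp (- (1 / t)) else 0)"

lemma poly_exp_tendsto_0: "((\<lambda>x. poly p x * exp (- x)) \<longlongrightarrow> 0) at_top" for p :: "real poly"
proof -
  have "((\<lambda>x. \<Sum>i\<le>degree p. coeff p i * (x ^ i / exp x)) \<longlongrightarrow> (\<Sum>i\<le>degree p. coeff p i * 0)) at_top"
    by (intro tendsto_sum tendsto_mult tendsto_const tendsto_power_div_exp_0)
  then show ?thesis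
    by (simp add: poly_altdef exp_minus divide_inverse sum_distrib_right mult.assoc)
qed

text \<open>With \<open>s = 1 / t\<close>, the derivative of \<open>p(s) exp(-s)\<close> in
  \<open>t\<close> is \<open>s^2 (p(s) - p'(s)) exp(-s)\<close>. The difference quotient at 0 from
  the right has the same form with one more power of \<open>s\<close>, and the exponential decay
  wins.\<close>

lemma flat_has_derivative:
  "(flat p has_real_derivative flat (monom 1 2 * (p - pderiv p)) t) (at t)"
proof -
  consider "t < 0" | "t > 0" | "t = 0" by linarith
  then show ?thesis
  proof cases
    case 1
    have d: "((\<lambda>_. 0 :: real) has_real_derivative 0) (at t)" by simp
    have ev: "eventually (\<lambda>s. 0 = flat p s) (nhds t)"
      using eventually_nhds_in_open[of "{..<0}" t] 1 by (auto elim!: eventually_mono simp: flat_def)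
    have "flat (monom 1 2 * (p - pderiv p)) t = 0" using 1 by (simp add: flat_def)
    then show ?thesis using iffD1[OF DERIV_cong_ev[OF refl ev refl] d] by simp
  next
    case 2
    have d: "((\<lambda>s. poly p (1 / s) * exp (- (1 / s))) has_real_derivative
        flat (monom 1 2 * (p - pderiv p)) t) (at t)"
      using 2 by (auto intro!: derivative_eq_intros poly_DERIV[THEN DERIV_chain2]
          simp: flat_def poly_monom field_simps power2_eq_square)
    have ev: "eventually (\<lambda>s. poly p (1 / s) * exp (- (1 / s)) = flat p s) (nhds t)"
      using eventually_nhds_in_open[of "{0<..}" t] 2 by (auto elim!: eventually_mono simp: flat_def)
    show ?thesis using iffD1[OF DERIV_cong_ev[OF refl ev refl] d] .
  next
    case 3
    have "((\<lambda>h. flat p h / h) \<longlongrightarrow> 0) (at_right 0)"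
    proof -
      have "((\<lambda>h. poly (pCons 0 p) (1 / h) * exp (- (1 / h))) \<longlongrightarrow> 0) (at_right 0)"
        by (rule filterlim_compose[OF poly_exp_tendsto_0])
           (simp add: filterlim_inverse_at_top_right flip: inverse_eq_divide)
      then show ?thesis
        by (rule Lim_transform_eventually)
           (auto simp: eventually_at_filter flat_def divide_simps intro!: always_eventually)
    qed
    moreover have "((\<lambda>h. flat p h / h) \<longlongrightarrow> 0) (at_left 0)"
      by (rule Lim_transform_eventually[OF tendsto_const])
         (auto simp: eventually_at_filter flat_def intro!: always_eventually)
    ultimately have "((\<lambda>h. flat p h / h) \<longlongrightarrow> 0) (at 0)" by (simp add: filterlim_split_at)
    then show ?thesis using 3 by (simp add: DERIV_def flat_def)
  qed
qed

lemma flat_component_has_derivative: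
  fixes i :: "'n::finite"
  shows "((\<lambda>x::real ^ 'n. flat p (s * x $ i + c)) has_derivative
      (\<lambda>v. s * v $ i * flat (monom 1 2 * (p - pderiv p)) (s * x $ i + c))) (at x)"
proof -
  have 1: "((\<lambda>x::real ^ 'n. s * x $ i + c) has_derivative (\<lambda>v. s * v $ i)) (at x)"
    by (auto intro!: derivative_eq_intros bounded_linear.has_derivative[OF bounded_linear_vec_nth])
  show ?thesis
    using has_derivative_compose[OF 1 flat_has_derivative[of p "s * x $ i + c", unfolded has_field_derivative_def]]
    by (simp add: mult.commute)
qed

lemma continuously_diff_flat:
  fixes i :: "'n::finite"
  shows "continuously_diff k (\<lambda>x::real ^ 'n. flat p (s * x $ i + c))"
proof (induction k arbitrary: p)
  case 0
  then show ?case
    using has_derivative_continuous[OF flat_component_has_derivative[of p s i c]]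
    by (simp add: continuous_at_imp_continuous_on)
next
  case (Suc k)
  have "(\<lambda>x. frechet_derivative (\<lambda>x::real ^ 'n. flat p (s * x $ i + c)) (at x) v) =
      (\<lambda>x. s * v $ i * flat (monom 1 2 * (p - pderiv p)) (s * x $ i + c))" for v
    by (intro ext frechet_derivative_eqI flat_component_has_derivative)
  moreover have "(\<lambda>x::real ^ 'n. flat p (s * x $ i + c)) differentiable_on UNIV"
    using flat_component_has_derivative[of p s i c] unfolding differentiable_on_def differentiable_def by blast
  ultimately show ?case
    using Suc by (auto intro!: continuously_diff_mult continuously_diff_const)
qed

lemma box_bump:
  fixes a b :: "real ^ 'n::finite"
  obtains \<phi> where "test_fun \<phi>" "\<And>x. x \<in> box a b \<Longrightarrow> \<phi> x > 0" "\<And>x. x \<notin> box a b \<Longrightarrow> \<phi> x = 0"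
proof
  define \<phi> where "\<phi> x = (\<Prod>i\<in>UNIV. flat 1 (1 * x $ i + - a $ i) * flat 1 ((-1) * x $ i + b $ i))" for x
  have fl: "flat 1 t \<ge> 0" "flat 1 t = 0 \<longleftrightarrow> t \<le> 0" "flat 1 t > 0 \<longleftrightarrow> t > 0" for t
    by (auto simp: flat_def)
  show pos: "\<phi> x > 0" if "x \<in> box a b" for x
    unfolding \<phi>_def using that by (intro prod_pos) (auto simp: mem_box_cart fl)
  show zero: "\<phi> x = 0" if x: "x \<notin> box a b" for x
  proof -
    obtain i where "\<not> (a $ i < x $ i \<and> x $ i < b $ i)" using x unfolding mem_box_cart by blast
    then show ?thesis unfolding \<phi>_def by (intro prod_zero bexI[of _ i]) (auto simp: fl)
  qed
  have "bounded {x. \<phi> x \<noteq> 0}"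
    using zero by (intro bounded_subset[OF bounded_box[of a b]]) auto
  moreover have "continuously_diff k \<phi>" for k
    unfolding \<phi>_def[abs_def]
    by (intro continuously_diff_prod continuously_diff_mult continuously_diff_flat)
  ultimately show "test_fun \<phi>" by (simp add: test_fun_def compact_closure)
qed

lemma test_fun_supported: "test_fun \<phi> \<Longrightarrow> supported UNIV \<phi>"
  using continuously_diff.simps(1)[of \<phi>] by (auto simp: test_fun_def supported_UNIV_iff intro: bounded_subset[OF compact_imp_bounded closure_subset])

lemma supported_UNIV_integrable:
  fixes \<phi> :: "'a::euclidean_space \<Rightarrow> real"
  assumes "supported UNIV \<phi>"
  shows "integrable lborel \<phi>"
proof -
  obtain N where N: "\<And>x. \<phi> x \<noteq> 0 \<Longrightarrow> norm x \<le> N"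
    using assms by (auto simp: supported_UNIV_iff bounded_iff)
  have "integrable lborel (\<lambda>x. indicator (cball 0 N) x *\<^sub>R \<phi> x)"
    by (rule borel_integrable_compact[OF compact_cball supported_continuous[OF assms]])
  also have "(\<lambda>x. indicator (cball 0 N) x *\<^sub>R \<phi> x) = \<phi>"
    using N by (auto simp: indicator_def fun_eq_iff)
  finally show ?thesis .
qed

lemma test_fun_mpoly_supported:
  "test_fun \<phi> \<Longrightarrow> supported UNIV (\<lambda>x. mpoly_eval f x * \<phi> x)"
  by (intro supported_mult test_fun_supported continuous_on_mpoly_eval)

text \<open>If \<open>f\<close> and \<open>g\<close> differ at a point, their difference has
  constant sign on a small box around it, and a bump supported there separates them. This is the
  uniqueness behind the description operator in \<open>R_poly\<close>.\<close>

lemma density_unique: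
  fixes f g :: "'n::finite mpoly"
  assumes eq: "\<And>\<phi>. test_fun \<phi> \<Longrightarrow> (\<integral>x. \<phi> x * mpoly_eval f x \<partial>lborel) = (\<integral>x. \<phi> x * mpoly_eval g x \<partial>lborel)"
  shows "f = g"
proof (rule ccontr)
  assume "f \<noteq> g"
  then obtain x0 where x0: "mpoly_eval (f - g) x0 \<noteq> 0" using mpoly_eq_0I[of "f - g"] by auto
  define s where "s = sgn (mpoly_eval (f - g) x0)"
  define d where "d = mpoly_eval (s *\<^sub>R (f - g))"
  have d0: "d x0 > 0" using x0 by (auto simp: d_def s_def sgn_if simp del: mpoly_eval_diff)
  have d: "continuous_on S d" for S unfolding d_def by (rule continuous_on_mpoly_eval)
  have "open {x. d x > 0}" by (rule open_Collect_less) (auto intro: d)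
  then obtain e where e: "e > 0" "ball x0 e \<subseteq> {x. d x > 0}" using d0 open_contains_ball by blast
  then obtain a b where ab: "x0 \<in> box a b" "box a b \<subseteq> ball x0 e" using rational_boxes by blast
  obtain \<phi> where \<phi>: "test_fun \<phi>" "\<And>x. x \<in> box a b \<Longrightarrow> \<phi> x > 0" "\<And>x. x \<notin> box a b \<Longrightarrow> \<phi> x = 0"
    using box_bump by blast
  have int: "integrable lborel (\<lambda>x. \<phi> x * mpoly_eval h x)" for h
    using supported_UNIV_integrable[OF test_fun_mpoly_supported[OF \<phi>(1), of h]] by (simp add: mult.commute)
  have "(\<integral>x. \<phi> x * d x \<partial>lborel) = (\<integral>x. s * (\<phi> x * mpoly_eval f x - \<phi> x * mpoly_eval g x) \<partial>lborel)"
    by (simp add: d_def algebra_simps)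
  also have "\<dots> = s * ((\<integral>x. \<phi> x * mpoly_eval f x \<partial>lborel) - (\<integral>x. \<phi> x * mpoly_eval g x \<partial>lborel))"
    using int by simp
  also have "\<dots> = 0" using eq[OF \<phi>(1)] by simp
  finally have "((\<lambda>x. \<phi> x * d x) has_integral 0) UNIV"
    using has_integral_integral_lborel[OF int[of "s *\<^sub>R (f - g)"]] by (simp add: d_def del: mpoly_eval_scaleR)
  moreover have "(\<lambda>x. \<phi> x * d x) = (\<lambda>x. if x \<in> cbox a b then \<phi> x * d x else 0)"
  proof
    fix x
    have "\<phi> x = 0" if "x \<notin> cbox a b" using \<phi>(3)[of x] that box_subset_cbox[of a b] by blast
    then show "\<phi> x * d x = (if x \<in> cbox a b then \<phi> x * d x else 0)" by simp
  qed
  ultimately have I: "((\<lambda>x. \<phi> x * d x) has_integral 0) (cbox a b)"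
    using has_integral_restrict_UNIV[of "cbox a b" "\<lambda>x. \<phi> x * d x" 0] by (simp only:)
  have "\<phi> x0 * d x0 = 0"
  proof (rule has_integral_0_cbox_imp_0[OF _ _ I])
    show "continuous_on (cbox a b) (\<lambda>x. \<phi> x * d x)"
      using supported_continuous[OF test_fun_supported[OF \<phi>(1)]] d by (intro continuous_on_mult)
    show "0 \<le> \<phi> x * d x" for x
      using \<phi>(2,3)[of x] ab e by (cases "x \<in> box a b") (auto intro!: mult_nonneg_nonneg less_imp_le)
    show "box a b \<noteq> {}" "x0 \<in> cbox a b" using ab box_subset_cbox by auto
  qed
  then show False using \<phi>(2)[OF ab(1)] d0 by simp
qed

text \<open>The list \<open>B\<close> is the image of the standard basis under \<open>M\<close>, in
  the order given by \<open>idx\<close>, so the iterated integral along \<open>B\<close> is a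
  Lebesgue integral after a linear substitution.\<close>

lemma (in ordered_basis) foldr_full_int_det:
  fixes M :: "real ^ 'n ^ 'n"
  assumes idx: "bij_betw idx (UNIV :: 'n set) {..<CARD('n)}" and M: "M = (\<chi> i j. (B ! idx j) $ i)"
  shows "det M \<noteq> 0"
    and "supported UNIV \<phi> \<Longrightarrow> foldr full_int B \<phi> 0 = (\<integral>x. \<phi> x \<partial>lborel) / \<bar>det M\<bar>"
proof -
  define jx where "jx = the_inv_into UNIV idx"
  have jx: "bij_betw jx {..<CARD('n)} UNIV" unfolding jx_def by (rule bij_betw_the_inv_into[OF idx])
  have idx_jx: "idx (jx i) = i" if "i < CARD('n)" for i
    unfolding jx_def using idx that by (intro f_the_inv_into_f) (auto simp: bij_betw_def)
  have Maxis: "M *v axis j 1 = B ! idx j" for j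
    unfolding matrix_vector_mult_basis by (simp add: column_def M vec_eq_iff)
  define es where "es = map (\<lambda>i. axis (jx i) (1::real)) [0..<CARD('n)]"
  have inj: "inj_on jx {..<CARD('n)}" and im: "jx ` {..<CARD('n)} = UNIV" using jx by (auto simp: bij_betw_def)
  have es: "distinct es"
    unfolding es_def using inj by (auto simp: distinct_map inj_on_def axis_eq_axis)
  have "set es = (\<lambda>j. axis j 1) ` jx ` {..<CARD('n)}" by (auto simp: es_def image_image)
  then have set_es: "set es = Basis" by (auto simp: im Basis_vec_def)
  have map_es: "map ((*v) M) es = B"
    by (rule nth_equalityI) (auto simp: es_def length_B Maxis idx_jx)
  have "set B \<subseteq> range ((*v) M)" using map_es by (metis imageE image_subset_iff list.set_map rangeI)
  then have "span (set B) \<subseteq> range ((*v) M)"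
    by (intro span_minimal linear_subspace_image) auto
  then have "surj ((*v) M)" using span_B by auto
  then have "invertible M"
    by (meson invertible_right_inverse matrix_right_invertible_surjective)
  then show det: "det M \<noteq> 0" by (simp add: invertible_det_nz)
  assume \<phi>: "supported UNIV \<phi>"
  have "foldr full_int B \<phi> 0 = foldr full_int es (\<lambda>x. \<phi> (M *v x)) 0"
    using foldr_full_int_linear[of "(*v) M" es \<phi> 0] by (simp add: map_es)
  also have "\<dots> = (\<integral>x. \<phi> (M *v x) \<partial>lborel)"
    by (rule lborel_integral_eq_foldr[OF es set_es supported_UNIV_matrix[OF \<phi> det], symmetric])
  finally show "foldr full_int B \<phi> 0 = (\<integral>x. \<phi> x \<partial>lborel) / \<bar>det M\<bar>"
    using integral_matrix_change_of_variables[OF \<phi> det] det by (simp add: field_simps)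
qed

lemma bij_betw_card_less:
  "bij_betw (\<lambda>j::'n::{finite,linorder}. card {k. k < j}) UNIV {..<CARD('n)}"
proof -
  have mono: "card {k. k < i} < card {k. k < j}" if "i < j" for i j :: 'n
    using that by (intro psubset_card_mono) auto
  then have "inj (\<lambda>j::'n. card {k. k < j})"
    by (metis (mono_tags, lifting) injI linorder_neqE nat_less_le)
  moreover have "card {k. k < j} < CARD('n)" for j :: 'n
    by (intro psubset_card_mono) auto
  ultimately show ?thesis
    by (intro bij_betw_imageI card_subset_eq) (auto simp: card_image)
qed

text \<open>The density is computed for iterated integration along \<open>B\<close>, that is, for
  Lebesgue measure divided by the absolute determinant; the factor on the left clears this
  denominator.\<close>

lemma R_poly_eq:
  fixes B :: "(real ^ 'n::{finite,linorder}) list"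
  assumes B: "ordered_basis B" and Z: "\<And>j. j < length B \<Longrightarrow> ordered_basis.level_list B Z j \<noteq> []"
  shows "\<bar>det_list B\<bar> *\<^sub>R R_poly Z B = ordered_basis.density B (ordered_basis.level_list B Z) (length B)"
proof -
  interpret ordered_basis B by fact
  let ?f = "density (level_list Z) (length B)"
  note det = foldr_full_int_det[OF bij_betw_card_less refl, folded det_list_def]
  have eq: "R_distr Z B \<phi> = (\<integral>x. \<phi> x * mpoly_eval (inverse \<bar>det_list B\<bar> *\<^sub>R ?f) x \<partial>lborel)"
    if \<phi>: "test_fun \<phi>" for \<phi>
  proof -
    have "R_distr Z B \<phi> = (\<integral>x. mpoly_eval ?f x * \<phi> x \<partial>lborel) / \<bar>det_list B\<bar>"
      using R_distr_eq[OF test_fun_supported[OF \<phi>] Z] det(2)[OF test_fun_mpoly_supported[OF \<phi>]] by simp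
    then show ?thesis by (simp add: divide_inverse mult.left_commute[of "\<phi> _"] mult.commute[of "mpoly_eval _ _" "\<phi> _"])
  qed
  have "R_poly Z B = inverse \<bar>det_list B\<bar> *\<^sub>R ?f"
    unfolding R_poly_def
    by (rule the_equality) (use eq in \<open>auto intro!: density_unique simp del: mpoly_eval_scaleR\<close>)
  then show ?thesis using det(1) by simp
qed

subsection \<open>Sublists indexed by positions\<close>

lemma nths_eq_map:
  assumes "K \<subseteq> {..<length X}"
  shows "nths X K = map ((!) X) (sorted_list_of_set K)"
proof -
  have fin: "finite K" using assms finite_subset by blast
  have "zip X [0..<length X] = map (\<lambda>i. (X ! i, i)) [0..<length X]"
    by (rule nth_equalityI) auto
  then have "nths X K = map ((!) X) (filter (\<lambda>i. i \<in> K) [0..<length X])"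
    by (simp add: nths_def filter_map o_def)
  also have "filter (\<lambda>i. i \<in> K) [0..<length X] = sorted_list_of_set K"
    by (rule sorted_distinct_set_unique) (use assms fin in \<open>auto intro!: sorted_wrt_filter\<close>)
  finally show ?thesis .
qed

lemma set_nths_eq: "K \<subseteq> {..<length X} \<Longrightarrow> set (nths X K) = (!) X ` K"
  using finite_subset[of K "{..<length X}"] by (simp add: nths_eq_map)

lemma mset_sorted_list_of_set_eq: "finite K \<Longrightarrow> mset (sorted_list_of_set K) = mset_set K"
  using mset_set_set[OF distinct_sorted_list_of_set[of K]] by simp

lemma mset_filter_split:
  "mset (filter (\<lambda>u. P u \<and> Q u) xs) + mset (filter (\<lambda>u. P u \<and> \<not> Q u) xs) = filter_mset P (mset xs)"
  by (induction xs) auto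

lemma mset_nths_eq: "K \<subseteq> {..<length X} \<Longrightarrow> mset (nths X K) = image_mset ((!) X) (mset_set K)"
  using finite_subset[of K "{..<length X}"] by (simp add: nths_eq_map mset_sorted_list_of_set_eq)

lemma length_nths_eq: "K \<subseteq> {..<length X} \<Longrightarrow> length (nths X K) = card K"
  using finite_subset[of K "{..<length X}"] by (simp add: nths_eq_map)

text \<open>Indexed by positions, so that repeated vectors of \<open>X\<close> are kept apart and
  disjoint unions of positions become compositions of operators.\<close>

definition pos_poly :: "(real ^ 'n::finite) list \<Rightarrow> nat set \<Rightarrow> 'n mpoly" where
  "pos_poly X C = (\<Prod>k\<in>C. lin_poly (X ! k))"

lemma prod_poly_nths: "C \<subseteq> {..<length X} \<Longrightarrow> prod_poly (nths X C) = pos_poly X C"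
  using finite_subset[of C "{..<length X}"]
  by (simp add: nths_eq_map prod_poly_def pos_poly_def o_def
      flip: prod.distinct_set_conv_list[OF distinct_sorted_list_of_set])

lemma pos_poly_insert:
  "finite C \<Longrightarrow> k \<notin> C \<Longrightarrow> diff_op (pos_poly X (insert k C)) f = dir_deriv (X ! k) (diff_op (pos_poly X C) f)"
  by (simp add: pos_poly_def diff_op_mult dir_deriv_def)

lemma pos_poly_Un:
  "finite C \<Longrightarrow> finite C' \<Longrightarrow> C \<inter> C' = {} \<Longrightarrow>
    diff_op (pos_poly X (C \<union> C')) f = diff_op (pos_poly X C) (diff_op (pos_poly X C') f)"
  by (simp add: pos_poly_def prod.union_disjoint diff_op_mult)

lemma pos_poly_empty [simp]: "diff_op (pos_poly X {}) f = f"
  by (simp add: pos_poly_def)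

section \<open>Layers of positions and derivatives of the density\<close>

context ordered_basis
begin

definition layer :: "(real ^ 'n) list \<Rightarrow> nat set \<Rightarrow> nat \<Rightarrow> nat set" where
  "layer X K i = {k \<in> K. X ! k \<in> sub (Suc i) \<and> X ! k \<notin> sub i}"

definition layer_list :: "(real ^ 'n) list \<Rightarrow> nat set \<Rightarrow> nat \<Rightarrow> (real ^ 'n) list" where
  "layer_list X K i = map ((!) X) (sorted_list_of_set (layer X K i))"

definition dens :: "(real ^ 'n) list \<Rightarrow> nat set \<Rightarrow> 'n mpoly" where
  "dens X K = density (layer_list X K) (length B)"

lemma finite_layer: "finite K \<Longrightarrow> finite (layer X K i)"
  by (simp add: layer_def)

lemma layer_coord: "i < length B \<Longrightarrow> k \<in> layer X K i \<Longrightarrow> coord i (X ! k) \<noteq> 0"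
  by (auto simp: layer_def sub_Suc_iff[of i])

lemma layer_disjoint: "i < j \<Longrightarrow> k \<in> layer X K i \<Longrightarrow> k \<notin> layer X K j"
  using sub_mono[of "Suc i" j] by (auto simp: layer_def)

lemma layer_Diff: "layer X (K - C) i = layer X K i - C"
  by (auto simp: layer_def)

lemma layer_exists:
  assumes "X ! k \<noteq> 0" "k \<in> K"
  obtains i where "i < length B" "k \<in> layer X K i"
proof -
  define i where "i = (LEAST i. X ! k \<in> sub i)"
  have ex: "X ! k \<in> sub (length B)" by (simp add: sub_full)
  then have i: "X ! k \<in> sub i" "i \<le> length B" unfolding i_def by (rule LeastI, rule Least_le)
  have "i \<noteq> 0" using i(1) assms(1) sub_0 by (metis singletonD)
  then obtain i' where i': "i = Suc i'" using not0_implies_Suc by blast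
  have "X ! k \<notin> sub i'" using not_less_Least[of i' "\<lambda>i. X ! k \<in> sub i"] i' by (simp add: i_def)
  then show ?thesis using i i' assms by (intro that[of i']) (auto simp: layer_def)
qed

lemma layer_list_nonzero: "i < length B \<Longrightarrow> finite K \<Longrightarrow> \<forall>y\<in>set (layer_list X K i). coord i y \<noteq> 0"
  using layer_coord by (auto simp: layer_list_def finite_layer)

lemma mset_level_list:
  assumes "K \<subseteq> {..<length X}" "i < length B"
  shows "mset (level_list (nths X K) i) = mset (layer_list X K i)"
proof -
  have fin: "finite K" using assms finite_subset by blast
  have "mset (level_list (nths X K) i) = filter_mset (\<lambda>u. u \<in> sub (Suc i) \<and> u \<notin> sub i) (mset (nths X K))"
    using assms(2)
      mset_filter_split[of "\<lambda>u. u \<in> sub (Suc i) \<and> u \<notin> sub i" "\<lambda>u. representation (set B) u (B ! i) > 0" "nths X K"]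
    by (simp add: level_list_def pos_part_def neg_part_def flag_eq_sub)
  also have "\<dots> = image_mset ((!) X) (mset_set (layer X K i))"
    using assms(1) fin by (simp add: mset_nths_eq filter_mset_image_mset layer_def filter_mset_mset_set)
  also have "\<dots> = mset (layer_list X K i)"
    using fin by (simp add: layer_list_def finite_layer mset_sorted_list_of_set_eq)
  finally show ?thesis .
qed

lemma density_cong:
  "m \<le> length B \<Longrightarrow> (\<And>i. i < m \<Longrightarrow> mset (Y i) = mset (Y' i) \<and> (\<forall>y\<in>set (Y i). coord i y \<noteq> 0)) \<Longrightarrow>
    density Y m = density Y' m"
proof (induction m)
  case (Suc m)
  then show ?case
    using hyperplane.level_perm[OF hyperplane_coord, of "Y m" m "Y' m" "density Y m"] by simp
qed simp

lemma dens_eq: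
  assumes "K \<subseteq> {..<length X}"
  shows "density (level_list (nths X K)) (length B) = dens X K"
  unfolding dens_def
proof (rule density_cong[symmetric, OF order_refl])
  show "mset (layer_list X K i) = mset (level_list (nths X K) i) \<and> (\<forall>y\<in>set (layer_list X K i). coord i y \<noteq> 0)"
    if "i < length B" for i
    using mset_level_list[OF assms that] layer_list_nonzero[OF that finite_subset[OF assms finite_lessThan]] by auto
qed

text \<open>Layers below \<open>i\<close> are untouched; in layer \<open>i\<close> the vector is
  deleted; and it is parallel to the hyperplanes of all higher layers, so the derivative passes
  through these.\<close>

lemma dir_deriv_dens:
  assumes K: "finite K" and i: "i < length B" and k: "k \<in> layer X K i"
  shows "dir_deriv (X ! k) (dens X K) = (if layer X K i = {k} then 0 else dens X (K - {k}))"
proof -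
  let ?Y = "layer_list X K" and ?Y' = "layer_list X (K - {k})"
  interpret h: hyperplane "coord i" by (rule hyperplane_coord)
  have other: "?Y' j = ?Y j" if "j \<noteq> i" for j
  proof -
    have "k \<notin> layer X K j" using layer_disjoint k that by (metis linorder_neqE_nat)
    then show ?thesis by (simp add: layer_list_def layer_Diff)
  qed
  have low: "density ?Y' m = density ?Y m" if "m \<le> i" for m
    using that by (induction m) (auto simp: other)
  have at_i: "dir_deriv (X ! k) (density ?Y (Suc i)) =
      (if layer X K i = {k} then 0 else density ?Y' (Suc i))"
  proof -
    have fin: "finite (layer X K i)" using K by (rule finite_layer)
    have "X ! k \<in> set (?Y i)" using k fin by (auto simp: layer_list_def)
    then obtain as bs where Y: "?Y i = as @ X ! k # bs" by (meson split_list)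
    have nz: "\<forall>z\<in>set (as @ X ! k # bs). coord i z \<noteq> 0" using layer_list_nonzero[OF i K, of X] Y by simp
    have len: "length (?Y i) = card (layer X K i)" by (simp add: layer_list_def)
    show ?thesis
    proof (cases "layer X K i = {k}")
      case True
      then have "as = [] \<and> bs = []" using len Y by simp
      then show ?thesis using True Y nz h.dir_deriv_level_single by simp
    next
      case False
      then have "card (layer X K i) \<noteq> 1" using k by (metis card_1_singletonE singletonD)
      then have ne: "as @ bs \<noteq> []" using len Y by auto
      have "mset (?Y i) = image_mset ((!) X) (mset_set (layer X K i))"
        using fin by (simp add: layer_list_def mset_sorted_list_of_set_eq)
      also have "layer X K i = insert k (layer X K i - {k})" using k by blast
      also have "image_mset ((!) X) (mset_set (insert k (layer X K i - {k}))) =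
          add_mset (X ! k) (mset (?Y' i))"
        using fin mset_set.insert[of "layer X K i - {k}" k]
        by (simp add: layer_list_def layer_Diff mset_sorted_list_of_set_eq del: insert_Diff_single)
      finally have "mset (as @ bs) = mset (?Y' i)" using Y by simp
      then have "h.level (as @ bs) f = h.level (?Y' i) f" for f
        using nz by (intro h.level_perm) auto
      then show ?thesis using h.dir_deriv_level[OF nz ne] False by (simp add: Y low)
    qed
  qed
  have "dir_deriv (X ! k) (density ?Y m) = (if layer X K i = {k} then 0 else density ?Y' m)"
    if "Suc i \<le> m" "m \<le> length B" for m
    using that
  proof (induction m rule: dec_induct)
    case base
    show ?case by (rule at_i)
  next
    case (step m)
    have "coord m (X ! k) = 0" using k step by (auto simp: layer_def sub_def)
    then have "dir_deriv (X ! k) (density ?Y (Suc m)) = hyperplane.level (coord m) (?Y m) (dir_deriv (X ! k) (density ?Y m))"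
      using hyperplane.dir_deriv_level_parallel[OF hyperplane_coord] layer_list_nonzero[OF _ K] step by simp
    moreover have "hyperplane.level (coord m) (?Y m) 0 = 0"
      using hyperplane.dir_deriv_level_parallel[OF hyperplane_coord, of "?Y m" m 0 0] layer_list_nonzero[OF _ K] step
      by (simp add: coord_simps dir_deriv_vec_zero)
    ultimately show ?case using step other[of m] by auto
  qed
  then show ?thesis using i by (simp add: dens_def)
qed

text \<open>The vectors are deleted one at a time; none is ever alone in its layer, because
  \<open>K - C\<close> still meets the layer.\<close>

lemma diff_op_dens:
  assumes K: "finite K" and "C \<subseteq> K" and C: "\<And>k. k \<in> C \<Longrightarrow> X ! k \<noteq> 0"
    and ne: "\<And>i. i < length B \<Longrightarrow> layer X (K - C) i \<noteq> {}"
  shows "diff_op (pos_poly X C) (dens X K) = dens X (K - C)"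
proof -
  have "finite C" using K assms(2) finite_subset by blast
  then show ?thesis using assms(2,3,4)
  proof (induction C)
    case (insert k C)
    have ne: "layer X (K - C) i \<noteq> {}" if "i < length B" for i
      using insert.prems(3)[OF that] by (auto simp: layer_Diff)
    have "X ! k \<noteq> 0" "k \<in> K - C" using insert by auto
    then obtain i where i: "i < length B" "k \<in> layer X (K - C) i" by (rule layer_exists)
    have "layer X (K - C) i \<noteq> {k}" using insert.prems(3)[OF i(1)] by (auto simp: layer_Diff)
    then have "dir_deriv (X ! k) (dens X (K - C)) = dens X (K - C - {k})"
      using dir_deriv_dens[OF _ i] K by simp
    moreover have "K - C - {k} = K - insert k C" by blast
    ultimately show ?case using insert ne by (simp add: pos_poly_insert)
  qed simp
qed

text \<open>All vectors of the layer except one are deleted; the derivative along the remaining one,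
  now alone in its layer, is 0, and the other derivatives in \<open>C\<close> are applied to
  0.\<close>

lemma diff_op_dens_eq_0:
  assumes K: "finite K" and C: "finite C" and i: "i < length B" "layer X K i \<subseteq> C"
    and ne: "\<And>i. i < length B \<Longrightarrow> layer X K i \<noteq> {}"
  shows "diff_op (pos_poly X C) (dens X K) = 0"
proof -
  obtain k where k: "k \<in> layer X K i" using ne i by blast
  define L where "L = layer X K i - {k}"
  have L: "finite L" "L \<subseteq> K" using K finite_layer[OF K] by (auto simp: L_def layer_def)
  have nz: "X ! k' \<noteq> 0" if "k' \<in> L" for k'
    using that subspace_0[OF subspace_sub] by (auto simp: L_def layer_def)
  have "diff_op (pos_poly X L) (dens X K) = dens X (K - L)"
  proof (rule diff_op_dens[OF K L(2) nz])
    fix j assume j: "j < length B"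
    show "layer X (K - L) j \<noteq> {}"
    proof (cases "j = i")
      case False
      then have "layer X K j \<inter> L = {}" using layer_disjoint by (metis (no_types, lifting) Diff_iff L_def disjoint_iff linorder_neqE_nat)
      then show ?thesis using ne[OF j] by (auto simp: layer_Diff)
    qed (use k in \<open>auto simp: layer_Diff L_def\<close>)
  qed
  moreover have "layer X (K - L) i = {k}" using k by (auto simp: layer_Diff L_def)
  moreover have "k \<notin> L" by (simp add: L_def)
  moreover have "k \<in> layer X (K - L) i" using k by (simp add: layer_Diff L_def)
  ultimately have "diff_op (pos_poly X (insert k L)) (dens X K) = 0"
    using dir_deriv_dens[of "K - L" i k X] K L(1) i(1) pos_poly_insert[of L k X "dens X K"] by simp
  moreover have "insert k L = layer X K i" using k by (auto simp: L_def)
  moreover have "C = (C - layer X K i) \<union> layer X K i" using i by blast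
  ultimately show ?thesis
    using pos_poly_Un[of "C - layer X K i" "layer X K i" X "dens X K"] C finite_layer[OF K]
    by (metis Diff_disjoint diff_op_zero finite_Diff inf_commute)
qed

text \<open>A layer with one vector only rescales the value at 0; an empty layer gives 0, and a
  longer one ends with a primitive, which vanishes at 0.\<close>

lemma eval_density_0:
  assumes "m \<le> length B" "\<And>i. i < m \<Longrightarrow> \<forall>y\<in>set (Y i). coord i y \<noteq> 0"
  shows "i < m \<Longrightarrow> length (Y i) \<noteq> 1 \<Longrightarrow> mpoly_eval (density Y m) 0 = 0"
  using assms
proof (induction m)
  case (Suc m)
  interpret h: hyperplane "coord m" by (rule hyperplane_coord)
  show ?case
  proof (cases "length (Y m) = 1")
    case True
    then obtain y where y: "Y m = [y]" by (auto simp: length_Suc_conv)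
    then have "i < m" using Suc.prems True less_Suc_eq by auto
    then show ?thesis using Suc y by (simp add: h.level_single h.eval_extend h.proj_id h.l_simps)
  next
    case False
    then consider "Y m = []" | "length (Y m) \<ge> 2" by (cases "Y m") (auto simp: Suc_le_eq)
    then show ?thesis
      by cases (use Suc.prems in \<open>auto intro!: h.eval_level_hyperplane simp: h.l_simps\<close>)
  qed
qed simp

lemma eval_density_basis:
  assumes "m \<le> length B" "\<And>i. i < m \<Longrightarrow> Y i = [B ! i]"
  shows "mpoly_eval (density Y m) 0 = 1"
  using assms
proof (induction m)
  case (Suc m)
  interpret h: hyperplane "coord m" by (rule hyperplane_coord)
  show ?case using Suc by (simp add: h.level_single h.eval_extend h.proj_id h.l_simps coord_B)
qed simp

end

subsection \<open>External activity\<close>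

locale list_basis =
  fixes X :: "(real ^ 'n::finite) list" and J :: "nat set"
  assumes J_bases: "J \<in> bases_of X"
begin

abbreviation "B \<equiv> nths X J"

lemma J_subset: "J \<subseteq> {..<length X}"
  using J_bases by (simp add: bases_of_def)

lemma finite_J: "finite J"
  using J_subset finite_subset by blast

sublocale ordered_basis B
  using J_bases by unfold_locales (auto simp: bases_of_def)

lemma card_J: "card J = length B"
  by (simp add: length_nths_eq J_subset)

lemma set_B: "set B = (!) X ` J"
  by (simp add: set_nths_eq J_subset)

lemma inj_J: "inj_on ((!) X) J"
  using distinct_B finite_J by (simp add: nths_eq_map J_subset distinct_map)

lemma span_J: "span ((!) X ` J) = UNIV"
  using span_B by (simp add: set_B)

lemma not_in_span:
  assumes "b \<in> J" "S \<subseteq> J - {b}"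
  shows "X ! b \<notin> span ((!) X ` S)"
proof
  assume "X ! b \<in> span ((!) X ` S)"
  moreover have "(!) X ` S \<subseteq> (!) X ` J - {X ! b}" using inj_J assms by (auto simp: inj_on_def)
  ultimately have "X ! b \<in> span ((!) X ` J - {X ! b})" using span_mono by blast
  then have "dependent ((!) X ` J)" unfolding dependent_def using assms(1) by blast
  then show False using independent_B by (simp add: set_B)
qed

definition pos :: "nat \<Rightarrow> nat" where "pos i = sorted_list_of_set J ! i"

lemma pos_mono: "i < j \<Longrightarrow> j < length B \<Longrightarrow> pos i < pos j"
  unfolding pos_def using sorted_wrt_nth_less[OF strict_sorted_list_of_set[of J], of i j] finite_J card_J by simp

lemma pos_less_iff: "i < length B \<Longrightarrow> j < length B \<Longrightarrow> pos i < pos j \<longleftrightarrow> i < j"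
  using pos_mono by (metis linorder_neqE_nat not_less_iff_gr_or_eq)

lemma pos_le_iff: "i < length B \<Longrightarrow> j < length B \<Longrightarrow> pos i \<le> pos j \<longleftrightarrow> i \<le> j"
  using pos_less_iff[of j i] by (simp add: not_less[symmetric])

lemma pos_image: "pos ` {..<length B} = J"
proof -
  have "(!) (sorted_list_of_set J) ` {..<length (sorted_list_of_set J)} = set (sorted_list_of_set J)"
    by (auto simp: set_conv_nth)
  then show ?thesis using finite_J card_J by (simp add: pos_def[abs_def])
qed

lemma pos_in: "i < length B \<Longrightarrow> pos i \<in> J"
  using pos_image by blast

lemma B_nth: "i < length B \<Longrightarrow> B ! i = X ! pos i"
  using finite_J card_J[symmetric] by (simp add: nths_eq_map[OF J_subset] pos_def)

lemma J_cases:
  assumes "c \<in> J"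
  obtains j where "j < length B" "c = pos j"
  using assms pos_image by blast

lemma below_pos: "i < length B \<Longrightarrow> {c \<in> J. c < pos i} = pos ` {..<i}"
  by (auto simp: pos_less_iff pos_in elim!: J_cases)

lemma upto_pos: "i < length B \<Longrightarrow> {c \<in> J. c \<le> pos i} = pos ` {..i}"
  by (auto simp: pos_le_iff pos_in elim!: J_cases)

lemma sub_eq_span: "i \<le> length B \<Longrightarrow> sub i = span ((!) X ` pos ` {..<i})"
proof -
  assume i: "i \<le> length B"
  have "set (take i B) = (!) B ` {..<i}" using i by (auto simp: nth_image[symmetric] lessThan_atLeast0)
  also have "\<dots> = (!) X ` pos ` {..<i}" using i by (auto simp: image_image B_nth)
  finally show ?thesis using flag_eq_sub[OF i] by (simp add: flag_def)
qed

abbreviation "E \<equiv> ext_active X J"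
abbreviation "K \<equiv> {..<length X} - E"

lemma J_subset_K: "J \<subseteq> K"
  using J_subset by (auto simp: ext_active_def)

lemma finite_K: "finite K" by simp

lemma K_nonzero: "k \<in> K \<Longrightarrow> X ! k \<noteq> 0"
  using not_in_span[of k "{}"] span_zero by (force simp: ext_active_def)

text \<open>A vector of \<open>sub (Suc i)\<close> placed after \<open>pos i\<close> is spanned by
  earlier elements of \<open>J\<close>, hence is externally active unless it belongs to
  \<open>J\<close>, which independence excludes. So the basis vector is the last element of its
  layer.\<close>

lemma layer_pos: "i < length B \<Longrightarrow> k \<in> layer X K i \<Longrightarrow> k \<le> pos i"
proof (rule ccontr)
  assume i: "i < length B" and k: "k \<in> layer X K i" "\<not> k \<le> pos i"
  have "{c \<in> J. c \<le> pos i} \<subseteq> {b \<in> J. b < k}" using k(2) by auto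
  then have "pos ` {..<Suc i} \<subseteq> {b \<in> J. b < k}" using upto_pos[OF i] by (simp add: lessThan_Suc_atMost)
  moreover have "X ! k \<in> span ((!) X ` pos ` {..<Suc i})"
    using k(1) i sub_eq_span[of "Suc i"] by (simp add: layer_def)
  ultimately have span: "X ! k \<in> span ((!) X ` {b \<in> J. b < k})"
    using span_mono[OF image_mono] by blast
  have "k \<in> J" using span k(1) by (auto simp: layer_def ext_active_def)
  then show False using not_in_span[of k "{b \<in> J. b < k}"] span by auto
qed

lemma pos_layer: "i < length B \<Longrightarrow> pos i \<in> layer X K i"
  using J_subset_K pos_in[of i] B_in_sub[of i "Suc i"] coord_B[of i i]
  by (auto simp: layer_def B_nth sub_Suc_iff[of i])

lemma ext_active_pos:
  assumes e: "e \<in> E" and i: "i < length B" "X ! e \<notin> sub i"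
  shows "pos i < e"
proof (rule ccontr)
  assume "\<not> pos i < e"
  then have "{b \<in> J. b < e} \<subseteq> {b \<in> J. b < pos i}" by auto
  then have "(!) X ` {b \<in> J. b < e} \<subseteq> (!) X ` pos ` {..<i}" using below_pos[OF i(1)] by auto
  moreover have "X ! e \<in> span ((!) X ` {b \<in> J. b < e})" using e by (simp add: ext_active_def)
  ultimately have "X ! e \<in> span ((!) X ` pos ` {..<i})" using span_mono by blast
  then have "X ! e \<in> sub i" using sub_eq_span[of i] i by simp
  then show False using i by simp
qed

text \<open>Triangular elimination: the vector chosen in layer \<open>i\<close> differs from a
  nonzero multiple of \<open>B ! i\<close> by an element of \<open>sub i\<close>.\<close>

lemma sub_subset_span_transversal:
  assumes x: "\<And>i. i < length B \<Longrightarrow> x i \<in> layer X L i" and "i \<le> length B"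
  shows "sub i \<subseteq> span ((!) X ` x ` {..<i})"
  using assms(2)
proof (induction i)
  case 0
  then show ?case by (simp add: sub_0)
next
  case (Suc i)
  let ?S = "span ((!) X ` x ` {..<Suc i})"
  have low: "sub i \<subseteq> ?S"
  proof -
    have "span ((!) X ` x ` {..<i}) \<subseteq> ?S" by (intro span_mono image_mono) auto
    then show ?thesis using Suc by simp
  qed
  define c where "c = coord i (X ! x i)"
  have xi: "X ! x i \<in> sub (Suc i)" "c \<noteq> 0"
    using x[of i] Suc.prems layer_coord[of i "x i" X L] by (auto simp: layer_def c_def)
  have decomp: "v - coord i v *\<^sub>R B ! i \<in> sub i" if "v \<in> sub (Suc i)" for v
    using that Suc.prems B_in_sub[of i "Suc i"]
    by (auto simp: sub_Suc_iff[of i] coord_simps coord_B intro!: subspace_diff subspace_scale subspace_sub)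
  have "X ! x i \<in> ?S" by (intro span_base) auto
  moreover have "X ! x i - c *\<^sub>R B ! i \<in> ?S" using low decomp[OF xi(1)] unfolding c_def by (rule subsetD)
  ultimately have "X ! x i - (X ! x i - c *\<^sub>R B ! i) \<in> ?S" by (rule span_diff)
  then have "inverse c *\<^sub>R (c *\<^sub>R B ! i) \<in> ?S" by (intro span_scale[where c = "inverse c"]) simp
  moreover have "inverse c *\<^sub>R (c *\<^sub>R B ! i) = B ! i" using xi by simp
  ultimately have Bi: "B ! i \<in> ?S" by (simp only:)
  show ?case
  proof
    fix v assume "v \<in> sub (Suc i)"
    then have "(v - coord i v *\<^sub>R B ! i) + coord i v *\<^sub>R B ! i \<in> ?S"
      using low decomp Bi by (intro span_add span_scale) auto
    then show "v \<in> ?S" by simp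
  qed
qed

lemma forward_exchange_pos:
  assumes "forward_exchange X \<BB>" "J \<in> \<BB>" "i < length B" "x < length X"
    and "X ! x \<in> sub (Suc i)" "X ! x \<notin> sub i" "x \<notin> E"
  shows "insert x (J - {pos i}) \<in> \<BB>"
proof -
  have "Suc i \<in> {1..CARD('n)}" using assms(3) length_B by auto
  moreover have "X ! x \<in> flag B (Suc i) - flag B (Suc i - 1)"
    using assms by (simp add: flag_eq_sub)
  ultimately have "insert x (J - {sorted_list_of_set J ! (Suc i - 1)}) \<in> \<BB>"
    using assms(1,2,4,7) unfolding forward_exchange_def by blast
  then show ?thesis by (simp add: pos_def)
qed

text \<open>Stated by spans instead of the index of \<open>b\<close>, so that it applies to a
  modified basis without computing its enumeration.\<close>

lemma forward_exchange_span:
  assumes "forward_exchange X \<BB>" "J \<in> \<BB>" "b \<in> J" "x < length X"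
    and "X ! x \<in> span ((!) X ` {c \<in> J. c \<le> b})" "X ! x \<notin> span ((!) X ` {c \<in> J. c < b})" "x \<notin> E"
  shows "insert x (J - {b}) \<in> \<BB>"
proof -
  obtain i where i: "i < length B" "b = pos i" using assms(3) by (rule J_cases)
  show ?thesis
    unfolding i(2)
  proof (rule forward_exchange_pos[OF assms(1,2) i(1) assms(4)])
    show "X ! x \<in> sub (Suc i)" "X ! x \<notin> sub i"
      using assms(5,6) i upto_pos below_pos sub_eq_span[of i] sub_eq_span[of "Suc i"]
      by (simp_all add: lessThan_Suc_atMost)
  qed (rule assms)
qed

end

section \<open>Consequences of forward exchange\<close>

context
  fixes X :: "(real ^ 'n::finite) list" and \<BB> :: "nat set set"
  assumes \<BB>: "\<BB> \<subseteq> bases_of X" and fe: "forward_exchange X \<BB>"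
begin

lemma list_basis_\<BB>: "J \<in> \<BB> \<Longrightarrow> list_basis X J"
  using \<BB> by unfold_locales auto

text \<open>The basis elements are exchanged in the order \<open>b\<^sub>r, \<dots>, b\<^sub>1\<close>, so that the initial
  segment \<open>b\<^sub>1, \<dots>, b\<^sub>i\<close> is still present when \<open>b\<^sub>i\<close> is replaced.\<close>

lemma transversal_in_\<BB>:
  assumes J: "J \<in> \<BB>" and x: "\<And>i. i < length (nths X J) \<Longrightarrow>
    x i \<in> ordered_basis.layer (nths X J) X ({..<length X} - ext_active X J) i"
  shows "x ` {..<length (nths X J)} \<in> \<BB>"
proof -
  interpret list_basis X J by (rule list_basis_\<BB>[OF J])
  have "pos ` {..<i} \<union> x ` {i..<length B} \<in> \<BB>" if "i \<le> length B" for i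
    using that
  proof (induction i rule: inc_induct)
    case base
    then show ?case using J pos_image by simp
  next
    case (step i)
    define M where "M = pos ` {..<Suc i} \<union> x ` {Suc i..<length B}"
    have M: "M \<in> \<BB>" using step.IH by (simp add: M_def)
    have iB: "i < length B" using step.hyps by simp
    have xi: "x i \<in> layer X K i" using x iB by simp
    have pi: "pos i \<in> M" by (auto simp: M_def)
    have low: "pos ` {..<i} \<subseteq> M - {pos i}"
    proof
      fix c assume "c \<in> pos ` {..<i}"
      then obtain j where "j < i" "c = pos j" by auto
      then show "c \<in> M - {pos i}" using pos_mono[of j i] iB by (auto simp: M_def)
    qed
    \<comment> \<open>The element \<open>pos i\<close> belongs to layer \<open>i\<close>, whereas
      the \<open>x j\<close> with \<open>j > i\<close> belong to higher layers.\<close>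
    have notin: "pos i \<notin> x ` {Suc i..<length B}"
    proof
      assume "pos i \<in> x ` {Suc i..<length B}"
      then obtain j where j: "j \<in> {Suc i..<length B}" "pos i = x j" by blast
      then show False using layer_disjoint[of i j "pos i" X K] pos_layer[OF iB] x[of j] by simp
    qed
    have "insert (x i) (M - {pos i}) \<in> \<BB>"
    proof (cases "x i = pos i")
      case True
      then show ?thesis using M pi by (simp add: insert_absorb)
    next
      case False
      interpret M: list_basis X M by (rule list_basis_\<BB>[OF M])
      have less: "x i < pos i" using layer_pos[OF _ xi] False iB by simp
      \<comment> \<open>The vector \<open>X ! x i\<close> is a nonzero multiple of
        \<open>X ! pos i\<close> plus an element of \<open>sub i\<close>, whose spanning basis
        vectors remain in \<open>M\<close>. If it lay in the span, so would
        \<open>X ! pos i\<close>, and \<open>M\<close> would be dependent.\<close>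
      have not: "X ! x i \<notin> span ((!) X ` (M - {pos i}))"
      proof
        assume *: "X ! x i \<in> span ((!) X ` (M - {pos i}))"
        define c where "c = coord i (X ! x i)"
        have c: "c \<noteq> 0" using layer_coord[OF _ xi] iB by (simp add: c_def)
        have "X ! x i - c *\<^sub>R B ! i \<in> sub i"
          using xi iB B_in_sub[of i "Suc i"]
          by (auto simp: layer_def c_def sub_Suc_iff[of i] coord_simps coord_B intro!: subspace_diff subspace_scale subspace_sub)
        then have "X ! x i - c *\<^sub>R B ! i \<in> span ((!) X ` (M - {pos i}))"
          using sub_eq_span[of i] iB span_mono[OF image_mono[OF low]] by auto
        then have "X ! x i - (X ! x i - c *\<^sub>R B ! i) \<in> span ((!) X ` (M - {pos i}))"
          by (rule span_diff[OF *])
        then have "inverse c *\<^sub>R (c *\<^sub>R B ! i) \<in> span ((!) X ` (M - {pos i}))"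
          by (intro span_scale[where c = "inverse c"]) simp
        moreover have "inverse c *\<^sub>R (c *\<^sub>R B ! i) = X ! pos i" using c iB by (simp add: B_nth)
        ultimately have "X ! pos i \<in> span ((!) X ` (M - {pos i}))" by (simp only:)
        then show False using M.not_in_span[OF pi order_refl] by simp
      qed
      show ?thesis
      proof (rule M.forward_exchange_span[OF fe M pi])
        show "x i < length X" using xi by (simp add: layer_def)
        have "pos ` {..<Suc i} \<subseteq> {c \<in> M. c \<le> pos i}"
          using iB by (auto simp: M_def pos_le_iff less_Suc_eq_le)
        moreover have "X ! x i \<in> span ((!) X ` pos ` {..<Suc i})"
          using xi sub_eq_span[of "Suc i"] iB by (simp add: layer_def)
        ultimately show "X ! x i \<in> span ((!) X ` {c \<in> M. c \<le> pos i})"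
          using span_mono[OF image_mono] by blast
        show "X ! x i \<notin> span ((!) X ` {c \<in> M. c < pos i})"
          using not span_mono[OF image_mono, of "{c \<in> M. c < pos i}" "M - {pos i}" "(!) X"] by blast
        \<comment> \<open>Because \<open>x i < pos i\<close>, the elements of \<open>M\<close>
          before \<open>x i\<close> avoid \<open>pos i\<close> and cannot span
          \<open>X ! x i\<close>.\<close>
        have "{b \<in> M. b < x i} \<subseteq> M - {pos i}" using less by auto
        then show "x i \<notin> ext_active X M"
          using not span_mono[OF image_mono, of "{b \<in> M. b < x i}" "M - {pos i}" "(!) X"]
          by (auto simp: ext_active_def)
      qed
    qed
    moreover have "insert (x i) (M - {pos i}) = pos ` {..<i} \<union> x ` {i..<length B}"
    proof -
      have "M - {pos i} = pos ` {..<i} \<union> x ` {Suc i..<length B}"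
        using low notin by (auto simp: M_def lessThan_Suc)
      moreover have "{i..<length B} = insert i {Suc i..<length B}" using iB by auto
      ultimately show ?thesis by auto
    qed
    ultimately show ?case by simp
  qed
  from this[of 0] show ?thesis by (simp add: lessThan_atLeast0)
qed

lemma cocircuit_contains_layer:
  assumes J: "J \<in> \<BB>" and C: "\<And>J. J \<in> \<BB> \<Longrightarrow> C \<inter> J \<noteq> {}"
  obtains i where "i < length (nths X J)"
    "ordered_basis.layer (nths X J) X ({..<length X} - ext_active X J) i \<subseteq> C"
proof (rule ccontr)
  assume "\<not> thesis"
  then have "\<forall>i. i < length (nths X J) \<longrightarrow> (\<exists>k. k \<in> ordered_basis.layer (nths X J) X ({..<length X} - ext_active X J) i \<and> k \<notin> C)"
    using that by blast
  then obtain x where x: "\<And>i. i < length (nths X J) \<Longrightarrow>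
      x i \<in> ordered_basis.layer (nths X J) X ({..<length X} - ext_active X J) i \<and> x i \<notin> C" by metis
  then have "x ` {..<length (nths X J)} \<in> \<BB>" by (intro transversal_in_\<BB>[OF J]) auto
  then show False using C x by blast
qed

text \<open>Induction over the list: \<open>A\<close> is the set of basis elements chosen among the first \<open>n\<close>
  positions. If the vector at position \<open>n\<close> is not in the span of \<open>A\<close>, forward exchange allows
  to move it into every basis extending \<open>A\<close> (deletion and contraction of position \<open>n\<close>).\<close>

lemma vanishing:
  assumes "n \<le> length X" "A \<subseteq> {..<n}"
    and "\<And>a. a \<in> A \<Longrightarrow> dir_deriv (X ! a) f = 0"
    and "\<And>C. C \<subseteq> {n..<length X} \<Longrightarrow> (\<And>J. J \<in> \<BB> \<Longrightarrow> J \<inter> {..<n} = A \<Longrightarrow> C \<inter> J \<noteq> {}) \<Longrightarrow>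
      diff_op (pos_poly X C) f = 0"
    and "\<And>J. J \<in> \<BB> \<Longrightarrow> J \<inter> {..<n} = A \<Longrightarrow>
      mpoly_eval (diff_op (pos_poly X ({n..<length X} - (J \<union> ext_active X J))) f) 0 = 0"
  shows "f = 0"
  using assms
proof (induction n arbitrary: A f rule: inc_induct)
  case base
  show ?case
  proof (cases "A \<in> \<BB>")
    case True
    interpret list_basis X A by (rule list_basis_\<BB>[OF True])
    \<comment> \<open>The vectors of \<open>A\<close> span the space, so \<open>f\<close> is
      constant, and the condition for the basis \<open>A\<close> itself says that its value at 0 is
      0.\<close>
    have "dir_deriv u f = 0" for u
      using dir_deriv_span_eq_0[of "(!) X ` A" f u] base span_J by auto
    then have "mpoly_eval f (0 + 1 *\<^sub>R u) = mpoly_eval f 0" for u by (rule mpoly_eval_const_on_line)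
    moreover have "mpoly_eval f 0 = 0" using base(4)[OF True] base by auto
    ultimately show ?thesis by (intro mpoly_eq_0I) simp
  next
    case False
    \<comment> \<open>No basis in \<open>\<BB>\<close> equals \<open>A\<close>, so even the empty
      set satisfies the hypothesis on \<open>C\<close>.\<close>
    have "diff_op (pos_poly X {}) f = 0"
    proof (rule base(3))
      fix J assume "J \<in> \<BB>" "J \<inter> {..<length X} = A"
      moreover have "J \<subseteq> {..<length X}" using \<open>J \<in> \<BB>\<close> \<BB> by (auto simp: bases_of_def)
      ultimately show "{} \<inter> J \<noteq> {}" using False by (simp add: inf_absorb1)
    qed simp
    then show ?thesis by simp
  qed
next
  case (step n)
  note A = step.prems(1) and cocirc = step.prems(3) and Q = step.prems(4)
  have ivl: "{n..<length X} = insert n {Suc n..<length X}" using step by auto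
  have below: "{b \<in> J. b < n} = A" if "J \<inter> {..<n} = A" for J using that by auto
  show ?case
  proof (cases "X ! n \<in> span ((!) X ` A)")
    case True
    \<comment> \<open>A vector spanned by \<open>A\<close> is in no basis extending \<open>A\<close>
      and is externally active for all of them, so position \<open>n\<close> changes none of the
      conditions.\<close>
    have nJ: "n \<notin> J \<and> n \<in> ext_active X J" if "J \<in> \<BB>" "J \<inter> {..<n} = A" for J
    proof -
      interpret list_basis X J by (rule list_basis_\<BB>[OF that(1)])
      have "n \<notin> J" using not_in_span[of n A] that True by auto
      then show ?thesis using True step below[OF that(2)] by (simp add: ext_active_def)
    qed
    have Suc: "J \<inter> {..<n} = A" if "J \<inter> {..<Suc n} = A" for J using that A by auto
    show ?thesis
    proof (rule step.IH[of A f])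
      show "diff_op (pos_poly X C) f = 0"
        if "C \<subseteq> {Suc n..<length X}" "\<And>J. J \<in> \<BB> \<Longrightarrow> J \<inter> {..<Suc n} = A \<Longrightarrow> C \<inter> J \<noteq> {}" for C
      proof (rule cocirc)
        fix J assume "J \<in> \<BB>" "J \<inter> {..<n} = A"
        moreover from this have "J \<inter> {..<Suc n} = A" using nJ by (auto simp: lessThan_Suc)
        ultimately show "C \<inter> J \<noteq> {}" using that by blast
      qed (use that in auto)
      show "mpoly_eval (diff_op (pos_poly X ({Suc n..<length X} - (J \<union> ext_active X J))) f) 0 = 0"
        if "J \<in> \<BB>" "J \<inter> {..<Suc n} = A" for J
      proof -
        have "{n..<length X} - (J \<union> ext_active X J) = {Suc n..<length X} - (J \<union> ext_active X J)"
          using nJ[OF that(1) Suc[OF that(2)]] ivl by auto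
        then show ?thesis using Q[OF that(1) Suc[OF that(2)]] by simp
      qed
    qed (use A step.prems in auto)
  next
    case False
    \<comment> \<open>Deletion: only bases avoiding \<open>n\<close> remain. A set meeting all of
      them meets every basis extending \<open>A\<close> once \<open>n\<close> is added, and
      \<open>n\<close> occurs in each corresponding product because it is not externally
      active.\<close>
    have Df: "dir_deriv (X ! n) f = 0"
    proof (rule step.IH[of A])
      show "dir_deriv (X ! a) (dir_deriv (X ! n) f) = 0" if "a \<in> A" for a
        using step.prems(2)[OF that] by (metis dir_deriv_commute dir_deriv_zero)
      show "diff_op (pos_poly X C) (dir_deriv (X ! n) f) = 0"
        if C: "C \<subseteq> {Suc n..<length X}" "\<And>J. J \<in> \<BB> \<Longrightarrow> J \<inter> {..<Suc n} = A \<Longrightarrow> C \<inter> J \<noteq> {}" for C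
      proof -
        have "diff_op (pos_poly X (insert n C)) f = 0"
        proof (rule cocirc)
          fix J assume J: "J \<in> \<BB>" "J \<inter> {..<n} = A"
          then have "n \<in> J \<or> J \<inter> {..<Suc n} = A" by (auto simp: lessThan_Suc)
          then show "insert n C \<inter> J \<noteq> {}" using C(2) J by blast
        qed (use C ivl in auto)
        moreover have "finite C" "n \<notin> C" using C finite_subset[of C "{Suc n..<length X}"] by auto
        ultimately show ?thesis by (simp add: pos_poly_insert dir_deriv_def diff_op_commute)
      qed
      show "mpoly_eval (diff_op (pos_poly X ({Suc n..<length X} - (J \<union> ext_active X J))) (dir_deriv (X ! n) f)) 0 = 0"
        if J: "J \<in> \<BB>" "J \<inter> {..<Suc n} = A" for J
      proof -
        have Jn: "J \<inter> {..<n} = A" "n \<notin> J" using J A by auto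
        have "n \<notin> ext_active X J" using False below[OF Jn(1)] by (simp add: ext_active_def)
        then have "{n..<length X} - (J \<union> ext_active X J) = insert n ({Suc n..<length X} - (J \<union> ext_active X J))"
          using ivl Jn by auto
        then show ?thesis
          using Q[OF J(1) Jn(1)] by (simp add: pos_poly_insert dir_deriv_def diff_op_commute)
      qed
    qed (use A in auto)
    \<comment> \<open>Contraction: only bases containing \<open>n\<close> remain. The point is that
      a set of later positions that meets all of them also meets the bases avoiding
      \<open>n\<close>.\<close>
    show ?thesis
    proof (rule step.IH[of "insert n A"])
      show "dir_deriv (X ! a) f = 0" if "a \<in> insert n A" for a using that Df step.prems(2) by auto
      show "diff_op (pos_poly X C) f = 0"
        if C: "C \<subseteq> {Suc n..<length X}" "\<And>J. J \<in> \<BB> \<Longrightarrow> J \<inter> {..<Suc n} = insert n A \<Longrightarrow> C \<inter> J \<noteq> {}" for C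
      proof (rule cocirc)
        fix J assume J: "J \<in> \<BB>" "J \<inter> {..<n} = A"
        show "C \<inter> J \<noteq> {}"
        proof (cases "n \<in> J")
          case True
          then have "J \<inter> {..<Suc n} = insert n A" using J by (auto simp: lessThan_Suc)
          then show ?thesis using C(2) J by blast
        next
          case nJ: False
          interpret list_basis X J by (rule list_basis_\<BB>[OF J(1)])
          \<comment> \<open>The least \<open>b\<close> with this property is the element of
            \<open>J\<close> whose layer contains \<open>X ! n\<close>, hence the one that forward
            exchange replaces by \<open>n\<close>.\<close>
          define P where "P b \<longleftrightarrow> b \<in> J \<and> X ! n \<in> span ((!) X ` {c \<in> J. c \<le> b})" for b
          define b where "b = (LEAST b. P b)"
          have "J \<noteq> {}"
          proof
            assume "J = {}"
            then have "A = {}" using J by simp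
            have "X ! n \<in> span ((!) X ` J)" by (simp only: span_J UNIV_I)
            then have "X ! n = 0" using \<open>J = {}\<close> by simp
            then have "X ! n \<in> span ((!) X ` A)" by (simp add: span_zero)
            then show False using False by simp
          qed
          then have "P (Max J)"
          proof -
            have "{c \<in> J. c \<le> Max J} = J" using finite_J by auto
            then show ?thesis using \<open>J \<noteq> {}\<close> finite_J by (simp add: P_def span_J)
          qed
          then have Pb: "P b" unfolding b_def by (rule LeastI)
          have least: "\<not> P c" if "c < b" for c using that not_less_Least unfolding b_def by blast
          have not: "X ! n \<notin> span ((!) X ` {c \<in> J. c < b})"
          proof
            assume *: "X ! n \<in> span ((!) X ` {c \<in> J. c < b})"
            show False
            proof (cases "{c \<in> J. c < b} = {}")
              case True
              have "X ! n = 0" using * unfolding True by simp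
              then have "X ! n \<in> span ((!) X ` A)" by (simp add: span_zero)
              then show False using False by simp
            next
              case ne: False
              define c where "c = Max {c \<in> J. c < b}"
              have c: "c \<in> J" "c < b" using Max_in[OF _ ne] finite_J by (auto simp: c_def)
              have "{d \<in> J. d \<le> c} = {d \<in> J. d < b}"
                using c finite_J by (auto simp: c_def intro: order_le_less_trans)
              then have "P c" using * c by (simp add: P_def)
              then show False using least c by blast
            qed
          qed
          \<comment> \<open>Otherwise \<open>A\<close> alone would span \<open>X ! n\<close>. Hence
            exchanging \<open>b\<close> for \<open>n\<close> leaves the part of the basis before
            \<open>n\<close> unchanged.\<close>
          have "b > n"
          proof (rule ccontr)
            assume "\<not> b > n"
            then have "{c \<in> J. c \<le> b} \<subseteq> A" using J nJ by (force simp: le_less)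
            then show False using Pb False span_mono[OF image_mono] unfolding P_def by blast
          qed
          have "insert n (J - {b}) \<in> \<BB>"
          proof (rule forward_exchange_span[OF fe J(1)])
            show "n \<notin> ext_active X J" using False below[OF J(2)] by (simp add: ext_active_def)
          qed (use Pb not step in \<open>auto simp: P_def\<close>)
          moreover have "insert n (J - {b}) \<inter> {..<Suc n} = insert n A"
            using J \<open>b > n\<close> by auto
          ultimately have "C \<inter> insert n (J - {b}) \<noteq> {}" by (rule C(2))
          moreover have "n \<notin> C" using C by auto
          ultimately show ?thesis by blast
        qed
      qed (use C in auto)
      show "mpoly_eval (diff_op (pos_poly X ({Suc n..<length X} - (J \<union> ext_active X J))) f) 0 = 0"
        if J: "J \<in> \<BB>" "J \<inter> {..<Suc n} = insert n A" for J
      proof -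
        have "J \<inter> {..<n} = A" "n \<in> J" using J A by auto
        moreover from this have "{n..<length X} - (J \<union> ext_active X J) = {Suc n..<length X} - (J \<union> ext_active X J)"
          using ivl by auto
        ultimately show ?thesis using Q[OF J(1)] by simp
      qed
    qed (use A step in auto)
  qed
qed

end

lemma (in list_basis) level_list_nonempty: "i < length B \<Longrightarrow> level_list (nths X K) i \<noteq> []"
proof -
  assume i: "i < length B"
  have "mset (level_list (nths X K) i) = mset (layer_list X K i)"
    by (rule mset_level_list[OF _ i]) auto
  moreover have "layer_list X K i \<noteq> []"
    using pos_layer[OF i] finite_layer[OF finite_K] by (auto simp: layer_list_def)
  ultimately show ?thesis by (metis mset_zero_iff)
qed

section \<open>Biorthogonality of the two families\<close>

lemma R_basis_poly_eq:
  fixes X :: "(real ^ 'n::{finite,linorder}) list"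
  assumes "list_basis X J"
  shows "R_basis_poly X J = ordered_basis.dens (nths X J) X ({..<length X} - ext_active X J)"
proof -
  interpret list_basis X J by fact
  have "R_basis_poly X J = density (level_list (nths X K)) (length B)"
    unfolding R_basis_poly_def by (rule R_poly_eq[OF ordered_basis_axioms level_list_nonempty])
  also have "\<dots> = dens X K" by (rule dens_eq) auto
  finally show ?thesis .
qed

lemma Q_poly_eq: "Q_poly X J = pos_poly X ({..<length X} - (J \<union> ext_active X J))"
  by (simp add: Q_poly_def prod_poly_nths)

text \<open>If the complement of \<open>B \<union> E(B)\<close> misses an element of every layer of \<open>D\<close>, then
  \<open>E(D) \<subseteq> E(B)\<close>; if it misses exactly one element of every layer, then moreover \<open>B = D\<close>.\<close>

lemma pairing_duality:
  fixes X :: "(real ^ 'n::{finite,linorder}) list"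
  assumes J: "list_basis X J" and J1: "list_basis X J1"
  shows "pairing (Q_poly X J1) (R_basis_poly X J) = (if J1 = J then 1 else 0)"
proof -
  interpret list_basis X J by fact
  interpret L: list_basis X J1 by fact
  define C where "C = {..<length X} - (J1 \<union> L.E)"
  have finC: "finite C" by (simp add: C_def)
  have lengths: "length L.B = length B" by (simp add: length_B L.length_B)
  have p: "pairing (Q_poly X J1) (R_basis_poly X J) = mpoly_eval (diff_op (pos_poly X C) (dens X K)) 0"
    by (simp add: pairing_def Q_poly_eq R_basis_poly_eq[OF J] C_def)
  show ?thesis
  proof (cases "\<exists>i<length B. layer X K i \<subseteq> C")
    case True
    then obtain i where i: "i < length B" "layer X K i \<subseteq> C" by blast
    have "diff_op (pos_poly X C) (dens X K) = 0"
      using pos_layer by (intro diff_op_dens_eq_0[OF finite_K finC i]) blast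
    moreover have "J1 \<noteq> J"
    proof
      assume "J1 = J"
      then show False using pos_layer[OF i(1)] pos_in[OF i(1)] i(2) by (auto simp: C_def)
    qed
    ultimately show ?thesis using p by simp
  next
    case False
    then have "\<forall>i. i < length B \<longrightarrow> (\<exists>k. k \<in> layer X K i \<and> k \<notin> C)" by blast
    then obtain x where x: "\<And>i. i < length B \<Longrightarrow> x i \<in> layer X K i" "\<And>i. i < length B \<Longrightarrow> x i \<notin> C"
      by metis
    \<comment> \<open>Each \<open>x j\<close> is in \<open>J1\<close> or externally active for
      \<open>J1\<close>. Either way its vector is spanned by elements of \<open>J1\<close> up to
      \<open>x j\<close>, and \<open>x j \<le> pos j \<le> pos i\<close>.\<close>
    have in_span: "sub (Suc i) \<subseteq> span ((!) X ` {b \<in> J1. b \<le> pos i})" if i: "i < length B" for i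
    proof -
      have "X ! x j \<in> span ((!) X ` {b \<in> J1. b \<le> pos i})" if "j \<le> i" for j
      proof -
        have j: "j < length B" using that i by simp
        have "x j \<le> pos j" by (rule layer_pos[OF j x(1)[OF j]])
        then have le: "x j \<le> pos i" using pos_le_iff[OF j i] that by simp
        have "x j \<in> J1 \<or> x j \<in> L.E" using x[OF j] by (auto simp: C_def layer_def)
        then show ?thesis
        proof
          assume "x j \<in> J1"
          then show ?thesis using le by (intro span_base) auto
        next
          assume "x j \<in> L.E"
          then have "X ! x j \<in> span ((!) X ` {b \<in> J1. b < x j})" by (simp add: ext_active_def)
          moreover have "{b \<in> J1. b < x j} \<subseteq> {b \<in> J1. b \<le> pos i}" using le by auto
          ultimately show ?thesis using span_mono[OF image_mono] by blast
        qed
      qed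
      then have "(!) X ` x ` {..<Suc i} \<subseteq> span ((!) X ` {b \<in> J1. b \<le> pos i})" by auto
      then have "span ((!) X ` x ` {..<Suc i}) \<subseteq> span ((!) X ` {b \<in> J1. b \<le> pos i})"
        by (rule span_minimal) (rule subspace_span)
      then show ?thesis
        using sub_subset_span_transversal[of x K "Suc i"] x(1) i by force
    qed
    \<comment> \<open>An externally active \<open>e\<close> of layer \<open>i\<close> comes after
      \<open>pos i\<close>, so the elements of \<open>J1\<close> up to \<open>pos i\<close> already
      span it.\<close>
    have EE: "E \<subseteq> L.E"
    proof
      fix e assume e: "e \<in> E"
      have "X ! e \<in> span ((!) X ` {b \<in> J1. b < e})"
      proof (cases "X ! e = 0")
        case False
        obtain i where i: "i < length B" "e \<in> layer X E i" using layer_exists[OF False e] by blast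
        then have "pos i < e" using ext_active_pos[OF e] by (auto simp: layer_def)
        then have "{b \<in> J1. b \<le> pos i} \<subseteq> {b \<in> J1. b < e}" by auto
        moreover have "X ! e \<in> span ((!) X ` {b \<in> J1. b \<le> pos i})"
          using in_span[OF i(1)] i(2) by (auto simp: layer_def)
        ultimately show ?thesis using span_mono[OF image_mono] by blast
      qed (simp add: span_zero)
      moreover from this have "e \<notin> J1" using L.not_in_span[of e "{b \<in> J1. b < e}"] by auto
      ultimately show "e \<in> L.E" using e by (simp add: ext_active_def)
    qed
    then have CK: "C \<subseteq> K" by (auto simp: C_def)
    have "diff_op (pos_poly X C) (dens X K) = dens X (K - C)"
    proof (rule diff_op_dens[OF finite_K CK])
      show "X ! k \<noteq> 0" if "k \<in> C" for k using K_nonzero that CK by blast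
      show "layer X (K - C) i \<noteq> {}" if "i < length B" for i using x[OF that] by (auto simp: layer_Diff)
    qed
    then have p': "pairing (Q_poly X J1) (R_basis_poly X J) = mpoly_eval (dens X (K - C)) 0" using p by simp
    show ?thesis
    proof (cases "J1 = J")
      case True
      have KC: "K - C = J" using True J_subset_K by (auto simp: C_def)
      have "layer X J i = {pos i}" if i: "i < length B" for i
      proof -
        have "k = pos i" if k: "k \<in> layer X J i" for k
        proof -
          have "k \<in> J" using k by (simp add: layer_def)
          then obtain j where j: "j < length B" "k = pos j" by (rule J_cases)
          have "j = i"
            using layer_disjoint[of i j k X K] layer_disjoint[of j i k X K] pos_layer[OF j(1)] k j J_subset_K
            by (cases i j rule: linorder_cases) (auto simp: layer_def)
          then show ?thesis using j by simp
        qed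
        then show ?thesis using pos_layer[OF i] pos_in[OF i] by (auto simp: layer_def)
      qed
      then have "layer_list X J i = [B ! i]" if "i < length B" for i
        using that by (simp add: layer_list_def B_nth)
      then have "mpoly_eval (dens X J) 0 = 1" unfolding dens_def by (intro eval_density_basis) auto
      then show ?thesis using p' KC True by simp
    next
      case False
      have "\<exists>i<length B. length (layer_list X (K - C) i) \<noteq> 1"
      proof (rule ccontr)
        assume "\<not> ?thesis"
        then have one: "card (layer X (K - C) i) = 1" if "i < length B" for i
          using that by (simp add: layer_list_def)
        \<comment> \<open>Counting: with one element in each layer, \<open>K - C\<close> has at most
          as many elements as \<open>J1\<close>; it also contains \<open>J1\<close>, because
          \<open>E \<subseteq> L.E\<close>.\<close>
        have "K - C \<subseteq> (\<Union>i<length B. layer X (K - C) i)"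
        proof
          fix k assume k: "k \<in> K - C"
          then have "X ! k \<noteq> 0" using K_nonzero by blast
          then obtain i where "i < length B" "k \<in> layer X (K - C) i" using k by (rule layer_exists)
          then show "k \<in> (\<Union>i<length B. layer X (K - C) i)" by blast
        qed
        then have "card (K - C) \<le> card (\<Union>i<length B. layer X (K - C) i)"
          by (intro card_mono) (auto simp: finite_layer)
        also have "\<dots> \<le> (\<Sum>i<length B. card (layer X (K - C) i))" by (rule card_UN_le) simp
        also have "\<dots> = card J1" using one lengths by (simp add: L.card_J)
        finally have card: "card (K - C) \<le> card J1" .
        have "J1 \<subseteq> K - C" using EE L.J_subset by (auto simp: C_def ext_active_def)
        then have KC: "K - C = J1" using card by (intro card_seteq[symmetric]) auto
        have E: "L.E \<subseteq> E"
        proof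
          fix e assume e: "e \<in> L.E"
          then have "e \<notin> J1" "e < length X" "e \<notin> C" by (auto simp: C_def ext_active_def)
          then show "e \<in> E" using KC by blast
        qed
        \<comment> \<open>An element of \<open>J\<close> outside \<open>J1\<close> is spanned by
          earlier elements of \<open>J1\<close>, so it would be externally active for
          \<open>J1\<close> and therefore also for \<open>J\<close>.\<close>
        have "J \<subseteq> J1"
        proof
          fix b assume "b \<in> J"
          then obtain i where i: "i < length B" "b = pos i" by (rule J_cases)
          have b: "X ! b \<in> span ((!) X ` {c \<in> J1. c \<le> b})"
            using in_span[OF i(1)] pos_layer[OF i(1)] i(2) by (auto simp: layer_def)
          show "b \<in> J1"
          proof (rule ccontr)
            assume "b \<notin> J1"
            then have "{c \<in> J1. c \<le> b} = {c \<in> J1. c < b}" by (auto simp: le_less)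
            then have "b \<in> L.E" using b \<open>b \<notin> J1\<close> \<open>b \<in> J\<close> J_subset by (auto simp: ext_active_def)
            then show False using E \<open>b \<in> J\<close> by (auto simp: ext_active_def)
          qed
        qed
        moreover have "card J = card J1" using lengths by (simp add: card_J L.card_J)
        ultimately have "J = J1" using L.finite_J by (simp add: card_subset_eq)
        then show False using False by simp
      qed
      then obtain i where i: "i < length B" "length (layer_list X (K - C) i) \<noteq> 1" by blast
      have "mpoly_eval (dens X (K - C)) 0 = 0"
        unfolding dens_def
        by (rule eval_density_0[where i = i]) (use i layer_list_nonzero[of _ "K - C" X] in auto)
      then show ?thesis using p' False by simp
    qed
  qed
qed

section \<open>Cocircuits and the D-space\<close>

lemma contains_cocircuit:
  assumes "C \<subseteq> {..<length X}" "\<And>J. J \<in> \<BB> \<Longrightarrow> C \<inter> J \<noteq> {}"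
  obtains C' where "C' \<subseteq> C" "cocircuit X \<BB> C'"
proof -
  define P where "P C' \<longleftrightarrow> C' \<subseteq> C \<and> (\<forall>J\<in>\<BB>. C' \<inter> J \<noteq> {})" for C'
  have "finite {C'. P C'}"
    using assms(1) finite_subset[of "{C'. P C'}" "Pow C"] finite_subset[of C] by (auto simp: P_def)
  moreover have "P C" using assms(2) by (simp add: P_def)
  ultimately obtain C' where C': "P C'" "\<And>D. P D \<Longrightarrow> D \<subseteq> C' \<Longrightarrow> D = C'"
    using finite_has_minimal[of "{C'. P C'}"] by auto
  show ?thesis
  proof (rule that[of C'])
    show "C' \<subseteq> C" using C' by (simp add: P_def)
    show "cocircuit X \<BB> C'"
      unfolding cocircuit_def
    proof (intro conjI allI impI notI)
      fix D assume D: "D \<subset> C'" "\<forall>J\<in>\<BB>. D \<inter> J \<noteq> {}"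
      then have "P D" using C'(1) by (auto simp: P_def)
      then show False using C'(2)[of D] D by auto
    qed (use C' assms(1) in \<open>auto simp: P_def\<close>)
  qed
qed

text \<open>Every set meeting all bases contains a cocircuit, whose derivative already annihilates
  \<open>f\<close>; the remaining derivatives are applied to 0. The induction over positions
  produces such sets without control of minimality.\<close>

lemma D_space_iff:
  "f \<in> D_space X \<BB> \<longleftrightarrow>
    (\<forall>C\<subseteq>{..<length X}. (\<forall>J\<in>\<BB>. C \<inter> J \<noteq> {}) \<longrightarrow> diff_op (pos_poly X C) f = 0)"
proof
  assume f: "f \<in> D_space X \<BB>"
  show "\<forall>C\<subseteq>{..<length X}. (\<forall>J\<in>\<BB>. C \<inter> J \<noteq> {}) \<longrightarrow> diff_op (pos_poly X C) f = 0"
  proof (intro allI impI)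
    fix C assume C: "C \<subseteq> {..<length X}" "\<forall>J\<in>\<BB>. C \<inter> J \<noteq> {}"
    obtain C' where C': "C' \<subseteq> C" "cocircuit X \<BB> C'"
      by (rule contains_cocircuit[of C X \<BB>]) (use C in auto)
    then have "C' \<subseteq> {..<length X}" by (simp add: cocircuit_def)
    then have "diff_op (pos_poly X C') f = 0"
      using f C' by (auto simp: D_space_def dir_derivs_eq prod_poly_nths)
    moreover have "finite C" using C finite_subset by blast
    ultimately have "diff_op (pos_poly X ((C - C') \<union> C')) f = 0"
      using C' finite_subset by (subst pos_poly_Un) auto
    then show "diff_op (pos_poly X C) f = 0" using C' by (simp add: Un_absorb2)
  qed
next
  assume "\<forall>C\<subseteq>{..<length X}. (\<forall>J\<in>\<BB>. C \<inter> J \<noteq> {}) \<longrightarrow> diff_op (pos_poly X C) f = 0"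
  then show "f \<in> D_space X \<BB>"
    by (auto simp: D_space_def cocircuit_def dir_derivs_eq prod_poly_nths)
qed

lemma subspace_D_space: "subspace (D_space X \<BB>)"
  by (rule subspaceI) (auto simp: D_space_iff)

lemma R_basis_poly_in_D_space:
  fixes X :: "(real ^ 'n::{finite,linorder}) list"
  assumes \<BB>: "\<BB> \<subseteq> bases_of X" and fe: "forward_exchange X \<BB>" and J: "J \<in> \<BB>"
  shows "R_basis_poly X J \<in> D_space X \<BB>"
  unfolding D_space_iff
proof (intro allI impI)
  fix C assume C: "C \<subseteq> {..<length X}" "\<forall>J\<in>\<BB>. C \<inter> J \<noteq> {}"
  have LB: "list_basis X J" by (rule list_basis_\<BB>[OF \<BB> fe J])
  interpret list_basis X J by fact
  obtain i where i: "i < length B" "layer X K i \<subseteq> C"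
    by (rule cocircuit_contains_layer[OF \<BB> fe J, of C]) (use C in auto)
  have "finite C" using C finite_subset by blast
  then show "diff_op (pos_poly X C) (R_basis_poly X J) = 0"
    unfolding R_basis_poly_eq[OF LB]
    by (rule diff_op_dens_eq_0[OF finite_K _ i]) (use pos_layer in blast)
qed

lemma D_space_eq_0:
  fixes X :: "(real ^ 'n::finite) list"
  assumes \<BB>: "\<BB> \<subseteq> bases_of X" and fe: "forward_exchange X \<BB>" and f: "f \<in> D_space X \<BB>"
    and Q: "\<And>J. J \<in> \<BB> \<Longrightarrow> pairing (Q_poly X J) f = 0"
  shows "f = 0"
proof (rule vanishing[OF \<BB> fe, of 0 "{}"])
  show "diff_op (pos_poly X C) f = 0"
    if "C \<subseteq> {0..<length X}" "\<And>J. J \<in> \<BB> \<Longrightarrow> J \<inter> {..<0} = {} \<Longrightarrow> C \<inter> J \<noteq> {}" for C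
    using that f unfolding D_space_iff by (auto simp: lessThan_atLeast0)
  show "mpoly_eval (diff_op (pos_poly X ({0..<length X} - (J \<union> ext_active X J))) f) 0 = 0"
    if "J \<in> \<BB>" for J
    using Q[OF that] by (simp add: pairing_def Q_poly_eq lessThan_atLeast0)
qed auto

subsection \<open>Duality\<close>

lemma pairing_add: "pairing p (f + g) = pairing p f + pairing p g"
  and pairing_scaleR: "pairing p (c *\<^sub>R f) = c * pairing p f"
  and pairing_add_left: "pairing (p + q) f = pairing p f + pairing q f"
  and pairing_scaleR_left: "pairing (c *\<^sub>R p) f = c * pairing p f"
  by (simp_all add: pairing_def)

lemma linear_pairing: "linear (pairing p)"
  by (rule linearI) (simp_all add: pairing_add pairing_scaleR)

lemma linear_pairing_left: "linear (\<lambda>p. pairing p f)"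
  by (rule linearI) (simp_all add: pairing_add_left pairing_scaleR_left)

text \<open>The functional \<open>L i\<close> reads off the coefficient of \<open>g i\<close> in a
  linear combination.\<close>

lemma biorthogonal_independent:
  fixes g :: "'i \<Rightarrow> 'a::real_vector" and L :: "'i \<Rightarrow> 'a \<Rightarrow> real"
  assumes fin: "finite I" and L: "\<And>i. i \<in> I \<Longrightarrow> linear (L i)"
    and bi: "\<And>i j. i \<in> I \<Longrightarrow> j \<in> I \<Longrightarrow> L i (g j) = (if i = j then 1 else 0)"
  shows "inj_on g I" "independent (g ` I)"
proof -
  show inj: "inj_on g I"
  proof (rule inj_onI)
    fix i j assume "i \<in> I" "j \<in> I" "g i = g j"
    then show "i = j" using bi[of i i] bi[of i j] by (metis zero_neq_one)
  qed
  show "independent (g ` I)"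
  proof (rule independent_if_scalars_zero)
    fix c x assume sum: "(\<Sum>x\<in>g ` I. c x *\<^sub>R x) = 0" and "x \<in> g ` I"
    then obtain i where i: "i \<in> I" "x = g i" by blast
    have "0 = L i (\<Sum>j\<in>I. c (g j) *\<^sub>R g j)"
      using sum linear_0[OF L[OF i(1)]] by (simp add: sum.reindex[OF inj] o_def)
    also have "\<dots> = (\<Sum>j\<in>I. c (g j) * L i (g j))"
      using L[OF i(1)] by (simp add: linear_sum linear_cmul)
    also have "\<dots> = (\<Sum>j\<in>I. if i = j then c (g i) else 0)"
      using i bi by (intro sum.cong) auto
    also have "\<dots> = c x" using i fin by simp
    finally show "c x = 0" by simp
  qed (use fin in simp)
qed

theorem theorem7p5:
  fixes X :: "(real ^ 'n::{finite,linorder}) list" and \<BB> :: "nat set set"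
  assumes "span (set X) = UNIV"
    and "\<BB> \<subseteq> bases_of X" and "\<BB> \<noteq> {}"
    and "forward_exchange X \<BB>"
  shows "dual_via pairing (D_space X \<BB>) (P_space X \<BB>) \<and>
    basis_family (R_basis_poly X) \<BB> (D_space X \<BB>) \<and>
    basis_family (Q_poly X) \<BB> (P_space X \<BB>) \<and>
    (\<forall>B\<in>\<BB>. \<forall>D\<in>\<BB>. pairing (Q_poly X B) (R_basis_poly X D) = (if B = D then 1 else 0))"
proof -
  let ?D = "D_space X \<BB>" and ?P = "P_space X \<BB>" and ?Q = "Q_poly X" and ?R = "R_basis_poly X"
  have "finite {J. J \<subseteq> {..<length X}}" by simp
  then have fin: "finite \<BB>"
    by (rule rev_finite_subset) (use assms(2) in \<open>auto simp: bases_of_def\<close>)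
  have dual: "pairing (?Q B) (?R D) = (if B = D then 1 else 0)" if "B \<in> \<BB>" "D \<in> \<BB>" for B D
    using that assms(2) by (intro pairing_duality) (auto intro: list_basis.intro)
  have R_in: "?R J \<in> ?D" if "J \<in> \<BB>" for J by (rule R_basis_poly_in_D_space[OF assms(2,4) that])
  have Q_in: "?Q J \<in> ?P" if "J \<in> \<BB>" for J using that by (auto simp: P_space_def intro: span_base)
  have sumD: "(\<Sum>J\<in>\<BB>. c J *\<^sub>R ?R J) \<in> ?D" for c
    by (intro subspace_sum subspace_scale subspace_D_space R_in)
  have Q_sum: "pairing (?Q B) (\<Sum>J\<in>\<BB>. c J *\<^sub>R ?R J) = c B" if "B \<in> \<BB>" for c B
  proof -
    have "pairing (?Q B) (\<Sum>J\<in>\<BB>. c J *\<^sub>R ?R J) = (\<Sum>J\<in>\<BB>. c J * pairing (?Q B) (?R J))"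
      by (simp add: linear_sum[OF linear_pairing] pairing_scaleR)
    also have "\<dots> = (\<Sum>J\<in>\<BB>. if B = J then c B else 0)"
      using that dual by (intro sum.cong) auto
    finally show ?thesis using that fin by simp
  qed
  \<comment> \<open>The pairings with the \<open>Q_poly X J\<close> determine an element of the
    D-space; this yields both that the biorthogonal family spans and that the map to the dual space
    is injective.\<close>
  have eq: "f = g" if "f \<in> ?D" "g \<in> ?D" "\<And>J. J \<in> \<BB> \<Longrightarrow> pairing (?Q J) f = pairing (?Q J) g" for f g
  proof -
    have "f - g = 0"
      using that by (intro D_space_eq_0[OF assms(2,4)])
        (auto simp: subspace_diff[OF subspace_D_space] linear_diff[OF linear_pairing])
    then show ?thesis by simp
  qed
  have "basis_family ?R \<BB> ?D"
    unfolding basis_family_def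
  proof (intro conjI)
    show "inj_on ?R \<BB>" "independent (?R ` \<BB>)"
      using biorthogonal_independent[OF fin, of "\<lambda>J. pairing (?Q J)" ?R] dual linear_pairing by auto
    show "span (?R ` \<BB>) = ?D"
    proof
      show "span (?R ` \<BB>) \<subseteq> ?D" using R_in by (intro span_minimal subspace_D_space) auto
      show "?D \<subseteq> span (?R ` \<BB>)"
      proof
        fix f assume f: "f \<in> ?D"
        have "f = (\<Sum>J\<in>\<BB>. pairing (?Q J) f *\<^sub>R ?R J)"
          using Q_sum by (intro eq[OF f sumD]) auto
        also have "\<dots> \<in> span (?R ` \<BB>)" by (intro span_sum span_scale span_base) auto
        finally show "f \<in> span (?R ` \<BB>)" .
      qed
    qed
  qed
  moreover have "basis_family ?Q \<BB> ?P"
  proof -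
    have "pairing (?Q J) (?R I) = (if I = J then 1 else 0)" if "I \<in> \<BB>" "J \<in> \<BB>" for I J
      using dual that by auto
    note ind = biorthogonal_independent[of \<BB> "\<lambda>J p. pairing p (?R J)" ?Q, OF fin linear_pairing_left this]
    show ?thesis unfolding basis_family_def P_space_def using ind by simp
  qed
  moreover have "dual_via pairing ?D ?P"
    unfolding dual_via_def
  proof (intro conjI ballI allI)
    show "subspace ?D" "subspace ?P" by (simp_all add: subspace_D_space P_space_def)
    show "bij_betw (\<lambda>f. restrict (\<lambda>p. pairing p f) ?P) ?D (dual_space ?P)"
      unfolding bij_betw_def
    proof
      show "inj_on (\<lambda>f. restrict (\<lambda>p. pairing p f) ?P) ?D"
      proof (rule inj_onI)
        fix f g assume fg: "f \<in> ?D" "g \<in> ?D" "restrict (\<lambda>p. pairing p f) ?P = restrict (\<lambda>p. pairing p g) ?P"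
        have "pairing (?Q J) f = pairing (?Q J) g" if "J \<in> \<BB>" for J
          using fun_cong[OF fg(3), of "?Q J"] Q_in[OF that] by simp
        then show "f = g" by (rule eq[OF fg(1,2)])
      qed
      have P: "subspace ?P" by (simp add: P_space_def)
      show "(\<lambda>f. restrict (\<lambda>p. pairing p f) ?P) ` ?D = dual_space ?P"
      proof
        show "(\<lambda>f. restrict (\<lambda>p. pairing p f) ?P) ` ?D \<subseteq> dual_space ?P"
          by (auto simp: dual_space_def pairing_add_left pairing_scaleR_left subspace_add[OF P] subspace_scale[OF P])
        show "dual_space ?P \<subseteq> (\<lambda>f. restrict (\<lambda>p. pairing p f) ?P) ` ?D"
        proof
          fix \<phi> assume \<phi>: "\<phi> \<in> dual_space ?P"
          then have ext: "\<phi> \<in> extensional ?P" and add: "\<And>p q. p \<in> ?P \<Longrightarrow> q \<in> ?P \<Longrightarrow> \<phi> (p + q) = \<phi> p + \<phi> q"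
            and scale: "\<And>c p. p \<in> ?P \<Longrightarrow> \<phi> (c *\<^sub>R p) = c * \<phi> p" by (auto simp: dual_space_def)
          \<comment> \<open>The prescribed values on the \<open>Q_poly X J\<close> are the
            coefficients with respect to the biorthogonal family.\<close>
          define f where "f = (\<Sum>J\<in>\<BB>. \<phi> (?Q J) *\<^sub>R ?R J)"
          have "p \<in> ?P \<and> pairing p f = \<phi> p" if "p \<in> span (?Q ` \<BB>)" for p
            using that
          proof (induction rule: span_induct_alt)
            case base
            show ?case using scale[OF subspace_0[OF P], of 0] subspace_0[OF P] pairing_scaleR_left[of 0 0 f] by simp
          next
            case (step c x y)
            then obtain J where J: "J \<in> \<BB>" "x = ?Q J" by blast
            have "c *\<^sub>R x \<in> ?P" using subspace_scale[OF P Q_in[OF J(1)]] J(2) by simp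
            then show ?case
              using step J Q_in[OF J(1)] Q_sum[OF J(1)]
              by (simp add: subspace_add[OF P] add scale pairing_add_left pairing_scaleR_left f_def)
          qed
          then have "restrict (\<lambda>p. pairing p f) ?P = \<phi>"
            using ext by (auto simp: P_space_def restrict_def extensional_def fun_eq_iff)
          then show "\<phi> \<in> (\<lambda>f. restrict (\<lambda>p. pairing p f) ?P) ` ?D"
            unfolding f_def by (rule image_eqI[OF sym sumD])
        qed
      qed
    qed
  qed (simp_all add: pairing_add pairing_scaleR)
  ultimately show ?thesis using dual by blast
qed

end
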